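(* Let $N\ge 1$ and let $T$ be an $N$-valid tree of height $H$ with associated set $\tilde E\subset (K_1^+)^\bot$. Let $0<A\le B$ and let $m_0:X\to\mathbb C$ be a measurable function such that: (i) $m_0(\chi)=1$ for all $\chi\in (K_{-N}^+)^\bot$; (ii) for $\chi\in (K_1^+)^\bot$ one has $m_0(\chi)\neq 0$ if and only if $\chi\in\tilde E$; (iii) $A\le |m_0(\chi)|^2\le B$ for all $\chi\in\tilde E$; (iv) $m_0$ is periodic with every period $\mathbf r_1^{\bar\alpha_1}\mathbf r_2^{\bar\alpha_2}\cdots\mathbf r_\nu^{\bar\alpha_\nu}$ ($\nu\in\mathbb N$, $\bar\alpha_j\in GF(p^s)$), i.e. $m_0(\chi\,\mathbf r_1^{\bar\alpha_1}\cdots\mathbf r_\nu^{\bar\alpha_\nu})=m_0(\chi)$ for all $\chi\in X$. Let $\varphi$ be the function on $K$ whose Fourier transform is $$\hat\varphi(\chi)=\prod_{n=0}^{\infty}m_0(\chi\mathcal A^{-n}),\qquad \chi\in X$$ (for each $\chi$ all but finitely many factors equal $1$). Then $\varphi$ generates a Riesz MRA of $L_2(K)$, with Riesz constants $A^{H-N+2}$ and $B^{H-N+2}$ (i.e. the system $(\varphi(x\dot-h))_{h\in H_0}$ is a Riesz basis of $V_0$ with these constants).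
   Context: Field. Let $p$ be a prime, $s\ge1$, and $K=F^{(s)}$ the local field of characteristic $p$ whose elements are the sequences $a=(\mathbf a_n)_{n\in\mathbb Z}$, $\mathbf a_n\in GF(p^s)$, with $\mathbf a_n=0$ for all sufficiently negative $n$ (identified with Laurent series $\sum_n\mathbf a_nx^n$); addition $\dot+$, subtraction $\dot-$ and multiplication by scalars of $GF(p^s)$ are coordinatewise. $GF(p^s)$ is identified with $GF(p)^s$ as a $GF(p)$-vector space, $\mathbf a=(a^{(0)},\dots,a^{(s-1)})$, with $1=(1,0,\dots,0)$. $K^+$ is the additive group of $K$; $K_n=K_n^+=\{a\in K:\mathbf a_j=0 \text{ for } j<n\}$. $g_n$ is the sequence with $1$ in position $n$ and $0$ elsewhere. The dilation operator is $\mathcal A:\sum_n\lambda_ng_n\mapsto\sum_n\lambda_ng_{n-1}$. $\mu$ is Haar measure on $K^+$ with $\mu(K_0)=1$. $H_0=\{\mathbf a_{-1}g_{-1}\dot+\cdots\dot+\mathbf a_{-\nu}g_{-\nu}:\nu\in\mathbb N,\ \mathbf a_{-j}\in GF(p^s)\}$. Characters. $X$ is the group of characters of $K^+$, $(\chi,x)$ is the value of $\chi$ at $x$. For $k\in\mathbb Z$, $\mathbf u\in GF(p^s)$ the character $\mathbf r_k^{\mathbf u}$ is $(\mathbf r_k^{\mathbf u},a)=\exp\big(\tfrac{2\pi i}{p}\sum_{l=0}^{s-1}u^{(l)}a_k^{(l)}\big)$. Every $\chi\in X$ is uniquely $\prod_{k\in\mathbb Z}\mathbf r_k^{\mathbf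 a_k}$ with $\mathbf a_k=0$ for all large $k$. The annihilator $(K_n^+)^\bot$ is the set of characters trivial on $K_n$, i.e. those with $\mathbf a_k=0$ for $k\ge n$. $\chi\mathcal A$ is defined by $(\chi\mathcal A,x)=(\chi,\mathcal Ax)$, so $\mathbf r_j^{\mathbf u}\mathcal A=\mathbf r_{j+1}^{\mathbf u}$. $\nu$ is Haar measure on $X$ with $\nu((K_0^+)^\bot)=1$. $\hat f(\chi)=\int_Kf(x)\overline{(\chi,x)}\,d\mu(x)$, extended to $L_2$. Riesz MRA. A family $(f_j)\subset L_2(K)$ is a Riesz system with constants $A,B>0$ if for every $c=(c_j)\in\ell_2$ the series $\sum c_jf_j$ converges in $L_2(K)$ and $A\|c\|_{\ell_2}^2\le\|\sum c_jf_j\|^2_{L_2(K)}\le B\|c\|^2_{\ell_2}$; it is a Riesz basis of a closed subspace $V$ if moreover its closed linear span is $V$. A Riesz multiresolution analysis (MRA) of $L_2(K)$ is a family of closed subspaces $(V_n)_{n\in\mathbb Z}$ with: A1) $V_n\subset V_{n+1}$; A2) $\overline{\bigcup_nV_n}=L_2(K)$, $\bigcap_nV_n=\{0\}$; A3) $f(x)\in V_n\Leftrightarrow f(\mathcal Ax)\in V_{n+1}$; A4) $f(x)\in V_0\Rightarrow f(x\dot-h)\in V_0$ for all $h\in H_0$; A5) there is $\varphi\in L_2(K)$ such that $(\varphi(x\dot-h))_{h\in H_0}$ is a Riesz basis of $V_0$. A function $\varphi\in L_2(K)$ generates a Riesz MRA if the spaces $V_n=\overline{\mathrm{span}}\,\{\varphi(\mathcal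 A^nx\dot-h):h\in H_0\}$ form a Riesz MRA with scaling function $\varphi$ (i.e. A5 holds with this $\varphi$). $N$-valid trees. An $N$-valid tree is a rooted tree $T$, directed away from the root, whose nodes are labelled by elements of $GF(p^s)$, such that: the root is labelled $\mathbf 0$; for each $j=0,1,\dots,N-1$ level $j$ consists of the single node $\mathbf 0$ (the root is level $0$); every sequence $(\bar\alpha_1,\dots,\bar\alpha_N)\in GF(p^s)^N$ occurs exactly once as the labels of a directed path $\bar\alpha_1\to\cdots\to\bar\alpha_N$ (of length $N-1$) in $T$. The height $H$ is the largest level of a node (the number of edges of a longest path from the root). The set $\tilde E$ associated with $T$ is the union of $(K_{-N}^+)^\bot$ and all cosets $(K_{-N}^+)^\bot\,\mathbf r_{-N}^{\bar\beta_{-N}}\mathbf r_{-N+1}^{\bar\beta_{-N+1}}\cdots\mathbf r_{0}^{\bar\beta_{0}}$, where $\bar\beta_0\to\bar\beta_{-1}\to\cdots\to\bar\beta_{-N}$ runs over all directed paths with $N+1$ nodes in $T$ (directed away from the root). *)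

theory Defs
  imports
    "HOL-Analysis.Analysis"
    "HOL-Computational_Algebra.Formal_Laurent_Series"
begin

unbundle fps_syntax

section \<open>The field of coefficients\<close>

text \<open>
  The identification of $GF(p^s)$ with $GF(p)^s$: \<open>coord u l\<close> is the representative in
  $\{0,\dots,p-1\}$ of the $l$-th coordinate $u^{(l)}$ of \<open>u\<close>.  Over a prime field, linear maps
  are the same as additive ones.  The bijectivity forces the finite field \<open>'a\<close> to have
  $p^s$ elements.
\<close>

definition gf_coordinates :: "nat \<Rightarrow> nat \<Rightarrow> ('a::{field,finite} \<Rightarrow> nat \<Rightarrow> nat) \<Rightarrow> bool" where
  "gf_coordinates p s coord \<longleftrightarrow>
     prime p \<and> s \<ge> 1 \<and>
     bij_betw (\<lambda>u. restrict (coord u) {..<s}) UNIV ({..<s} \<rightarrow>\<^sub>E {..<p}) \<and>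
     (\<forall>u v. \<forall>l<s. coord (u + v) l = (coord u l + coord v l) mod p) \<and>
     (\<forall>l<s. coord 1 l = (if l = 0 then 1 else 0))"


section \<open>The local field and its additive group\<close>

text \<open>
  \<open>K\<close> is the type \<open>'a fls\<close> of formal Laurent series, with the topology of the library (in which
  the subgroups \<open>Ksub n\<close> are a basis of neighbourhoods of 0); the element $g_n$ is
  \<open>fls_X_intpow n\<close>, and since \<open>fls_shift n x $$ k = x $$ (k + n)\<close>, the power $\mathcal A^n$
  of the dilation operator ($n$ an integer) is \<open>fls_shift n\<close>.
\<close>

definition Ksub :: "int \<Rightarrow> 'a::zero fls set" where
  "Ksub n = {a. \<forall>j<n. a $$ j = 0}"

definition H0 :: "'a::{field,finite} fls set" where
  "H0 = {(\<Sum>j=1..n. fls_const (a j) * fls_X_intpow (- int j)) | (n::nat) a. True}"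

abbreviation dilation :: "int \<Rightarrow> 'a::{field,finite} fls \<Rightarrow> 'a fls" where
  "dilation n \<equiv> fls_shift n"

definition is_haar_K :: "'a::{field,finite} fls measure \<Rightarrow> bool" where
  "is_haar_K \<mu> \<longleftrightarrow>
     sets \<mu> = sets borel \<and> (\<forall>a. distr \<mu> borel (\<lambda>x. a + x) = \<mu>) \<and> emeasure \<mu> (Ksub 0) = 1"


section \<open>Characters\<close>

text \<open>The group of continuous unitary characters, with the compact-open topology.\<close>

typedef (overloaded) ('g::"{ab_group_add,topological_space}") character =
  "{\<xi> :: 'g \<Rightarrow> complex. continuous_on UNIV \<xi> \<and>
      (\<forall>x y. \<xi> (x + y) = \<xi> x * \<xi> y) \<and> (\<forall>x. norm (\<xi> x) = 1)}"
  morphisms char_eval Abs_character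
  by (rule exI[of _ "\<lambda>_. 1"]) auto

setup_lifting type_definition_character

instantiation character :: ("{ab_group_add,topological_space}") comm_monoid_mult
begin

lift_definition one_character :: "'a character" is "\<lambda>_. 1"
  by auto

lift_definition times_character :: "'a character \<Rightarrow> 'a character \<Rightarrow> 'a character"
  is "\<lambda>\<xi> \<psi> x. \<xi> x * \<psi> x"
  by (auto simp: norm_mult intro: continuous_intros)

instance
  by standard (transfer; auto simp: mult.assoc mult.commute)+

end

instantiation character :: ("{ab_group_add,topological_space}") topological_space
begin

definition open_character :: "'a character set \<Rightarrow> bool" where
  "open_character =
     generate_topology {{\<xi>. char_eval \<xi> ` C \<subseteq> U} | C U. compact C \<and> open U}"

instance
proof
  show "open (UNIV :: 'a character set)"
    unfolding open_character_def by (rule generate_topology.UNIV)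
next
  fix S T :: "'a character set"
  assume "open S" "open T"
  then show "open (S \<inter> T)"
    unfolding open_character_def by (rule generate_topology.Int)
next
  fix \<S> :: "'a character set set"
  assume "\<forall>S\<in>\<S>. open S"
  then show "open (\<Union>\<S>)"
    unfolding open_character_def by (intro generate_topology.UN) auto
qed

end

definition annihilator :: "'g::{ab_group_add,topological_space} set \<Rightarrow> 'g character set" where
  "annihilator S = {\<xi>. \<forall>x\<in>S. char_eval \<xi> x = 1}"

definition is_haar_X :: "'a::{field,finite} fls character measure \<Rightarrow> bool" where
  "is_haar_X \<nu> \<longleftrightarrow>
     sets \<nu> = sets borel \<and> (\<forall>\<psi>. distr \<nu> borel (\<lambda>\<xi>. \<psi> * \<xi>) = \<nu>) \<and>
     emeasure \<nu> (annihilator (Ksub 0)) = 1"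

lemma fls_subdegree_gt_if_dist_less:
  fixes a b :: "'a::group_add fls"
  assumes d: "dist a b < inverse (2 ^ m)" and "a \<noteq> b"
  shows "int m < fls_subdegree (a - b)"
proof (rule ccontr)
  assume less: "\<not> ?thesis"
  show False
  proof (cases "fls_subdegree (a - b) \<ge> 0")
    case True
    with less have "nat (fls_subdegree (a - b)) \<le> m" by linarith
    then have "(2::real) ^ nat (fls_subdegree (a - b)) \<le> 2 ^ m"
      by (intro power_increasing) auto
    then have "inverse (2 ^ m) \<le> inverse ((2::real) ^ nat (fls_subdegree (a - b)))"
      by (intro le_imp_inverse_le) auto
    moreover have "dist a b = inverse (2 ^ nat (fls_subdegree (a - b)))"
      using \<open>a \<noteq> b\<close> True by (simp add: dist_fls_def)
    ultimately show False using d by linarith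
  next
    case False
    have "inverse ((2::real) ^ m) \<le> 1"
      using one_le_power[of "2::real" m] by (simp add: inverse_le_1_iff)
    moreover have "(1::real) \<le> 2 ^ nat (- fls_subdegree (a - b))"
      by (rule one_le_power) simp
    moreover have "dist a b = 2 ^ nat (- fls_subdegree (a - b))"
      using \<open>a \<noteq> b\<close> False by (simp add: dist_fls_def)
    ultimately show False using d by linarith
  qed
qed

lemma fls_nth_eq_if_dist_less:
  fixes a b :: "'a::group_add fls"
  assumes "dist a b < inverse (2 ^ nat \<bar>k\<bar>)"
  shows "a $$ k = b $$ k"
proof (cases "a = b")
  case False
  then have "k < fls_subdegree (a - b)"
    using fls_subdegree_gt_if_dist_less[OF assms] by linarith
  then have "(a - b) $$ k = 0" by (rule fls_eq0_below_subdegree)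
  then show ?thesis by simp
qed simp

lemma continuous_on_fls_nth:
  fixes f :: "'a::group_add \<Rightarrow> 'b::topological_space"
  shows "continuous_on UNIV (\<lambda>a. f (a $$ k))"
  unfolding continuous_on_def
proof
  fix x :: "'a fls"
  have "eventually (\<lambda>y. dist y x < inverse (2 ^ nat \<bar>k\<bar>)) (nhds x)"
    unfolding eventually_nhds_metric by (intro exI[of _ "inverse (2 ^ nat \<bar>k\<bar>)"]) auto
  then have "eventually (\<lambda>y. f (y $$ k) = f (x $$ k)) (nhds x)"
    by eventually_elim (simp add: fls_nth_eq_if_dist_less)
  then have "eventually (\<lambda>y. f (y $$ k) = f (x $$ k)) (at x)"
    by (simp add: eventually_at_filter eventually_mono)
  then show "((\<lambda>a. f (a $$ k)) \<longlongrightarrow> f (x $$ k)) (at x)"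
    by (rule tendsto_eventually)
qed

lemma continuous_on_fls_shift:
  "continuous_on UNIV (fls_shift n :: 'a::group_add fls \<Rightarrow> 'a fls)"
  unfolding continuous_on_iff
proof (intro ballI allI impI)
  fix x :: "'a fls" and e :: real
  assume "e > 0"
  obtain m :: nat where m: "inverse (2 ^ m) < e"
    using real_arch_pow_inv[of e "1/2"] \<open>e > 0\<close> by (auto simp: power_one_over inverse_eq_divide)
  show "\<exists>d>0. \<forall>y\<in>UNIV. dist y x < d \<longrightarrow> dist (fls_shift n y) (fls_shift n x) < e"
  proof (intro exI[of _ "inverse (2 ^ (m + nat \<bar>n\<bar>) :: real)"] conjI ballI impI)
    fix y :: "'a fls"
    assume d: "dist y x < inverse (2 ^ (m + nat \<bar>n\<bar>))"
    show "dist (fls_shift n y) (fls_shift n x) < e"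
    proof (cases "y = x")
      case True
      then show ?thesis using \<open>e > 0\<close> by simp
    next
      case False
      have ge: "int (m + nat \<bar>n\<bar>) \<le> fls_subdegree (y - x)"
        using fls_subdegree_gt_if_dist_less[OF d False] by linarith
      have neq: "fls_shift n y \<noteq> fls_shift n x" using False fls_shift_eq_iff[of n y x] by blast
      have diff: "fls_shift n y - fls_shift n x = fls_shift n (y - x)"
        by (rule fls_eqI) simp
      have sd: "fls_subdegree (fls_shift n y - fls_shift n x) = fls_subdegree (y - x) - n"
        unfolding diff using False by (intro fls_shift_subdegree) simp
      have "int m \<le> fls_subdegree (y - x) - n" using ge by linarith
      then have "m \<le> nat (fls_subdegree (y - x) - n)" "0 \<le> fls_subdegree (y - x) - n" by linarith+
      then have "dist (fls_shift n y) (fls_shift n x) = inverse (2 ^ nat (fls_subdegree (y - x) - n))"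
        using neq sd by (simp add: dist_fls_def)
      also have "\<dots> \<le> inverse (2 ^ m)"
        using \<open>m \<le> nat (fls_subdegree (y - x) - n)\<close>
        by (intro le_imp_inverse_le power_increasing) auto
      also have "\<dots> < e" by (rule m)
      finally show ?thesis .
    qed
  qed auto
qed

text \<open>\<open>char_dilation n \<xi>\<close> is $\chi\mathcal A^n$, that is, $(\chi\mathcal A^n, x) = (\chi, \mathcal A^n x)$.\<close>

lift_definition char_dilation ::
    "int \<Rightarrow> 'a::{field,finite} fls character \<Rightarrow> 'a fls character"
  is "\<lambda>n \<xi> x. \<xi> (dilation n x)"
proof -
  fix n :: int and \<xi> :: "'a fls \<Rightarrow> complex"
  assume \<xi>: "continuous_on UNIV \<xi> \<and>
    (\<forall>x y. \<xi> (x + y) = \<xi> x * \<xi> y) \<and> (\<forall>x. norm (\<xi> x) = 1)"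
  then have "continuous_on UNIV (\<lambda>x. \<xi> (dilation n x))"
    using continuous_on_compose2[of UNIV \<xi> UNIV "fls_shift n"] continuous_on_fls_shift[of n] by auto
  moreover have "dilation n (x + y) = dilation n x + dilation n y" for x y :: "'a fls"
    by (rule fls_eqI) simp
  ultimately show "continuous_on UNIV (\<lambda>x. \<xi> (dilation n x)) \<and>
      (\<forall>x y. \<xi> (dilation n (x + y)) = \<xi> (dilation n x) * \<xi> (dilation n y)) \<and>
      (\<forall>x. norm (\<xi> (dilation n x)) = 1)"
    using \<xi> by simp
qed

text \<open>
  The character $\mathbf r_k^{\mathbf u}$; the function below is a character whenever \<open>coord\<close>
  is a coordinate system, see \<open>char_eval_rademacher\<close>.
\<close>

definition rademacher ::
    "nat \<Rightarrow> nat \<Rightarrow> ('a::{field,finite} \<Rightarrow> nat \<Rightarrow> nat) \<Rightarrow> int \<Rightarrow> 'a \<Rightarrow> 'a fls character" where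
  "rademacher p s coord k u =
     Abs_character (\<lambda>a. exp (2 * of_real pi * \<i> / of_nat p *
                             of_nat (\<Sum>l<s. coord u l * coord (a $$ k) l)))"

lemma exp_root_unity_mod:
  assumes "p > 0" "m mod p = n mod p"
  shows "exp (2 * of_real pi * \<i> / of_nat p * of_nat m) = exp (2 * of_real pi * \<i> / of_nat p * of_nat n)"
proof -
  have main: "exp (2 * of_real pi * \<i> / of_nat p * of_nat m) =
      exp (2 * of_real pi * \<i> / of_nat p * of_nat (m mod p))" for m
  proof -
    have "(of_nat m :: complex) = of_nat p * of_nat (m div p) + of_nat (m mod p)"
      by (metis mult_div_mod_eq of_nat_add of_nat_mult)
    then have "2 * of_real pi * \<i> / of_nat p * of_nat m =
        2 * of_real pi * \<i> * of_nat (m div p) + 2 * of_real pi * \<i> / of_nat p * of_nat (m mod p)"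
      using assms(1) by (simp add: field_simps)
    moreover have "exp (2 * of_real pi * \<i> * of_nat (m div p)) = 1"
      using exp_of_nat_mult[of "m div p" "2 * of_real pi * \<i>"] by (simp add: mult_ac)
    ultimately show ?thesis by (simp add: exp_add)
  qed
  from main[of m] main[of n] assms(2) show ?thesis by simp
qed

lemma char_eval_rademacher:
  assumes "gf_coordinates p s coord"
  shows "char_eval (rademacher p s coord k u) a =
    exp (2 * of_real pi * \<i> / of_nat p * of_nat (\<Sum>l<s. coord u l * coord (a $$ k) l))"
proof -
  let ?e = "\<lambda>m::nat. exp (2 * of_real pi * \<i> / of_nat p * of_nat m) :: complex"
  have p: "p > 0" using assms prime_gt_0_nat by (auto simp: gf_coordinates_def)
  have mult: "?e (\<Sum>l<s. coord u l * coord ((x + y) $$ k) l) =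
      ?e (\<Sum>l<s. coord u l * coord (x $$ k) l) * ?e (\<Sum>l<s. coord u l * coord (y $$ k) l)" for x y
  proof -
    have *: "coord u l * coord ((x + y) $$ k) l mod p =
        (coord u l * coord (x $$ k) l + coord u l * coord (y $$ k) l) mod p" if "l < s" for l
      using assms that by (simp add: gf_coordinates_def mod_mult_right_eq flip: distrib_left)
    have "(\<Sum>l<s. coord u l * coord ((x + y) $$ k) l) mod p =
        (\<Sum>l<s. coord u l * coord ((x + y) $$ k) l mod p) mod p"
      by (simp only: mod_sum_eq)
    also have "\<dots> = (\<Sum>l<s. (coord u l * coord (x $$ k) l + coord u l * coord (y $$ k) l) mod p) mod p"
      using * by simp
    also have "\<dots> = (\<Sum>l<s. coord u l * coord (x $$ k) l + coord u l * coord (y $$ k) l) mod p"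
      by (simp only: mod_sum_eq)
    finally have "(\<Sum>l<s. coord u l * coord ((x + y) $$ k) l) mod p = \<dots>" .
    from exp_root_unity_mod[OF p this] show ?thesis
      by (simp add: sum.distrib distrib_left flip: exp_add)
  qed
  have "norm (?e m) = 1" for m
    using norm_exp_i_times[of "2 * pi / real p * real m"] by (simp add: mult_ac)
  moreover have "continuous_on UNIV (\<lambda>a. ?e (\<Sum>l<s. coord u l * coord (a $$ k) l))"
    using continuous_on_fls_nth[of "\<lambda>v. ?e (\<Sum>l<s. coord u l * coord v l)" k] .
  ultimately show ?thesis
    unfolding rademacher_def using mult by (subst Abs_character_inverse) auto
qed


section \<open>The Hilbert space $L_2$ and the Fourier transform\<close>

text \<open>
  Elements of $L_2$ are represented by square-integrable functions; subspaces of $L_2$ are sets of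
  such functions that are closed under equality almost everywhere.
\<close>

definition L2 :: "'b measure \<Rightarrow> ('b \<Rightarrow> complex) set" where
  "L2 M = {f \<in> borel_measurable M. integrable M (\<lambda>x. (cmod (f x))\<^sup>2)}"

definition L2_norm :: "'b measure \<Rightarrow> ('b \<Rightarrow> complex) \<Rightarrow> real" where
  "L2_norm M f = sqrt (\<integral>x. (cmod (f x))\<^sup>2 \<partial>M)"

definition L2_tendsto ::
    "'b measure \<Rightarrow> ('i \<Rightarrow> 'b \<Rightarrow> complex) \<Rightarrow> ('b \<Rightarrow> complex) \<Rightarrow> 'i filter \<Rightarrow> bool" where
  "L2_tendsto M f g F \<longleftrightarrow>
     g \<in> L2 M \<and> eventually (\<lambda>i. f i \<in> L2 M) F \<and>
     ((\<lambda>i. L2_norm M (\<lambda>x. f i x - g x)) \<longlongrightarrow> 0) F"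

definition L2_closure :: "'b measure \<Rightarrow> ('b \<Rightarrow> complex) set \<Rightarrow> ('b \<Rightarrow> complex) set" where
  "L2_closure M U = {f \<in> L2 M. \<forall>\<epsilon>>0. \<exists>g\<in>U. L2_norm M (\<lambda>x. f x - g x) < \<epsilon>}"

definition L2_closed_span :: "'b measure \<Rightarrow> ('b \<Rightarrow> complex) set \<Rightarrow> ('b \<Rightarrow> complex) set" where
  "L2_closed_span M S =
     L2_closure M {(\<lambda>x. \<Sum>f\<in>F. c f * f x) | F c. finite F \<and> F \<subseteq> S}"

definition L2_closed_subspace :: "'b measure \<Rightarrow> ('b \<Rightarrow> complex) set \<Rightarrow> bool" where
  "L2_closed_subspace M V \<longleftrightarrow>
     V \<subseteq> L2 M \<and> (\<lambda>_. 0) \<in> V \<and>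
     (\<forall>f\<in>V. \<forall>g\<in>V. (\<lambda>x. f x + g x) \<in> V) \<and> (\<forall>c. \<forall>f\<in>V. (\<lambda>x. c * f x) \<in> V) \<and>
     L2_closure M V = V"

definition fourier ::
    "'a::{field,finite} fls measure \<Rightarrow> ('a fls \<Rightarrow> complex) \<Rightarrow> 'a fls character \<Rightarrow> complex" where
  "fourier \<mu> f \<xi> = (\<integral>x. f x * cnj (char_eval \<xi> x) \<partial>\<mu>)"

text \<open>
  \<open>has_L2_fourier \<mu> \<nu> f F\<close>: the $L_2$ Fourier transform of \<open>f\<close> is (the class of) \<open>F\<close>, where the
  transform is extended by continuity from $L_1\cap L_2$ to $L_2$.
\<close>

definition has_L2_fourier ::
    "'a::{field,finite} fls measure \<Rightarrow> 'a fls character measure \<Rightarrow>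
     ('a fls \<Rightarrow> complex) \<Rightarrow> ('a fls character \<Rightarrow> complex) \<Rightarrow> bool" where
  "has_L2_fourier \<mu> \<nu> f F \<longleftrightarrow>
     (\<exists>g :: nat \<Rightarrow> 'a fls \<Rightarrow> complex.
        (\<forall>n. integrable \<mu> (g n) \<and> g n \<in> L2 \<mu>) \<and>
        L2_tendsto \<mu> g f sequentially \<and>
        L2_tendsto \<nu> (\<lambda>n. fourier \<mu> (g n)) F sequentially)"


section \<open>Riesz multiresolution analyses\<close>

definition riesz_system ::
    "'b measure \<Rightarrow> real \<Rightarrow> real \<Rightarrow> 'i set \<Rightarrow> ('i \<Rightarrow> 'b \<Rightarrow> complex) \<Rightarrow> bool" where
  "riesz_system M A B J f \<longleftrightarrow>
     0 < A \<and> 0 < B \<and> (\<forall>j\<in>J. f j \<in> L2 M) \<and>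
     (\<forall>c :: 'i \<Rightarrow> complex. (\<lambda>j. (cmod (c j))\<^sup>2) summable_on J \<longrightarrow>
        (\<exists>g. L2_tendsto M (\<lambda>F x. \<Sum>j\<in>F. c j * f j x) g (finite_subsets_at_top J) \<and>
             A * (\<Sum>\<^sub>\<infinity>j\<in>J. (cmod (c j))\<^sup>2) \<le> (L2_norm M g)\<^sup>2 \<and>
             (L2_norm M g)\<^sup>2 \<le> B * (\<Sum>\<^sub>\<infinity>j\<in>J. (cmod (c j))\<^sup>2)))"

definition riesz_basis ::
    "'b measure \<Rightarrow> real \<Rightarrow> real \<Rightarrow> 'i set \<Rightarrow> ('i \<Rightarrow> 'b \<Rightarrow> complex) \<Rightarrow> ('b \<Rightarrow> complex) set \<Rightarrow> bool" where
  "riesz_basis M A B J f V \<longleftrightarrow> riesz_system M A B J f \<and> L2_closed_span M (f ` J) = V"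

definition riesz_MRA ::
    "'a::{field,finite} fls measure \<Rightarrow> (int \<Rightarrow> ('a fls \<Rightarrow> complex) set) \<Rightarrow> bool" where
  "riesz_MRA \<mu> V \<longleftrightarrow>
     (\<forall>n. L2_closed_subspace \<mu> (V n)) \<and>
     (\<forall>n. V n \<subseteq> V (n + 1)) \<and>
     L2_closure \<mu> (\<Union>n. V n) = L2 \<mu> \<and>
     (\<Inter>n. V n) = {f \<in> L2 \<mu>. AE x in \<mu>. f x = 0} \<and>
     (\<forall>n. \<forall>f \<in> L2 \<mu>. f \<in> V n \<longleftrightarrow> (\<lambda>x. f (dilation 1 x)) \<in> V (n + 1)) \<and>
     (\<forall>f \<in> V 0. \<forall>h\<in>H0. (\<lambda>x. f (x - h)) \<in> V 0) \<and>
     (\<exists>\<phi> \<in> L2 \<mu>. \<exists>A B. riesz_basis \<mu> A B H0 (\<lambda>h x. \<phi> (x - h)) (V 0))"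

definition MRA_space ::
    "'a::{field,finite} fls measure \<Rightarrow> ('a fls \<Rightarrow> complex) \<Rightarrow> int \<Rightarrow> ('a fls \<Rightarrow> complex) set" where
  "MRA_space \<mu> \<phi> n = L2_closed_span \<mu> ((\<lambda>h x. \<phi> (dilation n x - h)) ` H0)"

text \<open>\<open>\<phi>\<close> generates a Riesz MRA in which its shifts have the Riesz constants \<open>A\<close> and \<open>B\<close>.\<close>

definition generates_riesz_MRA ::
    "'a::{field,finite} fls measure \<Rightarrow> real \<Rightarrow> real \<Rightarrow> ('a fls \<Rightarrow> complex) \<Rightarrow> bool" where
  "generates_riesz_MRA \<mu> A B \<phi> \<longleftrightarrow>
     \<phi> \<in> L2 \<mu> \<and> riesz_MRA \<mu> (MRA_space \<mu> \<phi>) \<and>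
     riesz_basis \<mu> A B H0 (\<lambda>h x. \<phi> (x - h)) (MRA_space \<mu> \<phi> 0)"


section \<open>$N$-valid trees\<close>

definition dpath :: "'v set \<Rightarrow> ('v \<times> 'v) set \<Rightarrow> 'v list \<Rightarrow> bool" where
  "dpath V E xs \<longleftrightarrow> xs \<noteq> [] \<and> set xs \<subseteq> V \<and> successively (\<lambda>u v. (u, v) \<in> E) xs"

definition rooted_tree :: "'v set \<Rightarrow> ('v \<times> 'v) set \<Rightarrow> 'v \<Rightarrow> bool" where
  "rooted_tree V E r \<longleftrightarrow>
     r \<in> V \<and> E \<subseteq> V \<times> V \<and> (\<forall>v\<in>V. \<exists>!xs. dpath V E xs \<and> hd xs = r \<and> last xs = v)"

definition tree_level :: "'v set \<Rightarrow> ('v \<times> 'v) set \<Rightarrow> 'v \<Rightarrow> 'v \<Rightarrow> nat" where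
  "tree_level V E r v = length (THE xs. dpath V E xs \<and> hd xs = r \<and> last xs = v) - 1"

text \<open>
  Only used for \<open>N\<close>-valid trees, which are finite: every node of level at least \<open>N - 1\<close> is the end
  of a directed path with \<open>N\<close> nodes, and there are only finitely many of those.
\<close>

definition tree_height :: "'v set \<Rightarrow> ('v \<times> 'v) set \<Rightarrow> 'v \<Rightarrow> nat" where
  "tree_height V E r = Max (tree_level V E r ` V)"

definition N_valid_tree ::
    "nat \<Rightarrow> 'v set \<Rightarrow> ('v \<times> 'v) set \<Rightarrow> 'v \<Rightarrow> ('v \<Rightarrow> 'a::{field,finite}) \<Rightarrow> bool" where
  "N_valid_tree N V E r lab \<longleftrightarrow>
     rooted_tree V E r \<and> lab r = 0 \<and>
     (\<forall>j<N. \<exists>v. {u \<in> V. tree_level V E r u = j} = {v} \<and> lab v = 0) \<and>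
     (\<forall>\<alpha>. length \<alpha> = N \<longrightarrow> (\<exists>!xs. dpath V E xs \<and> map lab xs = \<alpha>))"

text \<open>In a path \<open>xs\<close> with \<open>N + 1\<close> nodes, the label $\bar\beta_{-j}$ is that of \<open>xs ! j\<close>.\<close>

definition tree_set ::
    "nat \<Rightarrow> nat \<Rightarrow> ('a::{field,finite} \<Rightarrow> nat \<Rightarrow> nat) \<Rightarrow>
     nat \<Rightarrow> 'v set \<Rightarrow> ('v \<times> 'v) set \<Rightarrow> ('v \<Rightarrow> 'a) \<Rightarrow> 'a fls character set" where
  "tree_set p s coord N V E lab =
     annihilator (Ksub (- int N)) \<union>
     (\<Union>xs \<in> {xs. dpath V E xs \<and> length xs = N + 1}.
        (\<lambda>\<xi>. \<xi> * (\<Prod>j\<le>N. rademacher p s coord (- int j) (lab (xs ! j)))) `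
          annihilator (Ksub (- int N)))"

end

(*
The character group X is identified with K itself: the character of b in K takes the value
prod_k psi (b_{-1-k}) (x_k) at x, where psi is a nondegenerate symmetric bicharacter of GF(p^s). This
pairing is symmetric, makes K_n and H0 satisfy K_n^bot = K_{-n} and H0^bot = H0, turns the dilation of
characters into the dilation of K, and carries one Haar measure to the other. The Fourier transform
therefore becomes a transform of L2(K), and Plancherel's theorem follows by duality from the
multiplication formula, since the span of the modulated indicators of balls is dense and is mapped
onto itself.

Let F be the product of the dilated masks. For given digits b_0, ..., b_{N-1} the tree contains one path
with these labels; F b is nonzero only if the digits b_{-1}, b_{-2}, ... are the labels met on the way
from that path to the root, followed by zeros. Hence F has compact support, the sum of |F|^2 over an
H0-coset has a single nonzero term, and that term is a product of at most H - N + 1 values of |m0|^2 in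
[A, B]. As m0 = 1 occurs, A <= 1 <= B, which gives the Riesz bounds. Multiplying F by a bounded
H0-periodic function stays in the transform of V 0; applied to the refinement equation this yields
V 0 <= V 1, applied to the indicator of H0 + K_N it yields the indicator of K_{-N} in V 0 and hence
density. Finally, functions in V n are invariant under a ball that grows to K as n decreases, so the
intersection is trivial.
*)

theory Submission
  imports Defs
begin

section \<open>Square-integrable functions\<close>

text \<open>The tree acts through one mechanism. A window of N consecutive digits names exactly one
  directed path with N nodes, and a node other than the root has exactly one parent, so a nonzero
  value of the next dilated mask fixes the next digit to the left. A path with N zero labels can
  only be the initial segment of the tree, hence nothing but zeros can follow once the root is
  reached. If the path of the digits 0, ..., N - 1 starts at level L, it ends at level L + N - 1 <=
  H, so at most H - N + 1 factors differ from 1; the exponent H - N + 2 leaves one spare factor,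
  absorbed by A <= 1 <= B. The subtraction on naturals does not truncate: the path labelled 0, ...,
  0, 1 ends at level at least N, since all smaller levels carry the label 0. The analytic obstacle
  is that the transform on L2 is defined through arbitrary integrable approximating sequences, so
  the isometry on test functions does not carry over by density alone. Testing both functions
  against the dense family treats every such sequence at once.\<close>

lemma L2_borel: "f \<in> L2 M \<Longrightarrow> f \<in> borel_measurable M"
  and L2_integrable: "f \<in> L2 M \<Longrightarrow> integrable M (\<lambda>x. (cmod (f x))\<^sup>2)"
  by (auto simp: L2_def)

lemma L2_bound:
  assumes "f \<in> L2 M" "g \<in> borel_measurable M" "AE x in M. cmod (g x) \<le> C * cmod (f x)"
  shows "g \<in> L2 M"
proof -
  have "integrable M (\<lambda>x. C\<^sup>2 * (cmod (f x))\<^sup>2)"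
    using assms(1) by (simp add: L2_def)
  moreover have "AE x in M. norm ((cmod (g x))\<^sup>2) \<le> norm (C\<^sup>2 * (cmod (f x))\<^sup>2)"
    using assms(3)
  proof eventually_elim
    case (elim x)
    then have "(cmod (g x))\<^sup>2 \<le> (C * cmod (f x))\<^sup>2"
      by (intro power_mono) auto
    then show ?case by (simp add: power_mult_distrib)
  qed
  moreover have "(\<lambda>x. (cmod (g x))\<^sup>2) \<in> borel_measurable M"
    using assms(2) by measurable
  ultimately have "integrable M (\<lambda>x. (cmod (g x))\<^sup>2)"
    using Bochner_Integration.integrable_bound by blast
  then show ?thesis
    using assms(2) unfolding L2_def by simp
qed

lemma L2_zero [simp]: "(\<lambda>_. 0) \<in> L2 M"
  by (simp add: L2_def)

lemma L2_add:
  assumes "f \<in> L2 M" "g \<in> L2 M"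
  shows "(\<lambda>x. f x + g x) \<in> L2 M"
proof -
  have [measurable]: "f \<in> borel_measurable M" "g \<in> borel_measurable M"
    using assms by (auto simp: L2_def)
  have int: "integrable M (\<lambda>x. 2 * (cmod (f x))\<^sup>2 + 2 * (cmod (g x))\<^sup>2)"
    using assms by (auto simp: L2_def)
  have "(cmod (f x + g x))\<^sup>2 \<le> 2 * (cmod (f x))\<^sup>2 + 2 * (cmod (g x))\<^sup>2" for x
  proof -
    have "(cmod (f x + g x))\<^sup>2 \<le> (cmod (f x) + cmod (g x))\<^sup>2"
      by (intro power_mono norm_triangle_ineq) auto
    also have "\<dots> \<le> 2 * (cmod (f x))\<^sup>2 + 2 * (cmod (g x))\<^sup>2"
      using zero_le_power2[of "cmod (f x) - cmod (g x)"] by (simp add: power2_eq_square algebra_simps)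
    finally show ?thesis .
  qed
  then have "AE x in M. norm ((cmod (f x + g x))\<^sup>2) \<le> norm (2 * (cmod (f x))\<^sup>2 + 2 * (cmod (g x))\<^sup>2)"
    by simp
  moreover have "(\<lambda>x. (cmod (f x + g x))\<^sup>2) \<in> borel_measurable M"
    by measurable
  ultimately have "integrable M (\<lambda>x. (cmod (f x + g x))\<^sup>2)"
    using Bochner_Integration.integrable_bound[OF int] by blast
  then show ?thesis unfolding L2_def by simp
qed

lemma L2_scale: "f \<in> L2 M \<Longrightarrow> (\<lambda>x. c * f x) \<in> L2 M"
  by (auto simp: L2_def norm_mult power_mult_distrib)

lemma L2_diff: "f \<in> L2 M \<Longrightarrow> g \<in> L2 M \<Longrightarrow> (\<lambda>x. f x - g x) \<in> L2 M"
  using L2_add[of f M "\<lambda>x. -1 * g x"] L2_scale[of g M "-1"] by simp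

lemma borel_measurable_cnj [measurable (raw)]:
  "f \<in> borel_measurable M \<Longrightarrow> (\<lambda>x. cnj (f x)) \<in> borel_measurable M"
  by (rule measurable_compose[OF _ borel_measurable_continuous_onI]) (auto intro: continuous_intros)

lemma L2_cnj: "f \<in> L2 M \<Longrightarrow> (\<lambda>x. cnj (f x)) \<in> L2 M"
  by (auto simp: L2_def)

lemma L2_sum: "(\<And>i. i \<in> I \<Longrightarrow> f i \<in> L2 M) \<Longrightarrow> (\<lambda>x. \<Sum>i\<in>I. f i x) \<in> L2 M"
  by (induction I rule: infinite_finite_induct) (auto intro: L2_add)

lemma L2_mult_integrable:
  assumes "f \<in> L2 M" "g \<in> L2 M"
  shows "integrable M (\<lambda>x. f x * g x)"
proof -
  have [measurable]: "f \<in> borel_measurable M" "g \<in> borel_measurable M"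
    using assms by (auto simp: L2_def)
  have int: "integrable M (\<lambda>x. (cmod (f x))\<^sup>2 + (cmod (g x))\<^sup>2)"
    using assms by (auto simp: L2_def)
  have le: "cmod (f x * g x) \<le> (cmod (f x))\<^sup>2 + (cmod (g x))\<^sup>2" for x
  proof -
    have "2 * (cmod (f x) * cmod (g x)) \<le> (cmod (f x))\<^sup>2 + (cmod (g x))\<^sup>2"
      using zero_le_power2[of "cmod (f x) - cmod (g x)"] by (simp add: power2_eq_square algebra_simps)
    moreover have "0 \<le> cmod (f x) * cmod (g x)" by simp
    ultimately show ?thesis unfolding norm_mult by linarith
  qed
  have "AE x in M. norm (f x * g x) \<le> norm ((cmod (f x))\<^sup>2 + (cmod (g x))\<^sup>2)"
    using le by simp
  then show ?thesis
    using Bochner_Integration.integrable_bound[OF int, of "\<lambda>x. f x * g x"] by simp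
qed

section \<open>The norm, the Cauchy-Schwarz inequality and the triangle inequality\<close>

lemma L2_norm_nonneg [simp]: "0 \<le> L2_norm M f"
  by (simp add: L2_norm_def)

lemma L2_norm_power2: "(L2_norm M f)\<^sup>2 = (\<integral>x. (cmod (f x))\<^sup>2 \<partial>M)"
  by (simp add: L2_norm_def)

lemma L2_norm_cnj: "L2_norm M (\<lambda>x. cnj (f x)) = L2_norm M f"
  by (simp add: L2_norm_def)

lemma L2_norm_zero [simp]: "L2_norm M (\<lambda>_. 0) = 0"
  by (simp add: L2_norm_def)

lemma L2_norm_scale: "L2_norm M (\<lambda>x. c * f x) = cmod c * L2_norm M f"
  by (simp add: L2_norm_def norm_mult power_mult_distrib real_sqrt_mult)

lemma L2_norm_minus_commute: "L2_norm M (\<lambda>x. f x - g x) = L2_norm M (\<lambda>x. g x - f x)"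
  by (simp add: L2_norm_def norm_minus_commute)

lemma L2_norm_cong_AE:
  assumes "f \<in> L2 M" "g \<in> L2 M" "AE x in M. f x = g x"
  shows "L2_norm M f = L2_norm M g"
proof -
  have [measurable]: "f \<in> borel_measurable M" "g \<in> borel_measurable M"
    using assms by (auto simp: L2_def)
  show ?thesis unfolding L2_norm_def using assms(3)
    by (intro arg_cong[of _ _ sqrt] integral_cong_AE) auto
qed

lemma L2_norm_eq_0_iff:
  assumes "f \<in> L2 M"
  shows "L2_norm M f = 0 \<longleftrightarrow> (AE x in M. f x = 0)"
  using integral_nonneg_eq_0_iff_AE[OF L2_integrable[OF assms]] by (simp add: L2_norm_def)

lemma nn_integral_cmod_power2:
  assumes "f \<in> L2 M"
  shows "(\<integral>\<^sup>+x. ennreal ((cmod (f x))\<^sup>2) \<partial>M) = ennreal ((L2_norm M f)\<^sup>2)"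
  unfolding L2_norm_power2 using assms by (intro nn_integral_eq_integral) (auto simp: L2_def)

text \<open>Phrased with the extended integral because Fatou's lemma delivers its estimate there,
  before square-integrability is known.\<close>

lemma L2_normI_nn:
  assumes "f \<in> borel_measurable M" "C \<ge> 0"
    and "(\<integral>\<^sup>+x. ennreal ((cmod (f x))\<^sup>2) \<partial>M) \<le> ennreal (C\<^sup>2)"
  shows "f \<in> L2 M" "L2_norm M f \<le> C"
proof -
  have "integrable M (\<lambda>x. (cmod (f x))\<^sup>2)"
    using assms le_less_trans[OF assms(3)] by (intro integrableI_bounded) auto
  then show f: "f \<in> L2 M" using assms by (simp add: L2_def)
  have "ennreal ((L2_norm M f)\<^sup>2) \<le> ennreal (C\<^sup>2)"
    using assms(3) unfolding nn_integral_cmod_power2[OF f] .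
  then have "(L2_norm M f)\<^sup>2 \<le> C\<^sup>2" by (simp only: ennreal_le_iff zero_le_power2)
  then show "L2_norm M f \<le> C" using assms(2) by (rule power2_le_imp_le)
qed

lemma L2_norm_mono:
  assumes "g \<in> L2 M" "f \<in> borel_measurable M" "C \<ge> 0"
    and "AE x in M. cmod (f x) \<le> C * cmod (g x)"
  shows "f \<in> L2 M" "L2_norm M f \<le> C * L2_norm M g"
proof -
  show f: "f \<in> L2 M" using L2_bound[OF assms(1,2,4)] .
  have "(\<integral>x. (cmod (f x))\<^sup>2 \<partial>M) \<le> (\<integral>x. C\<^sup>2 * (cmod (g x))\<^sup>2 \<partial>M)"
  proof (rule integral_mono_AE)
    show "AE x in M. (cmod (f x))\<^sup>2 \<le> C\<^sup>2 * (cmod (g x))\<^sup>2"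
      using assms(4)
      by eventually_elim (metis norm_ge_zero power_mono power_mult_distrib)
  qed (use f assms(1) in \<open>auto simp: L2_def\<close>)
  also have "\<dots> = (C * L2_norm M g)\<^sup>2"
    by (simp add: L2_norm_power2 power_mult_distrib)
  finally show "L2_norm M f \<le> C * L2_norm M g"
    unfolding L2_norm_power2[symmetric] by (rule power2_le_imp_le) (use assms(3) in simp)
qed

lemma L2_Cauchy_Schwarz:
  assumes f: "f \<in> L2 M" and g: "g \<in> L2 M"
  shows "(\<integral>x. cmod (f x) * cmod (g x) \<partial>M) \<le> L2_norm M f * L2_norm M g"
    and "cmod (\<integral>x. f x * g x \<partial>M) \<le> L2_norm M f * L2_norm M g"
proof -
  define a b c where "a = (\<integral>x. (cmod (f x))\<^sup>2 \<partial>M)" and "b = (\<integral>x. cmod (f x) * cmod (g x) \<partial>M)"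
    and "c = (\<integral>x. (cmod (g x))\<^sup>2 \<partial>M)"
  have fg: "integrable M (\<lambda>x. cmod (f x) * cmod (g x))"
    using integrable_norm[OF L2_mult_integrable[OF f g]] by (simp add: norm_mult)
  have quad: "0 \<le> t\<^sup>2 * a - 2 * t * b + c" for t
  proof -
    have "0 \<le> (\<integral>x. (t * cmod (f x) - cmod (g x))\<^sup>2 \<partial>M)" by simp
    also have "\<dots> = (\<integral>x. t\<^sup>2 * (cmod (f x))\<^sup>2 - 2 * t * (cmod (f x) * cmod (g x)) + (cmod (g x))\<^sup>2 \<partial>M)"
      by (simp add: power2_eq_square algebra_simps)
    also have "\<dots> = t\<^sup>2 * a - 2 * t * b + c"
      using f g fg by (simp add: a_def b_def c_def L2_def)
    finally show ?thesis .
  qed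
  have "0 \<le> a" "0 \<le> b" "0 \<le> c" by (simp_all add: a_def b_def c_def)
  have "b\<^sup>2 \<le> a * c"
  proof (cases "a = 0")
    case True
    have "b = 0"
    proof (rule ccontr)
      assume "b \<noteq> 0"
      \<comment> \<open>With a = 0 the form is linear in t, and this t gives it the value
        -1.\<close>
      then show False
        using quad[of "(c + 1) / (2 * b)"] True by simp
    qed
    then show ?thesis using \<open>0 \<le> a\<close> \<open>0 \<le> c\<close> by simp
  next
    case False
    have "(b / a)\<^sup>2 * a = b\<^sup>2 / a" "2 * (b / a) * b = 2 * (b\<^sup>2 / a)"
      using False by (simp_all add: power2_eq_square field_simps)
    \<comment> \<open>The quadratic is minimal at t = b / a.\<close>
    then have "b\<^sup>2 / a \<le> c" using quad[of "b / a"] by linarith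
    then show ?thesis using False \<open>0 \<le> a\<close> by (simp add: divide_le_eq mult.commute)
  qed
  then have "b \<le> sqrt (a * c)" using \<open>0 \<le> b\<close> by (simp add: real_le_rsqrt)
  then show *: "(\<integral>x. cmod (f x) * cmod (g x) \<partial>M) \<le> L2_norm M f * L2_norm M g"
    by (simp add: a_def b_def c_def L2_norm_def real_sqrt_mult)
  have "cmod (\<integral>x. f x * g x \<partial>M) \<le> (\<integral>x. cmod (f x) * cmod (g x) \<partial>M)"
    using integral_norm_bound[of M "\<lambda>x. f x * g x"] by (simp add: norm_mult)
  with * show "cmod (\<integral>x. f x * g x \<partial>M) \<le> L2_norm M f * L2_norm M g" by linarith
qed

lemma L2_norm_triangle:
  assumes f: "f \<in> L2 M" and g: "g \<in> L2 M"
  shows "L2_norm M (\<lambda>x. f x + g x) \<le> L2_norm M f + L2_norm M g"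
proof (rule power2_le_imp_le)
  have fg: "integrable M (\<lambda>x. cmod (f x) * cmod (g x))"
    using integrable_norm[OF L2_mult_integrable[OF f g]] by (simp add: norm_mult)
  have "(L2_norm M (\<lambda>x. f x + g x))\<^sup>2 = (\<integral>x. (cmod (f x + g x))\<^sup>2 \<partial>M)"
    by (rule L2_norm_power2)
  also have "\<dots> \<le> (\<integral>x. (cmod (f x))\<^sup>2 + 2 * (cmod (f x) * cmod (g x)) + (cmod (g x))\<^sup>2 \<partial>M)"
  proof (rule integral_mono)
    show "(cmod (f x + g x))\<^sup>2 \<le> (cmod (f x))\<^sup>2 + 2 * (cmod (f x) * cmod (g x)) + (cmod (g x))\<^sup>2" for x
    proof -
      have "(cmod (f x + g x))\<^sup>2 \<le> (cmod (f x) + cmod (g x))\<^sup>2"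
        by (intro power_mono norm_triangle_ineq) auto
      then show ?thesis by (simp add: power2_eq_square algebra_simps)
    qed
  qed (use L2_add[OF f g] f g fg in \<open>auto simp: L2_def\<close>)
  also have "\<dots> = (L2_norm M f)\<^sup>2 + 2 * (\<integral>x. cmod (f x) * cmod (g x) \<partial>M) + (L2_norm M g)\<^sup>2"
    using f g fg by (simp add: L2_norm_power2 L2_def)
  also have "\<dots> \<le> (L2_norm M f + L2_norm M g)\<^sup>2"
    using L2_Cauchy_Schwarz(1)[OF f g] by (simp add: power2_sum)
  finally show "(L2_norm M (\<lambda>x. f x + g x))\<^sup>2 \<le> (L2_norm M f + L2_norm M g)\<^sup>2" .
qed simp

lemma L2_norm_triangle_diff:
  assumes "f \<in> L2 M" "g \<in> L2 M" "h \<in> L2 M"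
  shows "L2_norm M (\<lambda>x. f x - h x) \<le> L2_norm M (\<lambda>x. f x - g x) + L2_norm M (\<lambda>x. g x - h x)"
  using L2_norm_triangle[OF L2_diff[OF assms(1,2)] L2_diff[OF assms(2,3)]] by simp

lemma L2_norm_diff_ge:
  assumes "f \<in> L2 M" "g \<in> L2 M"
  shows "\<bar>L2_norm M f - L2_norm M g\<bar> \<le> L2_norm M (\<lambda>x. f x - g x)"
  using L2_norm_triangle[OF L2_diff[OF assms] assms(2)]
    L2_norm_triangle[OF L2_diff[OF assms(2,1)] assms(1)] L2_norm_minus_commute[of M f g]
  by auto

section \<open>Convergence in the mean\<close>

lemma L2_tendsto_norm:
  assumes "L2_tendsto M f g F"
  shows "((\<lambda>i. L2_norm M (f i)) \<longlongrightarrow> L2_norm M g) F"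
proof (rule Lim_transform_eventually)
  have lim: "((\<lambda>i. L2_norm M (\<lambda>x. f i x - g x)) \<longlongrightarrow> 0) F" and g: "g \<in> L2 M"
    and ev: "eventually (\<lambda>i. f i \<in> L2 M) F"
    using assms by (auto simp: L2_tendsto_def)
  have "((\<lambda>i. L2_norm M (f i) - L2_norm M g) \<longlongrightarrow> 0) F"
    by (rule tendsto_0_le[OF lim, where K = 1], use ev in eventually_elim)
       (use L2_norm_diff_ge g in simp)
  then show "((\<lambda>i. (L2_norm M (f i) - L2_norm M g) + L2_norm M g) \<longlongrightarrow> L2_norm M g) F"
    using tendsto_add[of _ 0 F "\<lambda>_. L2_norm M g"] by force
qed simp

lemma L2_tendsto_integral:
  assumes "L2_tendsto M f g F" "u \<in> L2 M"
  shows "((\<lambda>i. \<integral>x. f i x * u x \<partial>M) \<longlongrightarrow> (\<integral>x. g x * u x \<partial>M)) F"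
proof -
  have lim: "((\<lambda>i. L2_norm M (\<lambda>x. f i x - g x)) \<longlongrightarrow> 0) F" and g: "g \<in> L2 M"
    and ev: "eventually (\<lambda>i. f i \<in> L2 M) F"
    using assms by (auto simp: L2_tendsto_def)
  have "((\<lambda>i. (\<integral>x. f i x * u x \<partial>M) - (\<integral>x. g x * u x \<partial>M)) \<longlongrightarrow> 0) F"
  proof (rule tendsto_0_le[OF lim, where K = "L2_norm M u"], use ev in eventually_elim)
    case (elim i)
    have "(\<integral>x. f i x * u x \<partial>M) - (\<integral>x. g x * u x \<partial>M) = (\<integral>x. (f i x - g x) * u x \<partial>M)"
      using L2_mult_integrable[OF elim assms(2)] L2_mult_integrable[OF g assms(2)]
      by (simp add: left_diff_distrib)
    then show ?case using L2_Cauchy_Schwarz(2)[OF L2_diff[OF elim g] assms(2)] by simp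
  qed
  then show ?thesis using Lim_null by blast
qed

lemma L2_tendsto_add:
  assumes "L2_tendsto M f g F" "L2_tendsto M f' g' F"
  shows "L2_tendsto M (\<lambda>i x. f i x + f' i x) (\<lambda>x. g x + g' x) F"
  unfolding L2_tendsto_def
proof (intro conjI)
  have ev: "eventually (\<lambda>i. f i \<in> L2 M) F" "eventually (\<lambda>i. f' i \<in> L2 M) F"
    and g: "g \<in> L2 M" "g' \<in> L2 M"
    using assms by (auto simp: L2_tendsto_def)
  show "(\<lambda>x. g x + g' x) \<in> L2 M" using g by (rule L2_add)
  show "\<forall>\<^sub>F i in F. (\<lambda>x. f i x + f' i x) \<in> L2 M"
    using ev by eventually_elim (rule L2_add)
  have lim: "((\<lambda>i. L2_norm M (\<lambda>x. f i x - g x) + L2_norm M (\<lambda>x. f' i x - g' x)) \<longlongrightarrow> 0) F"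
    using assms by (auto simp: L2_tendsto_def intro!: tendsto_add_zero)
  show "((\<lambda>i. L2_norm M (\<lambda>x. f i x + f' i x - (g x + g' x))) \<longlongrightarrow> 0) F"
  proof (rule tendsto_0_le[OF lim, where K = 1], use ev in eventually_elim)
    case (elim i)
    then show ?case
      using L2_norm_triangle[OF L2_diff[OF elim(1) g(1)] L2_diff[OF elim(2) g(2)]]
      by (simp add: algebra_simps)
  qed
qed

lemma L2_tendsto_scale:
  assumes "L2_tendsto M f g F"
  shows "L2_tendsto M (\<lambda>i x. c * f i x) (\<lambda>x. c * g x) F"
proof -
  have "((\<lambda>i. cmod c * L2_norm M (\<lambda>x. f i x - g x)) \<longlongrightarrow> 0) F"
    using assms by (auto simp: L2_tendsto_def intro!: tendsto_mult_right_zero)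
  then show ?thesis
    using assms by (auto simp: L2_tendsto_def L2_norm_scale[symmetric] right_diff_distrib L2_scale
        elim: eventually_mono)
qed

text \<open>The bound by \<open>w\<close> survives the limit, so |f n - g|^2 is dominated by the
  integrable function (2 C |w|)^2.\<close>

lemma L2_dominated_convergence:
  assumes "\<And>n. f n \<in> borel_measurable M" "g \<in> borel_measurable M" "w \<in> L2 M"
    and "\<And>n x. x \<in> space M \<Longrightarrow> cmod (f n x) \<le> C * cmod (w x)"
    and lim: "\<And>x. x \<in> space M \<Longrightarrow> (\<lambda>n. f n x) \<longlonglongrightarrow> g x"
  shows "L2_tendsto M f g sequentially"
proof -
  have gb: "cmod (g x) \<le> C * cmod (w x)" if "x \<in> space M" for x
    using tendsto_norm[OF lim[OF that]] by (rule LIMSEQ_le_const2) (use assms(4) that in auto)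
  have g: "g \<in> L2 M" using gb assms by (intro L2_bound[of w _ g C]) auto
  have f: "f n \<in> L2 M" for n using assms by (intro L2_bound[of w _ "f n" C]) auto
  have "(\<lambda>n. \<integral>x. (cmod (f n x - g x))\<^sup>2 \<partial>M) \<longlonglongrightarrow> (\<integral>x. 0 \<partial>M)"
  proof (rule integral_dominated_convergence)
    show "integrable M (\<lambda>x. (2 * C)\<^sup>2 * (cmod (w x))\<^sup>2)" using assms(3) by (simp add: L2_def)
    show "AE x in M. (\<lambda>n. (cmod (f n x - g x))\<^sup>2) \<longlonglongrightarrow> 0"
    proof (rule AE_I2)
      fix x assume "x \<in> space M"
      then have "(\<lambda>n. f n x - g x) \<longlonglongrightarrow> 0" using lim LIM_zero by blast
      then have "(\<lambda>n. (cmod (f n x - g x))\<^sup>2) \<longlonglongrightarrow> (cmod 0)\<^sup>2" by (intro tendsto_intros)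
      then show "(\<lambda>n. (cmod (f n x - g x))\<^sup>2) \<longlonglongrightarrow> 0" by simp
    qed
    show "AE x in M. norm ((cmod (f n x - g x))\<^sup>2) \<le> (2 * C)\<^sup>2 * (cmod (w x))\<^sup>2" for n
    proof (rule AE_I2)
      fix x assume "x \<in> space M"
      then have "cmod (f n x - g x) \<le> 2 * C * cmod (w x)"
        using assms(4)[of x n] gb[of x] norm_triangle_ineq4[of "f n x" "g x"] by linarith
      then have "(cmod (f n x - g x))\<^sup>2 \<le> (2 * C * cmod (w x))\<^sup>2" by (intro power_mono) auto
      then show "norm ((cmod (f n x - g x))\<^sup>2) \<le> (2 * C)\<^sup>2 * (cmod (w x))\<^sup>2"
        by (simp only: power_mult_distrib) simp
    qed
  qed (use assms(1,2) in auto)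
  then have "(\<lambda>n. sqrt (\<integral>x. (cmod (f n x - g x))\<^sup>2 \<partial>M)) \<longlonglongrightarrow> sqrt 0"
    by (intro tendsto_real_sqrt) simp
  then show ?thesis using f g by (simp add: L2_tendsto_def L2_norm_def)
qed

section \<open>Completeness\<close>

lemma L2_norm_partial_sum_le:
  assumes "\<And>k. f k \<in> L2 M" "\<And>k. L2_norm M (f k) \<le> (1/2) ^ k"
  shows "L2_norm M (\<lambda>x. \<Sum>k<n. complex_of_real (cmod (f k x))) \<le> 2"
proof -
  \<comment> \<open>The moduli are embedded into the complex numbers because \<open>L2_norm\<close>
    takes complex functions.\<close>
  have f': "(\<lambda>x. complex_of_real (cmod (f k x))) \<in> L2 M" for k
    using L2_borel[OF assms(1)[of k]] L2_integrable[OF assms(1)[of k]]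
    unfolding L2_def by (simp add: borel_measurable_norm borel_measurable_of_real)
  have norm': "L2_norm M (\<lambda>x. complex_of_real (cmod (f k x))) = L2_norm M (f k)" for k
    by (simp add: L2_norm_def)
  have "L2_norm M (\<lambda>x. \<Sum>k<n. complex_of_real (cmod (f k x))) \<le> (\<Sum>k<n. (1/2) ^ k)"
  proof (induction n)
    case (Suc n)
    have "L2_norm M (\<lambda>x. \<Sum>k<Suc n. complex_of_real (cmod (f k x))) \<le>
        L2_norm M (\<lambda>x. \<Sum>k<n. complex_of_real (cmod (f k x))) + L2_norm M (f n)"
      using L2_norm_triangle[OF L2_sum[of "{..<n}", OF f'] f'[of n]] norm'[of n] by simp
    then show ?case using Suc assms(2)[of n] by simp
  qed simp
  also have "\<dots> \<le> (\<Sum>k. (1/2) ^ k)"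
    by (intro sum_le_suminf summable_geometric) auto
  also have "\<dots> = 2" by (simp add: suminf_geometric)
  finally show ?thesis .
qed

text \<open>The triangle inequality bounds the sums of |f (k+1) - f k| in norm by 2, whatever the
  number of terms. By monotone convergence their supremum is finite almost everywhere, and at such
  points the telescoping series converges absolutely.\<close>

lemma L2_rapidly_Cauchy_AE_convergent:
  assumes f: "\<And>k. f k \<in> L2 M" and rapid: "\<And>k. L2_norm M (\<lambda>x. f (Suc k) x - f k x) \<le> (1/2) ^ k"
  shows "AE x in M. convergent (\<lambda>k. f k x)"
proof -
  define D where "D n x = (\<Sum>k<n. cmod (f (Suc k) x - f k x))" for n x
  have [measurable]: "f k \<in> borel_measurable M" for k using f by (simp add: L2_def)
  have D_nonneg: "0 \<le> D n x" for n x unfolding D_def by (intro sum_nonneg) auto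
  have Dmono: "D n x \<le> D m x" if "n \<le> m" for n m x
    unfolding D_def using that by (intro sum_mono2) auto
  have D_int: "(\<integral>\<^sup>+x. ennreal ((D n x)\<^sup>2) \<partial>M) \<le> 4" for n
  proof -
    let ?d = "\<lambda>x. \<Sum>k<n. complex_of_real (cmod (f (Suc k) x - f k x))"
    have eq: "cmod (?d x) = D n x" for x
      using D_nonneg[of n x] unfolding D_def by (simp del: of_real_sum flip: of_real_sum)
    have le: "L2_norm M ?d \<le> 2" using L2_norm_partial_sum_le[of "\<lambda>k x. f (Suc k) x - f k x" M n]
      f rapid by (auto intro: L2_diff)
    have "?d \<in> L2 M"
    proof (intro L2_sum)
      fix k show "(\<lambda>x. complex_of_real (cmod (f (Suc k) x - f k x))) \<in> L2 M"
        using L2_diff[OF f[of "Suc k"] f[of k]] unfolding L2_def by simp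
    qed
    from nn_integral_cmod_power2[OF this]
    have "(\<integral>\<^sup>+x. ennreal ((D n x)\<^sup>2) \<partial>M) = ennreal ((L2_norm M ?d)\<^sup>2)" by (simp only: eq)
    also have "\<dots> \<le> ennreal (2\<^sup>2)"
      using le by (intro ennreal_leI power_mono) auto
    finally show ?thesis by simp
  qed
  have "(\<integral>\<^sup>+x. (SUP n. ennreal ((D n x)\<^sup>2)) \<partial>M) = (SUP n. (\<integral>\<^sup>+x. ennreal ((D n x)\<^sup>2) \<partial>M))"
  proof (rule nn_integral_monotone_convergence_SUP)
    show "incseq (\<lambda>n x. ennreal ((D n x)\<^sup>2))"
      using Dmono D_nonneg by (auto simp: incseq_def le_fun_def intro!: ennreal_leI power_mono)
  qed (auto simp: D_def)
  also have "\<dots> \<le> 4" using D_int by (intro SUP_least)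
  finally have "(\<integral>\<^sup>+x. (SUP n. ennreal ((D n x)\<^sup>2)) \<partial>M) \<noteq> \<infinity>"
    by (auto simp: top_unique)
  then have "AE x in M. (SUP n. ennreal ((D n x)\<^sup>2)) \<noteq> \<infinity>"
    by (intro nn_integral_noteq_infinite) (auto simp: D_def)
  then show ?thesis
  proof eventually_elim
    case (elim x)
    then obtain C where C: "(SUP n. ennreal ((D n x)\<^sup>2)) = ennreal C" "C \<ge> 0"
      by (metis ennreal_cases infinity_ennreal_def)
    have "(D n x)\<^sup>2 \<le> C" for n
    proof -
      have "ennreal ((D n x)\<^sup>2) \<le> ennreal C" unfolding C(1)[symmetric] by (rule SUP_upper) simp
      then show ?thesis using C(2) by simp
    qed
    then have "D n x \<le> sqrt C" for n by (simp add: real_le_rsqrt)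
    then have "summable (\<lambda>k. cmod (f (Suc k) x - f k x))"
      unfolding D_def by (intro summableI_nonneg_bounded[of _ "sqrt C"]) auto
    then have "summable (\<lambda>k. f (Suc k) x - f k x)" by (rule summable_norm_cancel)
    then have "convergent (\<lambda>n. (\<Sum>k<n. f (Suc k) x - f k x))" by (simp add: summable_iff_convergent)
    moreover have "(\<lambda>n. (\<Sum>k<n. f (Suc k) x - f k x)) = (\<lambda>n. f n x - f 0 x)"
      by (rule ext) (rule sum_lessThan_telescope)
    ultimately have "convergent (\<lambda>n. f n x - f 0 x)" by (simp only:)
    then have "convergent (\<lambda>n. (f n x - f 0 x) + f 0 x)"
      by (intro convergent_add) (auto simp: convergent_const)
    then show ?case by simp
  qed
qed

theorem L2_complete:
  assumes f: "\<And>n. f n \<in> L2 M"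
    and Cauchy: "\<And>e. e > 0 \<Longrightarrow> \<exists>N. \<forall>m\<ge>N. \<forall>n\<ge>N. L2_norm M (\<lambda>x. f m x - f n x) < e"
  shows "\<exists>g. L2_tendsto M f g sequentially"
proof -
  have "\<forall>k. \<exists>N. \<forall>m\<ge>N. \<forall>n\<ge>N. L2_norm M (\<lambda>x. f m x - f n x) < (1/2) ^ k"
    using Cauchy by simp
  then obtain N where N: "\<And>k m n. m \<ge> N k \<Longrightarrow> n \<ge> N k \<Longrightarrow> L2_norm M (\<lambda>x. f m x - f n x) < (1/2) ^ k"
    by metis
  \<comment> \<open>Summing the thresholds makes \<open>r\<close> monotone and at least as large as
    each \<open>N k\<close>; the summand \<open>k\<close> sends it to infinity.\<close>
  define r where "r k = (\<Sum>i\<le>k. N i) + k" for k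
  have r_ge: "N k \<le> r k" "k \<le> r k" for k
    unfolding r_def by (auto intro: trans_le_add1 member_le_sum)
  have r_Suc: "r k \<le> r (Suc k)" for k by (simp add: r_def)
  have meas [measurable]: "f n \<in> borel_measurable M" for n using f by (simp add: L2_def)
  define g where "g x = lim (\<lambda>k. f (r k) x)" for x
  have [measurable]: "g \<in> borel_measurable M" unfolding g_def by measurable
  have "AE x in M. convergent (\<lambda>k. f (r k) x)"
  proof (rule L2_rapidly_Cauchy_AE_convergent)
    show "L2_norm M (\<lambda>x. f (r (Suc k)) x - f (r k) x) \<le> (1/2) ^ k" for k
      using N[of k "r (Suc k)" "r k"] r_ge(1)[of k] r_Suc[of k] by (simp add: less_imp_le)
  qed (rule f)
  then have conv: "AE x in M. (\<lambda>k. f (r k) x) \<longlonglongrightarrow> g x"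
    by eventually_elim (simp add: g_def convergent_LIMSEQ_iff)
  \<comment> \<open>Fatou along the subsequence replaces the second member of the Cauchy estimate by
    the pointwise limit \<open>g\<close>; that \<open>g\<close> is square-integrable comes out of
    the same estimate.\<close>
  have Fatou: "(\<lambda>x. f n x - g x) \<in> L2 M \<and> L2_norm M (\<lambda>x. f n x - g x) \<le> e"
    if "\<And>k. k \<ge> K \<Longrightarrow> L2_norm M (\<lambda>x. f n x - f k x) \<le> e" "e \<ge> 0" for n e K
  proof -
    have "(\<integral>\<^sup>+x. ennreal ((cmod (f n x - g x))\<^sup>2) \<partial>M) =
        (\<integral>\<^sup>+x. liminf (\<lambda>k. ennreal ((cmod (f n x - f (r k) x))\<^sup>2)) \<partial>M)"
      using conv
    proof (intro nn_integral_cong_AE, eventually_elim)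
      case (elim x)
      then have "(\<lambda>k. ennreal ((cmod (f n x - f (r k) x))\<^sup>2)) \<longlonglongrightarrow> ennreal ((cmod (f n x - g x))\<^sup>2)"
        by (intro tendsto_intros tendsto_ennrealI)
      then show ?case by (intro lim_imp_Liminf[symmetric]) auto
    qed
    also have "\<dots> \<le> liminf (\<lambda>k. \<integral>\<^sup>+x. ennreal ((cmod (f n x - f (r k) x))\<^sup>2) \<partial>M)"
      by (intro nn_integral_liminf) measurable
    also have "\<dots> = liminf (\<lambda>k. ennreal ((L2_norm M (\<lambda>x. f n x - f (r k) x))\<^sup>2))"
      by (simp add: nn_integral_cmod_power2 L2_diff f)
    also have "\<dots> \<le> liminf (\<lambda>k. ennreal (e\<^sup>2))"
    proof (rule Liminf_mono)
      show "\<forall>\<^sub>F k in sequentially. ennreal ((L2_norm M (\<lambda>x. f n x - f (r k) x))\<^sup>2) \<le> ennreal (e\<^sup>2)"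
        using eventually_ge_at_top[of K]
      proof eventually_elim
        case (elim k)
        then show ?case using that(1)[of "r k"] r_ge(2)[of k]
          by (intro ennreal_leI power_mono) auto
      qed
    qed
    also have "\<dots> = ennreal (e\<^sup>2)" by (simp add: Liminf_const)
    finally have le: "(\<integral>\<^sup>+x. ennreal ((cmod (f n x - g x))\<^sup>2) \<partial>M) \<le> ennreal (e\<^sup>2)" .
    show ?thesis using L2_normI_nn[OF _ that(2) le] by simp
  qed
  have "(\<lambda>x. f (N 0) x - g x) \<in> L2 M"
    using Fatou[of "N 0" "N 0" 1] N[of 0 "N 0"] by (simp add: less_imp_le)
  from L2_diff[OF f[of "N 0"] this] have g: "g \<in> L2 M" by simp
  have "(\<lambda>n. L2_norm M (\<lambda>x. f n x - g x)) \<longlonglongrightarrow> 0"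
  proof (rule LIMSEQ_I)
    fix e :: real assume "e > 0"
    then obtain K where K: "\<And>m n. m \<ge> K \<Longrightarrow> n \<ge> K \<Longrightarrow> L2_norm M (\<lambda>x. f m x - f n x) < e / 2"
      using Cauchy[of "e / 2"] by auto
    have "L2_norm M (\<lambda>x. f n x - g x) \<le> e / 2" if "n \<ge> K" for n
      using Fatou[of K n "e / 2"] K[OF that] \<open>e > 0\<close> by (auto simp: less_imp_le)
    then show "\<exists>K. \<forall>n\<ge>K. norm (L2_norm M (\<lambda>x. f n x - g x) - 0) < e"
      using \<open>e > 0\<close> by (intro exI[of _ K]) fastforce
  qed
  then show ?thesis using f g by (auto simp: L2_tendsto_def)
qed

section \<open>Spans, closures and closed subspaces\<close>

definition L2_span :: "('b \<Rightarrow> complex) set \<Rightarrow> ('b \<Rightarrow> complex) set" where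
  "L2_span S = {(\<lambda>x. \<Sum>f\<in>F. c f * f x) | F c. finite F \<and> F \<subseteq> S}"

lemma L2_spanE:
  assumes "g \<in> L2_span S"
  obtains F c where "finite F" "F \<subseteq> S" "g = (\<lambda>x. \<Sum>f\<in>F. c f * f x)"
  using assms by (auto simp: L2_span_def)

lemma L2_span_base:
  assumes "f \<in> S"
  shows "f \<in> L2_span S"
  unfolding L2_span_def using assms
  by (intro CollectI exI[of _ "{f}"] exI[of _ "\<lambda>_. 1"]) auto

lemma L2_span_zero: "(\<lambda>_. 0) \<in> L2_span S"
  unfolding L2_span_def by (intro CollectI exI[of _ "{}"]) auto

lemma L2_span_scale:
  assumes "f \<in> L2_span S"
  shows "(\<lambda>x. a * f x) \<in> L2_span S"
proof -
  obtain F c where F: "finite F" "F \<subseteq> S" "f = (\<lambda>x. \<Sum>f\<in>F. c f * f x)"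
    using assms by (rule L2_spanE)
  then show ?thesis
    unfolding L2_span_def
    by (intro CollectI exI[of _ F] exI[of _ "\<lambda>f. a * c f"]) (auto simp: sum_distrib_left mult.assoc)
qed

lemma L2_span_add:
  assumes "f \<in> L2_span S" "g \<in> L2_span S"
  shows "(\<lambda>x. f x + g x) \<in> L2_span S"
proof -
  obtain F c where F: "finite F" "F \<subseteq> S" "f = (\<lambda>x. \<Sum>f\<in>F. c f * f x)"
    using assms(1) by (rule L2_spanE)
  obtain G d where G: "finite G" "G \<subseteq> S" "g = (\<lambda>x. \<Sum>f\<in>G. d f * f x)"
    using assms(2) by (rule L2_spanE)
  have 1: "(\<Sum>f\<in>F. c f * f x) = (\<Sum>f\<in>F \<union> G. (if f \<in> F then c f else 0) * f x)" for x
    using F(1) G(1) by (intro sum.mono_neutral_cong_left) auto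
  have 2: "(\<Sum>f\<in>G. d f * f x) = (\<Sum>f\<in>F \<union> G. (if f \<in> G then d f else 0) * f x)" for x
    using F(1) G(1) by (intro sum.mono_neutral_cong_left) auto
  have "(\<lambda>x. f x + g x) = (\<lambda>x. \<Sum>h\<in>F \<union> G.
      ((if h \<in> F then c h else 0) + (if h \<in> G then d h else 0)) * h x)"
    unfolding F(3) G(3) 1 2 by (simp add: distrib_right sum.distrib)
  then show ?thesis
    unfolding L2_span_def using F(1,2) G(1,2)
    by (intro CollectI exI[of _ "F \<union> G"]
        exI[of _ "\<lambda>h. (if h \<in> F then c h else 0) + (if h \<in> G then d h else 0)"]) simp
qed

lemma L2_span_sum:
  assumes "\<And>i. i \<in> I \<Longrightarrow> f i \<in> L2_span S"
  shows "(\<lambda>x. \<Sum>i\<in>I. f i x) \<in> L2_span S"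
  using assms by (induction I rule: infinite_finite_induct) (auto intro: L2_span_add L2_span_zero)

lemma L2_span_subset_L2: "S \<subseteq> L2 M \<Longrightarrow> L2_span S \<subseteq> L2 M"
  unfolding L2_span_def by (auto intro!: L2_sum L2_scale)

lemma L2_closed_span_eq: "L2_closed_span M S = L2_closure M (L2_span S)"
  by (simp add: L2_closed_span_def L2_span_def)

lemma L2_closureD: "f \<in> L2_closure M U \<Longrightarrow> e > 0 \<Longrightarrow> \<exists>g\<in>U. L2_norm M (\<lambda>x. f x - g x) < e"
  by (simp add: L2_closure_def)

lemma L2_closureI:
  "f \<in> L2 M \<Longrightarrow> (\<And>e. e > 0 \<Longrightarrow> \<exists>g\<in>U. L2_norm M (\<lambda>x. f x - g x) < e) \<Longrightarrow> f \<in> L2_closure M U"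
  by (simp add: L2_closure_def)

lemma L2_closure_mono: "U \<subseteq> W \<Longrightarrow> L2_closure M U \<subseteq> L2_closure M W"
  by (fastforce simp: L2_closure_def)

lemma L2_closure_subset_L2: "L2_closure M U \<subseteq> L2 M"
  by (auto simp: L2_closure_def)

lemma L2_closure_superset: "U \<subseteq> L2 M \<Longrightarrow> U \<subseteq> L2_closure M U"
  by (auto simp: L2_closure_def intro!: bexI)

lemma L2_closure_closure:
  assumes "U \<subseteq> L2 M"
  shows "L2_closure M (L2_closure M U) = L2_closure M U"
proof
  show "L2_closure M (L2_closure M U) \<subseteq> L2_closure M U"
  proof
    fix f assume f: "f \<in> L2_closure M (L2_closure M U)"
    then have fL: "f \<in> L2 M" using L2_closure_subset_L2 by blast
    then show "f \<in> L2_closure M U"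
    proof (rule L2_closureI)
      fix e :: real assume "e > 0"
      then obtain g where g: "g \<in> L2_closure M U" "L2_norm M (\<lambda>x. f x - g x) < e / 2"
        using L2_closureD[OF f, of "e / 2"] by auto
      obtain h where h: "h \<in> U" "L2_norm M (\<lambda>x. g x - h x) < e / 2"
        using L2_closureD[OF g(1), of "e / 2"] \<open>e > 0\<close> by auto
      have "L2_norm M (\<lambda>x. f x - h x) < e"
        using L2_norm_triangle_diff[of f M g h] fL g h assms L2_closure_subset_L2[of M U] by fastforce
      with h show "\<exists>g\<in>U. L2_norm M (\<lambda>x. f x - g x) < e" by blast
    qed
  qed
qed (use L2_closure_superset[of "L2_closure M U" M] L2_closure_subset_L2 in blast)

lemma L2_closed_subspace_closed_span:
  assumes S: "S \<subseteq> L2 M"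
  shows "L2_closed_subspace M (L2_closed_span M S)"
  unfolding L2_closed_subspace_def L2_closed_span_eq
proof (intro conjI ballI allI)
  let ?U = "L2_span S"
  have U: "?U \<subseteq> L2 M" using S by (rule L2_span_subset_L2)
  show "L2_closure M ?U \<subseteq> L2 M" by (rule L2_closure_subset_L2)
  show "(\<lambda>_. 0) \<in> L2_closure M ?U"
    using L2_closure_superset[OF U] L2_span_zero by blast
  show "L2_closure M (L2_closure M ?U) = L2_closure M ?U"
    using U by (rule L2_closure_closure)
  show "(\<lambda>x. f x + g x) \<in> L2_closure M ?U" if f: "f \<in> L2_closure M ?U" and g: "g \<in> L2_closure M ?U" for f g
  proof (rule L2_closureI)
    have fg: "f \<in> L2 M" "g \<in> L2 M" using f g L2_closure_subset_L2 by blast+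
    then show "(\<lambda>x. f x + g x) \<in> L2 M" by (rule L2_add)
    fix e :: real assume "e > 0"
    then obtain f' where f': "f' \<in> ?U" "L2_norm M (\<lambda>x. f x - f' x) < e / 2"
      using L2_closureD[OF f, of "e / 2"] by auto
    obtain g' where g': "g' \<in> ?U" "L2_norm M (\<lambda>x. g x - g' x) < e / 2"
      using L2_closureD[OF g, of "e / 2"] \<open>e > 0\<close> by auto
    have "L2_norm M (\<lambda>x. f x + g x - (f' x + g' x)) =
        L2_norm M (\<lambda>x. (f x - f' x) + (g x - g' x))"
      by (simp add: algebra_simps)
    also have "\<dots> \<le> L2_norm M (\<lambda>x. f x - f' x) + L2_norm M (\<lambda>x. g x - g' x)"
      using f' g' U fg by (intro L2_norm_triangle L2_diff) auto
    also have "\<dots> < e" using f' g' by simp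
    finally show "\<exists>h\<in>?U. L2_norm M (\<lambda>x. f x + g x - h x) < e"
      by (rule bexI[OF _ L2_span_add[OF f'(1) g'(1)]])
  qed
  show "(\<lambda>x. c * f x) \<in> L2_closure M ?U" if f: "f \<in> L2_closure M ?U" for c f
  proof (rule L2_closureI)
    show "(\<lambda>x. c * f x) \<in> L2 M" using f L2_closure_subset_L2 L2_scale by blast
    fix e :: real assume "e > 0"
    then have "e / (cmod c + 1) > 0" by (simp add: add_nonneg_pos)
    then obtain f' where f': "f' \<in> ?U" "L2_norm M (\<lambda>x. f x - f' x) < e / (cmod c + 1)"
      using L2_closureD[OF f] by blast
    have "L2_norm M (\<lambda>x. c * f x - c * f' x) = cmod c * L2_norm M (\<lambda>x. f x - f' x)"
      by (simp add: L2_norm_scale flip: right_diff_distrib)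
    also have "\<dots> \<le> (cmod c + 1) * L2_norm M (\<lambda>x. f x - f' x)"
      by (intro mult_right_mono) auto
    also have "\<dots> < e"
      using f'(2) by (simp add: less_divide_eq mult.commute add_nonneg_pos)
    finally show "\<exists>h\<in>?U. L2_norm M (\<lambda>x. c * f x - h x) < e"
      by (rule bexI[OF _ L2_span_scale[OF f'(1)]])
  qed
qed

lemma
  assumes "L2_closed_subspace M V"
  shows L2_closed_subspace_subset: "V \<subseteq> L2 M"
    and L2_closed_subspace_zero: "(\<lambda>_. 0) \<in> V"
    and L2_closed_subspace_add: "f \<in> V \<Longrightarrow> g \<in> V \<Longrightarrow> (\<lambda>x. f x + g x) \<in> V"
    and L2_closed_subspace_scale: "f \<in> V \<Longrightarrow> (\<lambda>x. c * f x) \<in> V"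
    and L2_closed_subspace_closure: "L2_closure M V = V"
  using assms by (auto simp: L2_closed_subspace_def)

lemma L2_closed_subspace_sum:
  assumes "L2_closed_subspace M V" "\<And>i. i \<in> I \<Longrightarrow> f i \<in> V"
  shows "(\<lambda>x. \<Sum>i\<in>I. f i x) \<in> V"
  using assms(2)
  by (induction I rule: infinite_finite_induct)
     (auto intro: L2_closed_subspace_add[OF assms(1)] L2_closed_subspace_zero[OF assms(1)])

lemma L2_span_subset_closed_subspace:
  assumes "L2_closed_subspace M V" "S \<subseteq> V"
  shows "L2_span S \<subseteq> V"
  using assms unfolding L2_span_def
  by (auto intro!: L2_closed_subspace_sum[OF assms(1)] L2_closed_subspace_scale[OF assms(1)])

lemma L2_closed_span_minimal:
  assumes "L2_closed_subspace M V" "S \<subseteq> V"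
  shows "L2_closed_span M S \<subseteq> V"
  using L2_closure_mono[OF L2_span_subset_closed_subspace[OF assms], of M]
  by (simp add: L2_closed_span_eq L2_closed_subspace_closure[OF assms(1)])

lemma L2_closed_span_superset:
  assumes "S \<subseteq> L2 M"
  shows "L2_span S \<subseteq> L2_closed_span M S" and "S \<subseteq> L2_closed_span M S"
  using L2_closure_superset[OF L2_span_subset_L2[OF assms]] L2_span_base[of _ S]
  unfolding L2_closed_span_eq by blast+

lemma L2_closure_tendsto:
  assumes "L2_tendsto M f g F" "F \<noteq> bot" "eventually (\<lambda>i. f i \<in> U) F"
  shows "g \<in> L2_closure M U"
proof (rule L2_closureI)
  show "g \<in> L2 M" using assms by (simp add: L2_tendsto_def)
  fix e :: real assume "e > 0"
  then have "eventually (\<lambda>i. L2_norm M (\<lambda>x. f i x - g x) < e) F"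
    using assms(1) by (auto simp: L2_tendsto_def intro: order_tendstoD)
  then have "eventually (\<lambda>i. f i \<in> U \<and> L2_norm M (\<lambda>x. f i x - g x) < e) F"
    using assms(3) by (rule eventually_elim2) auto
  then obtain i where "f i \<in> U" "L2_norm M (\<lambda>x. f i x - g x) < e"
    using eventually_happens'[OF assms(2)] by blast
  then show "\<exists>h\<in>U. L2_norm M (\<lambda>x. g x - h x) < e"
    using L2_norm_minus_commute[of M g] by auto
qed

lemma L2_closure_sequence:
  assumes "g \<in> L2_closure M U" "U \<subseteq> L2 M"
  obtains f where "\<And>n. f n \<in> U" "L2_tendsto M f g sequentially"
proof -
  have "\<exists>h\<in>U. L2_norm M (\<lambda>x. g x - h x) < inverse (real (Suc n))" for n
    using L2_closureD[OF assms(1)] by (simp del: of_nat_Suc)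
  then obtain f where f: "\<And>n. f n \<in> U" "\<And>n. L2_norm M (\<lambda>x. g x - f n x) < inverse (real (Suc n))"
    by metis
  have "(\<lambda>n. L2_norm M (\<lambda>x. f n x - g x)) \<longlonglongrightarrow> 0"
  proof (rule tendsto_0_le[OF LIMSEQ_inverse_real_of_nat, where K = 1], rule always_eventually, rule allI)
    show "norm (L2_norm M (\<lambda>x. f n x - g x)) \<le> norm (inverse (real (Suc n))) * 1" for n
      using f(2)[of n] L2_norm_minus_commute[of M g "f n"] by simp
  qed
  then have "L2_tendsto M f g sequentially"
    using f(1) assms L2_closure_subset_L2[of M U]
    by (auto simp: L2_tendsto_def intro!: always_eventually)
  with f(1) show thesis using that by blast
qed

text \<open>\<open>L2_norm\<close> does not see null sets, so closures are saturated under equality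
  almost everywhere. This is what makes sets of functions a faithful model of subspaces of
  L2.\<close>

lemma L2_closure_AE:
  assumes "f \<in> L2_closure M U" "U \<subseteq> L2 M" "g \<in> L2 M" "AE x in M. f x = g x"
  shows "g \<in> L2_closure M U"
proof (rule L2_closureI[OF assms(3)])
  fix e :: real assume "e > 0"
  then obtain h where h: "h \<in> U" "L2_norm M (\<lambda>x. f x - h x) < e"
    using L2_closureD[OF assms(1)] by blast
  have "L2_norm M (\<lambda>x. g x - h x) = L2_norm M (\<lambda>x. f x - h x)"
    using assms h L2_closure_subset_L2[of M U] by (intro L2_norm_cong_AE) (auto intro!: L2_diff)
  with h(2) have "L2_norm M (\<lambda>x. g x - h x) < e" by simp
  then show "\<exists>h\<in>U. L2_norm M (\<lambda>x. g x - h x) < e" using h(1) by (rule bexI)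
qed

lemma L2_closed_subspace_AE:
  assumes "L2_closed_subspace M V" "f \<in> V" "g \<in> L2 M" "AE x in M. f x = g x"
  shows "g \<in> V"
  using L2_closure_AE[of f M V g] assms by (auto simp: L2_closed_subspace_def)

section \<open>Riesz systems\<close>

lemma sum_tail_small:
  assumes "c summable_on J" "\<And>j. j \<in> J \<Longrightarrow> 0 \<le> (c j :: real)" "e > 0"
  shows "\<exists>K. finite K \<and> K \<subseteq> J \<and> (\<forall>F. finite F \<longrightarrow> F \<subseteq> J - K \<longrightarrow> sum c F < e)"
proof -
  have "(sum c \<longlongrightarrow> infsum c J) (finite_subsets_at_top J)"
    using has_sum_infsum[OF assms(1)] by (simp add: has_sum_def)
  then have "eventually (\<lambda>K. dist (sum c K) (infsum c J) < e) (finite_subsets_at_top J)"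
    using assms(3) by (rule tendstoD)
  then obtain K where K: "finite K" "K \<subseteq> J"
    "\<And>F. finite F \<Longrightarrow> K \<subseteq> F \<Longrightarrow> F \<subseteq> J \<Longrightarrow> dist (sum c F) (infsum c J) < e"
    by (auto simp: eventually_finite_subsets_at_top)
  \<comment> \<open>The terms over \<open>K\<close> already come within e of the total, and a
    disjoint \<open>F\<close> can add no more than what is missing.\<close>
  have "sum c F < e" if F: "finite F" "F \<subseteq> J - K" for F
  proof -
    have "sum c (K \<union> F) = sum c K + sum c F"
      using K F by (intro sum.union_disjoint) auto
    moreover have "sum c (K \<union> F) \<le> infsum c J"
      using K F assms by (intro finite_sum_le_infsum) auto
    moreover have "\<bar>sum c K - infsum c J\<bar> < e"
      using K(3)[of K] K(1,2) by (simp add: dist_real_def)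
    ultimately show ?thesis by linarith
  qed
  then show ?thesis using K(1,2) by blast
qed

text \<open>The upper bound on tails makes the finite partial sums a Cauchy net.
  \<open>L2_complete\<close> handles sequences, so the limit is found along an increasing sequence
  of finite sets and the whole net is shown to converge to it; both bounds then pass to the
  limit.\<close>

proposition riesz_systemI:
  fixes f :: "'i \<Rightarrow> 'b \<Rightarrow> complex"
  assumes A: "0 < A" and B: "0 < B" and f: "\<And>j. j \<in> J \<Longrightarrow> f j \<in> L2 M"
    and lower: "\<And>F c. finite F \<Longrightarrow> F \<subseteq> J \<Longrightarrow>
      A * (\<Sum>j\<in>F. (cmod (c j))\<^sup>2) \<le> (L2_norm M (\<lambda>x. \<Sum>j\<in>F. c j * f j x))\<^sup>2"
    and upper: "\<And>F c. finite F \<Longrightarrow> F \<subseteq> J \<Longrightarrow>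
      (L2_norm M (\<lambda>x. \<Sum>j\<in>F. c j * f j x))\<^sup>2 \<le> B * (\<Sum>j\<in>F. (cmod (c j))\<^sup>2)"
  shows "riesz_system M A B J f"
  unfolding riesz_system_def
proof (intro conjI allI impI ballI A B)
  show "f j \<in> L2 M" if "j \<in> J" for j using f that .
next
  fix c :: "'i \<Rightarrow> complex"
  assume summable: "(\<lambda>j. (cmod (c j))\<^sup>2) summable_on J"
  define s where "s F x = (\<Sum>j\<in>F. c j * f j x)" for F x
  have s_eq: "s F = (\<lambda>x. \<Sum>j\<in>F. c j * f j x)" for F
    by (rule ext) (simp add: s_def)
  have sL2: "s F \<in> L2 M" if "F \<subseteq> J" for F
    unfolding s_def using f that by (intro L2_sum L2_scale) auto
  have tail: "\<exists>K. finite K \<and> K \<subseteq> J \<and> (\<forall>F. finite F \<longrightarrow> K \<subseteq> F \<longrightarrow> F \<subseteq> J \<longrightarrow>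
      L2_norm M (\<lambda>x. s F x - s K x) < e)" if "e > 0" for e
  proof -
    have "e\<^sup>2 / B > 0" using B that by simp
    from sum_tail_small[OF summable zero_le_power2 this]
    obtain K where K: "finite K" "K \<subseteq> J"
      "\<And>F. finite F \<Longrightarrow> F \<subseteq> J - K \<Longrightarrow> (\<Sum>j\<in>F. (cmod (c j))\<^sup>2) < e\<^sup>2 / B"
      by blast
    have "L2_norm M (\<lambda>x. s F x - s K x) < e" if F: "finite F" "K \<subseteq> F" "F \<subseteq> J" for F
    proof -
      have "s F x - s K x = (\<Sum>j\<in>F - K. c j * f j x)" for x
        unfolding s_def using F K(1) by (simp add: sum_diff)
      then have "(L2_norm M (\<lambda>x. s F x - s K x))\<^sup>2 \<le> B * (\<Sum>j\<in>F - K. (cmod (c j))\<^sup>2)"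
        using upper[of "F - K" c] F by auto
      also have "\<dots> < e\<^sup>2"
        using K(3)[of "F - K"] F B by (auto simp: pos_less_divide_eq mult.commute)
      finally show ?thesis using \<open>e > 0\<close> by (simp add: power2_less_imp_less)
    qed
    then show ?thesis using K(1,2) by blast
  qed
  have "\<exists>K. finite K \<and> K \<subseteq> J \<and> (\<forall>F. finite F \<longrightarrow> K \<subseteq> F \<longrightarrow> F \<subseteq> J \<longrightarrow>
      L2_norm M (\<lambda>x. s F x - s K x) < inverse (real (Suc n)))" for n
    by (rule tail) simp
  then obtain K where K: "\<And>n. finite (K n)" "\<And>n. K n \<subseteq> J"
    "\<And>n F. finite F \<Longrightarrow> K n \<subseteq> F \<Longrightarrow> F \<subseteq> J \<Longrightarrow> L2_norm M (\<lambda>x. s F x - s (K n) x) < inverse (real (Suc n))"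
    by metis
  \<comment> \<open>The unions make the sequence increasing: \<open>L n\<close> contains every
    \<open>K k\<close> with k <= n, so \<open>near\<close> applies to all later members.\<close>
  define L where "L n = (\<Union>k\<le>n. K k)" for n
  have L: "finite (L n)" "L n \<subseteq> J" for n using K by (auto simp: L_def)
  have KL: "K k \<subseteq> L n" if "k \<le> n" for k n using that by (auto simp: L_def)
  have near: "L2_norm M (\<lambda>x. s F x - s G x) < 2 * inverse (real (Suc n))"
    if "finite F" "K n \<subseteq> F" "F \<subseteq> J" "finite G" "K n \<subseteq> G" "G \<subseteq> J" for F G n
    using K(3)[OF that(1-3)] K(3)[OF that(4-6)] L2_norm_minus_commute[of M "s G" "s (K n)"]
      L2_norm_triangle_diff[OF sL2[OF that(3)] sL2[OF K(2)[of n]] sL2[OF that(6)]]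
    by linarith
  have small: "\<exists>n. 2 * inverse (real (Suc n)) < e" if "e > 0" for e :: real
    using reals_Archimedean[of "e / 2"] that by (fastforce simp del: of_nat_Suc simp: mult.commute)
  have "\<exists>g. L2_tendsto M (\<lambda>n. s (L n)) g sequentially"
  proof (rule L2_complete)
    show "s (L n) \<in> L2 M" for n using sL2 L by blast
    fix e :: real assume "e > 0"
    then obtain N where N: "2 * inverse (real (Suc N)) < e" using small by blast
    have "L2_norm M (\<lambda>x. s (L m) x - s (L n) x) < e" if "m \<ge> N" "n \<ge> N" for m n
      using near[OF L(1) KL[OF that(1)] L(2) L(1) KL[OF that(2)] L(2)] N by linarith
    then show "\<exists>N. \<forall>m\<ge>N. \<forall>n\<ge>N. L2_norm M (\<lambda>x. s (L m) x - s (L n) x) < e" by blast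
  qed
  then obtain g where g: "L2_tendsto M (\<lambda>n. s (L n)) g sequentially" by blast
  then have gL2: "g \<in> L2 M" by (simp add: L2_tendsto_def)
  have conv: "L2_tendsto M s g (finite_subsets_at_top J)"
    unfolding L2_tendsto_def
  proof (intro conjI gL2)
    show "\<forall>\<^sub>F F in finite_subsets_at_top J. s F \<in> L2 M"
      using eventually_finite_subsets_at_top_weakI[of J "\<lambda>F. s F \<in> L2 M"] sL2 by blast
    show "((\<lambda>F. L2_norm M (\<lambda>x. s F x - g x)) \<longlongrightarrow> 0) (finite_subsets_at_top J)"
    proof (rule tendstoI)
      fix e :: real assume "e > 0"
      obtain N where N: "2 * inverse (real (Suc N)) < e / 2" using small[of "e / 2"] \<open>e > 0\<close> by auto
      have "eventually (\<lambda>n. L2_norm M (\<lambda>x. s (L n) x - g x) < e / 2) sequentially"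
        using g \<open>e > 0\<close> unfolding L2_tendsto_def by (metis half_gt_zero order_tendstoD(2))
      then have "eventually (\<lambda>n. n \<ge> N \<and> L2_norm M (\<lambda>x. s (L n) x - g x) < e / 2) sequentially"
        using eventually_ge_at_top[of N] by (rule eventually_elim2) auto
      then obtain n where n: "n \<ge> N" "L2_norm M (\<lambda>x. s (L n) x - g x) < e / 2"
        using eventually_happens'[OF sequentially_bot] by blast
      have "dist (L2_norm M (\<lambda>x. s F x - g x)) 0 < e" if F: "finite F" "K N \<subseteq> F" "F \<subseteq> J" for F
        using near[OF F L(1) KL[OF n(1)] L(2)] N n(2)
          L2_norm_triangle_diff[OF sL2[OF F(3)] sL2[OF L(2)[of n]] gL2] by simp
      then show "\<forall>\<^sub>F F in finite_subsets_at_top J. dist (L2_norm M (\<lambda>x. s F x - g x)) 0 < e"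
        unfolding eventually_finite_subsets_at_top using K(1,2)[of N] by blast
    qed
  qed
  have norm_lim: "((\<lambda>F. (L2_norm M (s F))\<^sup>2) \<longlongrightarrow> (L2_norm M g)\<^sup>2) (finite_subsets_at_top J)"
    by (intro tendsto_power L2_tendsto_norm conv)
  have sum_lim: "((\<lambda>F. \<Sum>j\<in>F. (cmod (c j))\<^sup>2) \<longlongrightarrow> (\<Sum>\<^sub>\<infinity>j\<in>J. (cmod (c j))\<^sup>2)) (finite_subsets_at_top J)"
    using has_sum_infsum[OF summable] by (simp add: has_sum_def)
  have "A * (\<Sum>\<^sub>\<infinity>j\<in>J. (cmod (c j))\<^sup>2) \<le> (L2_norm M g)\<^sup>2"
  proof (rule tendsto_le[OF _ norm_lim tendsto_mult_left[OF sum_lim]])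
    show "\<forall>\<^sub>F F in finite_subsets_at_top J. A * (\<Sum>j\<in>F. (cmod (c j))\<^sup>2) \<le> (L2_norm M (s F))\<^sup>2"
      by (intro eventually_finite_subsets_at_top_weakI) (use lower[of _ c] in \<open>simp add: s_eq\<close>)
  qed simp
  moreover have "(L2_norm M g)\<^sup>2 \<le> B * (\<Sum>\<^sub>\<infinity>j\<in>J. (cmod (c j))\<^sup>2)"
  proof (rule tendsto_le[OF _ tendsto_mult_left[OF sum_lim] norm_lim])
    show "\<forall>\<^sub>F F in finite_subsets_at_top J. (L2_norm M (s F))\<^sup>2 \<le> B * (\<Sum>j\<in>F. (cmod (c j))\<^sup>2)"
      by (intro eventually_finite_subsets_at_top_weakI) (use upper[of _ c] in \<open>simp add: s_eq\<close>)
  qed simp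
  ultimately show "\<exists>g. L2_tendsto M (\<lambda>F x. \<Sum>j\<in>F. c j * f j x) g (finite_subsets_at_top J) \<and>
      A * (\<Sum>\<^sub>\<infinity>j\<in>J. (cmod (c j))\<^sup>2) \<le> (L2_norm M g)\<^sup>2 \<and>
      (L2_norm M g)\<^sup>2 \<le> B * (\<Sum>\<^sub>\<infinity>j\<in>J. (cmod (c j))\<^sup>2)"
    using conv unfolding s_def by blast
qed

section \<open>The additive group of the local field\<close>

text \<open>The coset \<open>a + Ksub n\<close>, a ball about \<open>a\<close> in the ultrametric of
  K.\<close>

definition kball :: "'a::zero fls \<Rightarrow> int \<Rightarrow> 'a fls set" where
  "kball a n = {x. \<forall>j<n. x $$ j = a $$ j}"

lemma kball_refl [simp]: "a \<in> kball a n"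
  by (simp add: kball_def)

lemma Ksub_eq_kball: "Ksub n = kball 0 n"
  by (auto simp: Ksub_def kball_def)

lemma kball_eqI: "x \<in> kball a n \<Longrightarrow> kball a n = kball x n"
  by (auto simp: kball_def)

lemma kball_iff_diff: "x \<in> kball a n \<longleftrightarrow> x - a \<in> kball 0 n" for a :: "'a::group_add fls"
  by (auto simp: kball_def)

lemma kball_mono: "m \<le> n \<Longrightarrow> kball a n \<subseteq> kball a m"
  by (auto simp: kball_def)

text \<open>Every point of a ball is a centre of it, so two balls that meet are nested.\<close>

lemma kball_Int:
  "kball a m \<inter> kball b n = {} \<or> kball a m \<inter> kball b n = kball a m \<or> kball a m \<inter> kball b n = kball b n"
proof (cases "kball a m \<inter> kball b n = {}")
  case False
  then obtain x where x: "kball a m = kball x m" "kball b n = kball x n"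
    using kball_eqI by blast
  show ?thesis
    using kball_mono[of m n x] kball_mono[of n m x] unfolding x by (cases "m \<le> n") auto
qed simp

lemma open_kball: "open (kball a n)" for a :: "'a::group_add fls"
  unfolding open_dist
proof (intro ballI)
  fix x assume x: "x \<in> kball a n"
  show "\<exists>e>0. \<forall>y. dist y x < e \<longrightarrow> y \<in> kball a n"
  proof (intro exI[of _ "inverse (2 ^ nat n)"] conjI allI impI)
    fix y :: "'a fls" assume d: "dist y x < inverse (2 ^ nat n)"
    have "y \<in> kball x n"
    proof (cases "y = x")
      case False
      then have *: "n \<le> fls_subdegree (y - x)"
        using fls_subdegree_gt_if_dist_less[OF d] by linarith
      have "(y - x) $$ j = 0" if "j < n" for j
        using * that by (intro fls_eq0_below_subdegree) linarith
      then show ?thesis by (auto simp: kball_def)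
    qed simp
    then show "y \<in> kball a n" using kball_eqI[OF x] by simp
  qed simp
qed

lemma open_contains_kball:
  fixes U :: "'a::group_add fls set"
  assumes "open U" "x \<in> U"
  shows "\<exists>n. kball x n \<subseteq> U"
proof -
  obtain e where e: "e > 0" "\<And>y. dist y x < e \<Longrightarrow> y \<in> U"
    using assms by (auto simp: open_dist)
  obtain m :: nat where m: "inverse (2 ^ m) < e"
    using real_arch_pow_inv[of e "1/2"] \<open>e > 0\<close> by (auto simp: power_one_over inverse_eq_divide)
  have "y \<in> U" if y: "y \<in> kball x (int m)" for y
  proof (cases "y = x")
    case False
    then have ne: "y - x \<noteq> 0" by simp
    have "int m \<le> fls_subdegree (y - x)"
      using y ne by (intro fls_subdegree_geI) (auto simp: kball_def)
    then have "m \<le> nat (fls_subdegree (y - x))" "0 \<le> fls_subdegree (y - x)" by linarith+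
    then have "dist y x = inverse (2 ^ nat (fls_subdegree (y - x)))"
      using False by (simp add: dist_fls_def)
    also have "\<dots> \<le> inverse (2 ^ m)"
      using \<open>m \<le> nat (fls_subdegree (y - x))\<close> by (intro le_imp_inverse_le power_increasing) auto
    finally show ?thesis using m e(2) by simp
  qed (use assms in simp)
  then show ?thesis by blast
qed

lemma kball_borel [measurable]: "kball a n \<in> sets borel" for a :: "'a::group_add fls"
  using open_kball by (rule borel_open)

definition fls_trunc :: "int \<Rightarrow> 'a::zero fls \<Rightarrow> 'a fls" where
  "fls_trunc n x = Abs_fls (\<lambda>k. if k < n then x $$ k else 0)"

lemma fls_trunc_nth [simp]: "fls_trunc n x $$ k = (if k < n then x $$ k else 0)"
  unfolding fls_trunc_def
  by (rule nth_Abs_fls_lower_bound[of "fls_subdegree x"]) simp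

text \<open>Representatives of \<open>Ksub m\<close> modulo \<open>Ksub n\<close> for m <= n. That
  there are finitely many turns periodization of a compactly supported function into a finite
  sum.\<close>

definition kbox :: "int \<Rightarrow> int \<Rightarrow> 'a::zero fls set" where
  "kbox m n = {x. \<forall>k. k < m \<or> n \<le> k \<longrightarrow> x $$ k = 0}"

lemma finite_kbox: "finite (kbox m n :: 'a::{zero,finite} fls set)"
proof (rule finite_subset)
  show "kbox m n \<subseteq> (\<lambda>g. Abs_fls (\<lambda>k. if m \<le> k \<and> k < n then g k else 0)) ` PiE {m..<n} (\<lambda>_. UNIV :: 'a set)"
  proof
    fix x :: "'a fls" assume x: "x \<in> kbox m n"
    have "x = Abs_fls (\<lambda>k. if m \<le> k \<and> k < n then restrict (fls_nth x) {m..<n} k else 0)"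
      by (rule fls_eqI, subst nth_Abs_fls_lower_bound[of m]) (use x in \<open>auto simp: kbox_def\<close>)
    then show "x \<in> (\<lambda>g. Abs_fls (\<lambda>k. if m \<le> k \<and> k < n then g k else 0)) ` PiE {m..<n} (\<lambda>_. UNIV)"
      by (rule image_eqI[where x = "restrict (fls_nth x) {m..<n}"]) auto
  qed
qed (auto intro!: finite_imageI finite_PiE)

text \<open>These series serve as centres: each ball of index n has exactly one centre of this
  shape, so there are countably many balls and every open set is a countable union of them.\<close>

lemma countable_trunc: "countable {x :: 'a::{zero,finite} fls. \<forall>k\<ge>n. x $$ k = 0}"
proof (rule countable_subset)
  show "{x :: 'a fls. \<forall>k\<ge>n. x $$ k = 0} \<subseteq> (\<Union>m. kbox m n)"
  proof
    fix x :: "'a fls" assume "x \<in> {x. \<forall>k\<ge>n. x $$ k = 0}"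
    then have "x \<in> kbox (fls_subdegree x) n" by (auto simp: kbox_def)
    then show "x \<in> (\<Union>m. kbox m n)" by blast
  qed
  show "countable (\<Union>m. kbox m n :: 'a fls set)"
    by (rule countable_UN[OF _ countable_finite[OF finite_kbox]]) simp
qed

lemma kball_trunc: "fls_trunc n x \<in> kball x n" "x \<in> kball (fls_trunc n x) n"
  by (auto simp: kball_def)

lemma borel_fls_eq:
  "sets (borel :: 'a::{group_add,finite} fls measure) = sigma_sets UNIV (range (case_prod kball))"
proof -
  let ?E = "range (case_prod kball) :: 'a fls set set"
  have "sigma_sets UNIV {S :: 'a fls set. open S} = sigma_sets UNIV ?E"
  proof (rule sigma_sets_eqI)
    fix U :: "'a fls set" assume "U \<in> {S. open S}"
    define J where "J = {(d, n). (\<forall>k\<ge>n. d $$ k = 0) \<and> kball d n \<subseteq> U}"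
    have "countable J"
    proof (rule countable_subset)
      show "J \<subseteq> (\<Union>n. (\<lambda>d. (d, n)) ` {x. \<forall>k\<ge>n. x $$ k = 0})" by (auto simp: J_def)
    qed (auto intro!: countable_trunc)
    have "U = (\<Union>(d, n)\<in>J. kball d n)"
    proof (intro equalityI subsetI)
      fix x assume "x \<in> U"
      then obtain n where n: "kball x n \<subseteq> U" using open_contains_kball \<open>U \<in> _\<close> by blast
      have "(fls_trunc n x, n) \<in> J"
        using n kball_eqI[OF kball_trunc(1)[of n x]] by (auto simp: J_def)
      then show "x \<in> (\<Union>(d, n)\<in>J. kball d n)" using kball_trunc(2) by blast
    qed (auto simp: J_def)
    moreover have "\<Union> (case_prod kball ` J) \<in> sigma_sets UNIV ?E"
      using \<open>countable J\<close> by (intro sigma_sets_UNION countable_image) (auto intro: sigma_sets.Basic)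
    ultimately show "U \<in> sigma_sets UNIV ?E" by simp
  next
    fix U assume "U \<in> ?E"
    then show "U \<in> sigma_sets UNIV {S. open S}"
      using open_kball by (auto intro!: sigma_sets.Basic)
  qed
  then show ?thesis by (simp add: borel_def)
qed

lemma UN_kball_UNIV: "(\<Union>i. kball 0 (- int i)) = (UNIV :: 'a::zero fls set)"
proof -
  have "x \<in> kball 0 (- int (nat (- fls_subdegree x)))" for x :: "'a fls"
    by (auto simp: kball_def)
  then show ?thesis by blast
qed

text \<open>The empty set is adjoined to accommodate disjoint balls.\<close>

lemma Int_stable_kballs: "Int_stable (insert {} (range (case_prod kball)))"
proof (rule Int_stableI)
  fix a b :: "'a::zero fls set"
  assume "a \<in> insert {} (range (case_prod kball))" "b \<in> insert {} (range (case_prod kball))"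
  then consider "a = {}" | "b = {}" | x m y n where "a = kball x m" "b = kball y n" by auto
  then show "a \<inter> b \<in> insert {} (range (case_prod kball))"
  proof cases
    case 3
    then show ?thesis using kball_Int[of x m y n] by force
  qed auto
qed

lemma borel_fls_eq_insert:
  "sets (borel :: 'a::{group_add,finite} fls measure) =
    sigma_sets UNIV (insert {} (range (case_prod kball)))"
  unfolding borel_fls_eq by (rule sigma_sets_eqI) (auto intro: sigma_sets.Basic sigma_sets.Empty)

lemma kball_measure_eqI:
  fixes M N :: "'a::{group_add,finite} fls measure"
  assumes "sets M = sets borel" "sets N = sets borel"
    and eq: "\<And>a n. emeasure M (kball a n) = emeasure N (kball a n)"
    and fin: "\<And>n. emeasure M (kball 0 n) \<noteq> \<infinity>"
  shows "M = N"
proof (rule measure_eqI_generator_eq)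
  let ?E = "insert {} (range (case_prod kball)) :: 'a fls set set"
  show "Int_stable ?E" by (rule Int_stable_kballs)
  show "sets M = sigma_sets UNIV ?E" "sets N = sigma_sets UNIV ?E"
    using assms(1,2) borel_fls_eq_insert by auto
  show "range (\<lambda>i. kball 0 (- int i)) \<subseteq> ?E" by auto
  show "(\<Union>i. kball 0 (- int i)) = (UNIV :: 'a fls set)" by (rule UN_kball_UNIV)
qed (use eq fin in auto)

lemma fls_monom_nth: "(fls_const c * fls_X_intpow i) $$ k = (if k = i then c else 0)"
  for c :: "'a::comm_ring_1"
  by (simp add: fls_X_intpow_times_conv_shift)

text \<open>In coordinates H0 is described by a vanishing condition opposite to that of
  \<open>Ksub 0\<close>, which exhibits it as a set of representatives of K modulo
  \<open>Ksub 0\<close>.\<close>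

lemma H0_eq: "H0 = {x :: 'a::{field,finite} fls. \<forall>k\<ge>0. x $$ k = 0}"
proof (intro equalityI subsetI)
  fix x :: "'a fls" assume "x \<in> H0"
  then show "x \<in> {x. \<forall>k\<ge>0. x $$ k = 0}"
    by (auto simp: H0_def fls_nth_sum fls_monom_nth intro!: sum.neutral)
next
  fix x :: "'a fls" assume x: "x \<in> {x. \<forall>k\<ge>0. x $$ k = 0}"
  define n where "n = nat (- fls_subdegree x)"
  have "x = (\<Sum>j=1..n. fls_const (x $$ (- int j)) * fls_X_intpow (- int j))"
  proof (rule fls_eqI)
    fix k
    have "(\<Sum>j=1..n. fls_const (x $$ (- int j)) * fls_X_intpow (- int j)) $$ k =
        (\<Sum>j=1..n. if j = nat (- k) \<and> k < 0 then x $$ k else 0)"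
      unfolding fls_nth_sum fls_monom_nth by (rule sum.cong) auto
    also have "\<dots> = x $$ k"
    proof (cases "nat (- k) \<in> {1..n} \<and> k < 0")
      case True
      then show ?thesis by (simp add: sum.delta)
    next
      case False
      then have "k \<ge> 0 \<or> k < fls_subdegree x" by (auto simp: n_def)
      then have "x $$ k = 0" using x by auto
      then show ?thesis by (intro trans[OF sum.neutral]) auto
    qed
    finally show "x $$ k = (\<Sum>j=1..n. fls_const (x $$ (- int j)) * fls_X_intpow (- int j)) $$ k" ..
  qed
  then show "x \<in> H0" unfolding H0_def
    by (intro CollectI exI[of _ n] exI[of _ "\<lambda>j. x $$ (- int j)"]) simp
qed

lemma H0_add: "x \<in> H0 \<Longrightarrow> y \<in> H0 \<Longrightarrow> x + y \<in> H0"
  and H0_zero: "0 \<in> H0"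
  by (auto simp: H0_eq)

section \<open>Haar measure on K\<close>

locale haar_K =
  fixes \<mu> :: "'a::{field,finite} fls measure"
  assumes haar: "is_haar_K \<mu>"
begin

definition q :: real where "q = real CARD('a)"

lemma q_pos: "q > 0"
  by (simp add: q_def)

lemma sets_mu [measurable_cong, simp]: "sets \<mu> = sets borel"
  using haar by (simp add: is_haar_K_def)

lemma space_mu [simp]: "space \<mu> = UNIV"
  using sets_eq_imp_space_eq[OF sets_mu] by simp

lemma plus_measurable [measurable]: "(\<lambda>x. a + x) \<in> borel \<rightarrow>\<^sub>M (borel :: 'a fls measure)"
proof (rule borel_measurable_continuous_onI)
  show "continuous_on UNIV (\<lambda>x :: 'a fls. a + x)"
    unfolding continuous_on_iff by (auto simp: dist_fls_def)
qed

lemma shift_measurable [measurable]: "fls_shift n \<in> borel \<rightarrow>\<^sub>M (borel :: 'a fls measure)"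
  by (rule borel_measurable_continuous_onI continuous_on_fls_shift)+

lemma nth_measurable [measurable]:
  fixes f :: "'a \<Rightarrow> 'b::topological_space"
  shows "(\<lambda>x. f (x $$ k)) \<in> borel_measurable borel"
  by (rule borel_measurable_continuous_onI continuous_on_fls_nth)+

lemma distr_plus: "distr \<mu> borel (\<lambda>x. a + x) = \<mu>"
  using haar by (simp add: is_haar_K_def)

lemma emeasure_kball_0: "emeasure \<mu> (kball a n) = emeasure \<mu> (kball 0 n)"
proof -
  have "emeasure \<mu> (kball a n) = emeasure (distr \<mu> borel (\<lambda>x. a + x)) (kball a n)"
    by (simp only: distr_plus)
  also have "\<dots> = emeasure \<mu> ((\<lambda>x. a + x) -` kball a n \<inter> space \<mu>)"
    by (rule emeasure_distr) auto
  also have "(\<lambda>x. a + x) -` kball a n \<inter> space \<mu> = kball 0 n"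
    by (auto simp: kball_def)
  finally show ?thesis .
qed

text \<open>There is one coset of \<open>Ksub (n + 1)\<close> for each value of the digit at place
  n, and translation invariance gives all q of them the same measure.\<close>

lemma emeasure_kball_Suc: "emeasure \<mu> (kball 0 n) = ennreal q * emeasure \<mu> (kball 0 (n + 1))"
proof -
  have eq: "kball 0 n = (\<Union>u\<in>(UNIV :: 'a set). kball (fls_const u * fls_X_intpow n) (n + 1))"
  proof (intro equalityI subsetI)
    fix x :: "'a fls" assume x: "x \<in> kball 0 n"
    have "x \<in> kball (fls_const (x $$ n) * fls_X_intpow n) (n + 1)"
      using x by (auto simp: kball_def fls_monom_nth)
    then show "x \<in> (\<Union>u. kball (fls_const u * fls_X_intpow n) (n + 1))" by blast
  next
    fix x :: "'a fls" assume "x \<in> (\<Union>u. kball (fls_const u * fls_X_intpow n) (n + 1))"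
    then obtain u where "\<And>j. j < n + 1 \<Longrightarrow> x $$ j = (fls_const u * fls_X_intpow n) $$ j"
      unfolding kball_def by blast
    then have "\<And>j. j < n + 1 \<Longrightarrow> x $$ j = (if j = n then u else 0)"
      unfolding fls_monom_nth .
    then show "x \<in> kball 0 n" by (simp add: kball_def)
  qed
  have "disjoint_family_on (\<lambda>u :: 'a. kball (fls_const u * fls_X_intpow n) (n + 1)) UNIV"
    unfolding disjoint_family_on_def
  proof (intro ballI impI)
    fix u v :: 'a assume "u \<noteq> v"
    then show "kball (fls_const u * fls_X_intpow n) (n + 1) \<inter> kball (fls_const v * fls_X_intpow n) (n + 1) = {}"
      by (auto simp: kball_def fls_monom_nth dest!: spec[of _ n])
  qed
  then have "emeasure \<mu> (kball 0 n) = (\<Sum>u\<in>(UNIV :: 'a set). emeasure \<mu> (kball (fls_const u * fls_X_intpow n) (n + 1)))"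
    unfolding eq by (intro sum_emeasure[symmetric]) auto
  also have "\<dots> = (\<Sum>u\<in>(UNIV :: 'a set). emeasure \<mu> (kball 0 (n + 1)))"
    by (rule sum.cong[OF refl emeasure_kball_0])
  finally show ?thesis by (simp add: q_def ennreal_of_nat_eq_real_of_nat)
qed

lemma emeasure_kball: "emeasure \<mu> (kball a n) = ennreal (q powi (- n))"
proof -
  have "emeasure \<mu> (kball 0 n) = ennreal (q powi (- n))"
  proof (induction n rule: int_induct[where k = 0])
    case base
    then show ?case using haar by (simp add: is_haar_K_def Ksub_eq_kball)
  next
    case (step1 n)
    have "ennreal q * emeasure \<mu> (kball 0 (n + 1)) = ennreal (q powi (- n))"
      using step1(2) emeasure_kball_Suc[of n] by (simp only:)
    also have "q powi (- n) = q * q powi (- (n + 1))"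
      using q_pos power_int_add[of q 1 "- (n + 1)"] by simp
    also have "ennreal \<dots> = ennreal q * ennreal (q powi (- (n + 1)))"
      using q_pos by (simp add: ennreal_mult)
    finally show ?case
      using q_pos by (simp add: ennreal_mult_cancel_left)
  next
    case (step2 n)
    have "q powi (- (n - 1)) = q * q powi (- n)"
      using q_pos power_int_add[of q 1 "- n"] by simp
    then show ?case
      using emeasure_kball_Suc[of "n - 1"] step2 q_pos by (simp add: ennreal_mult)
  qed
  then show ?thesis using emeasure_kball_0[of a n] by simp
qed

lemma measure_kball [simp]: "measure \<mu> (kball a n) = q powi (- n)"
  using q_pos by (simp add: measure_def emeasure_kball)

lemma emeasure_kball_finite [simp]: "emeasure \<mu> (kball a n) < top"
  by (simp add: emeasure_kball)

sublocale sigma_finite_measure \<mu>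
proof
  show "\<exists>A. countable A \<and> A \<subseteq> sets \<mu> \<and> \<Union> A = space \<mu> \<and> (\<forall>a\<in>A. emeasure \<mu> a \<noteq> \<infinity>)"
    using UN_kball_UNIV
    by (intro exI[of _ "range (\<lambda>i. kball 0 (- int i))"]) (auto simp: emeasure_kball)
qed

text \<open>Comparison on balls suffices: the preimage of a ball of index m is a ball of index m +
  n, whose measure is smaller by the factor q^(-n).\<close>

lemma distr_shift:
  "distr \<mu> borel (fls_shift n) = density \<mu> (\<lambda>_. ennreal (q powi (- n)))"
proof (rule kball_measure_eqI[symmetric])
  fix a :: "'a fls" and m
  have "fls_shift n -` kball a m \<inter> space \<mu> = kball (fls_shift (- n) a) (m + n)"
  proof (intro equalityI subsetI)
    fix x assume x: "x \<in> fls_shift n -` kball a m \<inter> space \<mu>"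
    have "x $$ j = a $$ (j - n)" if "j < m + n" for j
      using x that by (auto simp: kball_def dest!: spec[of _ "j - n"])
    then show "x \<in> kball (fls_shift (- n) a) (m + n)" by (simp add: kball_def)
  qed (auto simp: kball_def)
  then have "emeasure (distr \<mu> borel (fls_shift n)) (kball a m) = ennreal (q powi (- (m + n)))"
    by (subst emeasure_distr) (auto simp: emeasure_kball)
  also have "\<dots> = ennreal (q powi (- n)) * ennreal (q powi (- m))"
    using q_pos power_int_add[of q "-n" "-m"] by (simp add: add.commute flip: ennreal_mult)
  also have "\<dots> = emeasure (density \<mu> (\<lambda>_. ennreal (q powi (- n)))) (kball a m)"
    by (subst emeasure_density_const) (auto simp: emeasure_kball)
  finally show "emeasure (density \<mu> (\<lambda>_. ennreal (q powi (- n)))) (kball a m) =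
      emeasure (distr \<mu> borel (fls_shift n)) (kball a m)" ..
next
  fix m
  show "emeasure (density \<mu> (\<lambda>_. ennreal (q powi (- n)))) (kball 0 m) \<noteq> \<infinity>"
    by (subst emeasure_density_const) (auto simp: emeasure_kball ennreal_mult_eq_top_iff)
qed auto

lemma integral_translate:
  fixes f :: "'a fls \<Rightarrow> 'b::{banach, second_countable_topology}"
  assumes "f \<in> borel_measurable borel"
  shows "(\<integral>x. f (a + x) \<partial>\<mu>) = (\<integral>x. f x \<partial>\<mu>)"
  using integral_distr[of "\<lambda>x. a + x" \<mu> borel f] assms distr_plus[of a] by simp

lemma integrable_translate:
  fixes f :: "'a fls \<Rightarrow> 'b::{banach, second_countable_topology}"
  assumes "integrable \<mu> f"
  shows "integrable \<mu> (\<lambda>x. f (a + x))"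
proof -
  have "integrable (distr \<mu> borel (\<lambda>x. a + x)) f" using assms by (simp only: distr_plus)
  then show ?thesis by (rule integrable_distr[rotated]) simp
qed

lemma integral_shift:
  fixes f :: "'a fls \<Rightarrow> 'b::{banach, second_countable_topology}"
  assumes "f \<in> borel_measurable borel"
  shows "(\<integral>x. f (fls_shift n x) \<partial>\<mu>) = q powi (- n) *\<^sub>R (\<integral>x. f x \<partial>\<mu>)"
proof -
  have "(\<integral>x. f (fls_shift n x) \<partial>\<mu>) = (\<integral>x. f x \<partial>distr \<mu> borel (fls_shift n))"
    using assms by (intro integral_distr[symmetric]) auto
  also have "\<dots> = (\<integral>x. q powi (- n) *\<^sub>R f x \<partial>\<mu>)"
    unfolding distr_shift using assms q_pos by (intro integral_density) auto
  finally show ?thesis by simp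
qed

lemma integrable_shift:
  fixes f :: "'a fls \<Rightarrow> 'b::{banach, second_countable_topology}"
  assumes "integrable \<mu> f"
  shows "integrable \<mu> (\<lambda>x. f (fls_shift n x))"
proof -
  have "integrable (density \<mu> (\<lambda>_. ennreal (q powi (- n)))) f"
    using assms q_pos borel_measurable_integrable[OF assms] by (subst integrable_density) auto
  then have "integrable (distr \<mu> borel (fls_shift n)) f" by (simp only: distr_shift)
  then show ?thesis by (rule integrable_distr[rotated]) simp
qed

lemma L2_mu_borel: "f \<in> L2 \<mu> \<Longrightarrow> f \<in> borel_measurable borel"
  using L2_borel[of f \<mu>] by simp

lemma L2_translate:
  assumes "f \<in> L2 \<mu>"
  shows "(\<lambda>x. f (a + x)) \<in> L2 \<mu>" "L2_norm \<mu> (\<lambda>x. f (a + x)) = L2_norm \<mu> f"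
proof -
  have [measurable]: "f \<in> borel_measurable borel" using L2_mu_borel[OF assms] .
  show "(\<lambda>x. f (a + x)) \<in> L2 \<mu>"
    using integrable_translate[OF L2_integrable[OF assms]] by (simp add: L2_def)
  show "L2_norm \<mu> (\<lambda>x. f (a + x)) = L2_norm \<mu> f"
    using integral_translate[of "\<lambda>x. (cmod (f x))\<^sup>2" a] by (simp add: L2_norm_def)
qed

lemma L2_translate_minus:
  assumes "f \<in> L2 \<mu>"
  shows "(\<lambda>x. f (x - a)) \<in> L2 \<mu>" "L2_norm \<mu> (\<lambda>x. f (x - a)) = L2_norm \<mu> f"
  using L2_translate[OF assms, of "- a"] by simp_all

lemma L2_shift:
  assumes "f \<in> L2 \<mu>"
  shows "(\<lambda>x. f (fls_shift n x)) \<in> L2 \<mu>"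
    "L2_norm \<mu> (\<lambda>x. f (fls_shift n x)) = sqrt (q powi (- n)) * L2_norm \<mu> f"
proof -
  have [measurable]: "f \<in> borel_measurable borel" using L2_mu_borel[OF assms] .
  show "(\<lambda>x. f (fls_shift n x)) \<in> L2 \<mu>"
    using integrable_shift[OF L2_integrable[OF assms]] by (simp add: L2_def)
  show "L2_norm \<mu> (\<lambda>x. f (fls_shift n x)) = sqrt (q powi (- n)) * L2_norm \<mu> f"
    using integral_shift[of "\<lambda>x. (cmod (f x))\<^sup>2" n] by (simp add: L2_norm_def real_sqrt_mult)
qed

lemma indicator_L2:
  assumes "S \<in> sets borel" "emeasure \<mu> S < \<infinity>"
  shows "(\<lambda>x. indicator S x :: complex) \<in> L2 \<mu>"
proof -
  have "(\<lambda>x. (cmod (indicator S x))\<^sup>2) = (indicator S :: _ \<Rightarrow> real)"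
    by (auto simp: indicator_def)
  then show ?thesis using assms by (simp add: L2_def)
qed

section \<open>Density of the indicators of balls\<close>

definition kball_indicators :: "('a fls \<Rightarrow> complex) set" where
  "kball_indicators = range (\<lambda>(a, n) x. indicator (kball a n) x)"

lemma kball_indicators_L2: "kball_indicators \<subseteq> L2 \<mu>"
  unfolding kball_indicators_def by (auto intro!: indicator_L2)

text \<open>Induction over the sigma-algebra from the intersection-stable family of balls.
  Intersecting with a fixed ball keeps every indicator square-integrable, so complements and
  disjoint unions do not leave L2.\<close>

lemma indicator_Int_kball_in_closed_span:
  assumes "S \<in> sets borel"
  shows "(\<lambda>x. indicator (S \<inter> kball 0 n) x) \<in> L2_closed_span \<mu> kball_indicators"
proof -
  let ?E = "insert {} (range (case_prod kball)) :: 'a fls set set"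
  let ?W = "L2_closed_span \<mu> kball_indicators"
  have W: "L2_closed_subspace \<mu> ?W"
    using kball_indicators_L2 by (rule L2_closed_subspace_closed_span)
  have kball_W: "(\<lambda>x. indicator (kball a m) x) \<in> ?W" for a m
    using L2_closed_span_superset(2)[OF kball_indicators_L2] by (auto simp: kball_indicators_def)
  note Int_stable_kballs
  moreover have "?E \<subseteq> Pow UNIV" by simp
  moreover have "S \<in> sigma_sets UNIV ?E" using assms by (simp only: borel_fls_eq_insert)
  ultimately show ?thesis
  proof (induction rule: sigma_sets_induct_disjoint)
    case (basic A)
    then consider "A = {}" | a m where "A = kball a m" by auto
    then show ?case
    proof cases
      case 1
      then show ?thesis using L2_closed_subspace_zero[OF W] by simp
    next
      case (2 a m)
      then consider "A \<inter> kball 0 n = {}" | "A \<inter> kball 0 n = kball a m" | "A \<inter> kball 0 n = kball 0 n"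
        using kball_Int[of a m 0 n] by auto
      then show ?thesis
        using kball_W L2_closed_subspace_zero[OF W] by cases simp_all
    qed
  next
    case empty
    then show ?case using L2_closed_subspace_zero[OF W] by simp
  next
    case (compl A)
    have "(\<lambda>x. indicator ((UNIV - A) \<inter> kball 0 n) x :: complex) =
        (\<lambda>x. indicator (kball 0 n) x + (- 1) * indicator (A \<inter> kball 0 n) x)"
      by (auto simp: indicator_def)
    then show ?case
      using L2_closed_subspace_add[OF W kball_W[of 0 n] L2_closed_subspace_scale[OF W compl.IH, of "-1"]]
      by (simp only:)
  next
    case (union A)
    have A: "A i \<in> sets borel" for i
      using union.hyps unfolding borel_fls_eq_insert by auto
    have "L2_tendsto \<mu> (\<lambda>k x. \<Sum>i<k. indicator (A i \<inter> kball 0 n) x)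
        (\<lambda>x. indicator ((\<Union>i. A i) \<inter> kball 0 n) x :: complex) sequentially"
    proof (rule L2_dominated_convergence)
      show "(\<lambda>x. indicator (kball 0 n) x :: complex) \<in> L2 \<mu>" by (rule indicator_L2) auto
      have eq: "(\<Sum>i<k. indicator (A i \<inter> kball 0 n) x) = (indicator ((\<Union>i<k. A i) \<inter> kball 0 n) x :: complex)" for k x
      proof -
        have "disjoint_family_on (\<lambda>i. A i \<inter> kball 0 n) {..<k}"
          using union.hyps by (auto simp: disjoint_family_on_def)
        then have "(indicator (\<Union>i<k. A i \<inter> kball 0 n) x :: complex) = (\<Sum>i<k. indicator (A i \<inter> kball 0 n) x)"
          by (intro indicator_UN_disjoint) auto
        then show ?thesis by (simp add: Int_UN_distrib2)
      qed
      show "cmod (\<Sum>i<k. indicator (A i \<inter> kball 0 n) x) \<le> 1 * cmod (indicator (kball 0 n) x :: complex)" for k x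
        unfolding eq by (auto simp: indicator_def)
      show "(\<lambda>k. \<Sum>i<k. indicator (A i \<inter> kball 0 n) x) \<longlonglongrightarrow> (indicator ((\<Union>i. A i) \<inter> kball 0 n) x :: complex)" for x
        unfolding eq
      proof (cases "\<exists>i. x \<in> A i")
        case True
        then obtain i where i: "x \<in> A i" by blast
        have "eventually (\<lambda>k. (indicator ((\<Union>i<k. A i) \<inter> kball 0 n) x :: complex) =
            indicator ((\<Union>i. A i) \<inter> kball 0 n) x) sequentially"
          using eventually_gt_at_top[of i] by eventually_elim (use i in \<open>auto simp: indicator_def\<close>)
        then show "(\<lambda>k. indicator ((\<Union>i<k. A i) \<inter> kball 0 n) x) \<longlonglongrightarrow> (indicator ((\<Union>i. A i) \<inter> kball 0 n) x :: complex)"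
          by (rule tendsto_eventually)
      qed (auto simp: indicator_def)
    qed (use A in auto)
    moreover have "(\<lambda>x. \<Sum>i<k. indicator (A i \<inter> kball 0 n) x) \<in> ?W" for k
      using union.IH by (intro L2_closed_subspace_sum[OF W])
    ultimately show ?case
      using L2_closure_tendsto[of \<mu> _ _ sequentially ?W] L2_closed_subspace_closure[OF W] by simp
  qed
qed

lemma indicator_in_closed_span:
  assumes "S \<in> sets borel" "emeasure \<mu> S < \<infinity>"
  shows "(\<lambda>x. indicator S x) \<in> L2_closed_span \<mu> kball_indicators"
proof -
  let ?W = "L2_closed_span \<mu> kball_indicators"
  have W: "L2_closed_subspace \<mu> ?W"
    using kball_indicators_L2 by (rule L2_closed_subspace_closed_span)
  have "L2_tendsto \<mu> (\<lambda>i x. indicator (S \<inter> kball 0 (- int i)) x) (\<lambda>x. indicator S x :: complex) sequentially"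
  proof (rule L2_dominated_convergence)
    show "(\<lambda>x. indicator S x :: complex) \<in> L2 \<mu>" using assms by (rule indicator_L2)
    show "cmod (indicator (S \<inter> kball 0 (- int i)) x) \<le> 1 * cmod (indicator S x :: complex)" for i x
      by (auto simp: indicator_def)
    fix x :: "'a fls"
    have "eventually (\<lambda>i. (indicator (S \<inter> kball 0 (- int i)) x :: complex) = indicator S x) sequentially"
      using eventually_ge_at_top[of "nat (- fls_subdegree x)"]
    proof eventually_elim
      case (elim i)
      then have "x \<in> kball 0 (- int i)" by (auto simp: kball_def)
      then show ?case by (auto simp: indicator_def)
    qed
    then show "(\<lambda>i. indicator (S \<inter> kball 0 (- int i)) x) \<longlonglongrightarrow> (indicator S x :: complex)"
      by (rule tendsto_eventually)
  qed (use assms in auto)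
  then show ?thesis
    using L2_closure_tendsto[of \<mu> _ _ sequentially ?W] L2_closed_subspace_closure[OF W]
      indicator_Int_kball_in_closed_span[OF assms(1)] by simp
qed

theorem kball_indicators_dense: "L2_closed_span \<mu> kball_indicators = L2 \<mu>"
proof
  let ?W = "L2_closed_span \<mu> kball_indicators"
  have W: "L2_closed_subspace \<mu> ?W"
    using kball_indicators_L2 by (rule L2_closed_subspace_closed_span)
  show "?W \<subseteq> L2 \<mu>" by (rule L2_closed_subspace_subset[OF W])
  show "L2 \<mu> \<subseteq> ?W"
  proof
    fix f assume f: "f \<in> L2 \<mu>"
    then obtain s where s: "\<And>i. simple_function \<mu> (s i)"
      "\<And>x. (\<lambda>i. s i x) \<longlonglongrightarrow> f x" "\<And>i x. cmod (s i x) \<le> 2 * cmod (f x)"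
      using borel_measurable_implies_sequence_metric[OF L2_borel[OF f], of 0] by auto
    have conv: "L2_tendsto \<mu> s f sequentially"
      using s f by (intro L2_dominated_convergence[where w = f and C = 2])
        (auto intro: borel_measurable_simple_function L2_borel)
    have "s i \<in> ?W" for i
    proof -
      have sL2: "s i \<in> L2 \<mu>"
        using s borel_measurable_simple_function[OF s(1)] by (intro L2_bound[OF f, of _ 2]) auto
      have fin: "finite (range (s i))" using s(1)[of i] by (simp add: simple_function_def)
      have "(\<lambda>x. y * indicator (s i -` {y}) x) \<in> ?W" if "y \<noteq> 0" for y
      proof -
        have meas: "s i -` {y} \<in> sets borel"
          using simple_functionD(2)[OF s(1), of i "{y}"] by simp
        \<comment> \<open>Chebyshev's argument: a nonzero value can be taken only on a set of finite
          measure.\<close>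
        have "integrable \<mu> (\<lambda>x. (cmod (s i x))\<^sup>2 / (cmod y)\<^sup>2)"
          using sL2 by (simp add: L2_def)
        then have "integrable \<mu> (indicator (s i -` {y}) :: _ \<Rightarrow> real)"
          by (rule Bochner_Integration.integrable_bound)
             (use meas that in \<open>auto simp: indicator_def\<close>)
        then have "emeasure \<mu> (s i -` {y}) < \<infinity>"
          by (simp add: integrable_indicator_iff)
        then show ?thesis
          using indicator_in_closed_span[OF meas] by (intro L2_closed_subspace_scale[OF W])
      qed
      then have "(\<lambda>x. y * indicator (s i -` {y}) x) \<in> ?W" for y
        using L2_closed_subspace_zero[OF W] by (cases "y = 0") auto
      then have "(\<lambda>x. \<Sum>y\<in>range (s i). y * indicator (s i -` {y}) x) \<in> ?W"
        by (intro L2_closed_subspace_sum[OF W])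
      moreover have "(\<Sum>y\<in>range (s i). y * indicator (s i -` {y}) x) = s i x" for x
      proof -
        have "(\<Sum>y\<in>range (s i). y * indicator (s i -` {y}) x) = (\<Sum>y\<in>{s i x}. y * indicator (s i -` {y}) x)"
          using fin by (intro sum.mono_neutral_right) (auto simp: indicator_def)
        then show ?thesis by simp
      qed
      ultimately show ?thesis by simp
    qed
    then show "f \<in> ?W"
      using L2_closure_tendsto[OF conv, of ?W] L2_closed_subspace_closure[OF W] by simp
  qed
qed

end

section \<open>Self-duality\<close>

definition fmon :: "int \<Rightarrow> 'a \<Rightarrow> 'a::comm_ring_1 fls" where
  "fmon k u = fls_const u * fls_X_intpow k"

lemma fmon_nth [simp]: "fmon k u $$ j = (if j = k then u else 0)"
  unfolding fmon_def by (rule fls_monom_nth)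

lemma fmon_add: "fmon k (u + v) = fmon k u + fmon k v"
  by (rule fls_eqI) simp

lemma fmon_0 [simp]: "fmon k 0 = 0"
  by (rule fls_eqI) simp

section \<open>The bicharacter of the coefficient field\<close>

locale local_field = haar_K \<mu> for \<mu> :: "'a::{field,finite} fls measure" +
  fixes p s :: nat and coord :: "'a \<Rightarrow> nat \<Rightarrow> nat"
  assumes coords: "gf_coordinates p s coord"
begin

lemma p_pos: "p > 0" and p_gt_1: "p > 1"
  using coords prime_gt_0_nat[of p] prime_gt_1_nat[of p] by (auto simp: gf_coordinates_def)

lemma coord_add: "l < s \<Longrightarrow> coord (u + v) l = (coord u l + coord v l) mod p"
  using coords by (simp add: gf_coordinates_def)

lemma coord_bij: "bij_betw (\<lambda>u. restrict (coord u) {..<s}) UNIV ({..<s} \<rightarrow>\<^sub>E {..<p})"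
  using coords by (simp add: gf_coordinates_def)

lemma coord_less: "l < s \<Longrightarrow> coord u l < p"
  using bij_betw_apply[OF coord_bij, of u] by (auto simp: PiE_iff)

lemma coord_eqI:
  assumes "\<And>l. l < s \<Longrightarrow> coord u l = coord v l"
  shows "u = v"
proof -
  have "restrict (coord u) {..<s} = restrict (coord v) {..<s}"
    using assms by (auto simp: restrict_def)
  then show ?thesis using coord_bij by (auto simp: bij_betw_def inj_on_def)
qed

lemma coord_surj:
  assumes "\<And>l. l < s \<Longrightarrow> k l < p"
  shows "\<exists>u. \<forall>l<s. coord u l = k l"
proof -
  have "restrict k {..<s} \<in> {..<s} \<rightarrow>\<^sub>E {..<p}" using assms by auto
  then obtain u where "restrict k {..<s} = restrict (coord u) {..<s}"
    using coord_bij by (metis (no_types, lifting) bij_betw_imp_surj_on imageE)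
  then show ?thesis by (metis lessThan_iff restrict_apply')
qed

lemma coord_0:
  assumes "l < s"
  shows "coord 0 l = 0"
proof -
  define c where "c = coord 0 l"
  have c: "c = (c + c) mod p" "c < p"
    using coord_add[OF assms, of 0 0] coord_less[OF assms, of 0] by (simp_all add: c_def)
  have "c = 0"
  proof (cases "c + c < p")
    case False
    \<comment> \<open>In this case c = 2 c - p, that is c = p, against c < p.\<close>
    then have "(c + c) mod p = c + c - p" using c(2) by (simp add: le_mod_geq)
    then show ?thesis using c False by linarith
  qed (use c in simp)
  then show ?thesis by (simp add: c_def)
qed

lemma coord_of_nat_mult: "l < s \<Longrightarrow> coord (of_nat n * u) l = (n * coord u l) mod p"
  by (induction n) (simp_all add: coord_0 coord_add distrib_right mod_simps add.commute)

lemma char_p: "of_nat p * u = (0::'a)"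
  by (rule coord_eqI) (simp add: coord_of_nat_mult coord_0)

lemma coord_sum:
  assumes "l < s"
  shows "coord (\<Sum>i\<in>I. f i) l = (\<Sum>i\<in>I. coord (f i) l) mod p"
  using assms by (induction I rule: infinite_finite_induct) (simp_all add: coord_0 coord_add mod_simps)

text \<open>The l-th basis vector of GF(p)^s, and 0 for l >= s.\<close>

definition coord_unit :: "nat \<Rightarrow> 'a" where
  "coord_unit l = (SOME u. \<forall>l'<s. coord u l' = (if l' = l then 1 else 0))"

lemma coord_unit: "l' < s \<Longrightarrow> coord (coord_unit l) l' = (if l' = l then 1 else 0)"
  using someI_ex[OF coord_surj[of "\<lambda>l'. if l' = l then 1 else 0"]] p_gt_1
  unfolding coord_unit_def by auto

lemma coord_decomp: "u = (\<Sum>l<s. of_nat (coord u l) * coord_unit l)"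
proof (rule coord_eqI)
  fix l assume l: "l < s"
  have "coord (\<Sum>l<s. of_nat (coord u l) * coord_unit l) l =
      (\<Sum>l'<s. (coord u l' * (if l = l' then 1 else 0)) mod p) mod p"
    using l by (simp add: coord_sum coord_of_nat_mult coord_unit)
  also have "\<dots> = (\<Sum>l'<s. if l' = l then coord u l' else 0) mod p"
    using l by (intro arg_cong[of _ _ "\<lambda>x. x mod p"] sum.cong) (auto simp: coord_less)
  also have "\<dots> = coord u l"
    using l by (simp add: coord_less)
  finally show "coord u l = coord (\<Sum>l<s. of_nat (coord u l) * coord_unit l) l" ..
qed

definition psi :: "'a \<Rightarrow> 'a \<Rightarrow> complex" where
  "psi u v = exp (2 * of_real pi * \<i> / of_nat p * of_nat (\<Sum>l<s. coord u l * coord v l))"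

lemma psi_commute: "psi u v = psi v u"
  by (simp add: psi_def mult.commute)

lemma norm_psi [simp]: "norm (psi u v) = 1"
  using norm_exp_i_times[of "2 * pi / real p * real (\<Sum>l<s. coord u l * coord v l)"]
  by (simp add: psi_def mult_ac)

lemma psi_nonzero [simp]: "psi u v \<noteq> 0"
  by (simp add: psi_def)

lemma psi_add: "psi (u + v) w = psi u w * psi v w"
proof -
  have "(\<Sum>l<s. coord (u + v) l * coord w l) mod p =
      (\<Sum>l<s. coord (u + v) l * coord w l mod p) mod p"
    by (simp only: mod_sum_eq)
  also have "\<dots> = (\<Sum>l<s. (coord u l * coord w l + coord v l * coord w l) mod p) mod p"
    by (simp add: coord_add mod_mult_left_eq flip: distrib_right)
  also have "\<dots> = (\<Sum>l<s. coord u l * coord w l + coord v l * coord w l) mod p"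
    by (simp only: mod_sum_eq)
  finally show ?thesis
    unfolding psi_def exp_add[symmetric] distrib_left[symmetric] of_nat_add[symmetric] sum.distrib[symmetric]
    by (rule exp_root_unity_mod[OF p_pos])
qed

lemma psi_add_right: "psi w (u + v) = psi w u * psi w v"
  using psi_add[of u v w] by (simp add: psi_commute)

lemma psi_0 [simp]: "psi 0 w = 1" "psi w 0 = 1"
  using psi_add[of 0 0 w] psi_add_right[of w 0 0] by simp_all

lemma psi_coord_unit:
  assumes "l < s"
  shows "psi u (coord_unit l) = exp (2 * of_real pi * \<i> * of_nat (coord u l) / of_nat p)"
proof -
  have "(\<Sum>l'<s. coord u l' * coord (coord_unit l) l') = (\<Sum>l'<s. if l' = l then coord u l' else 0)"
    by (rule sum.cong) (auto simp: coord_unit)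
  then show ?thesis using assms by (simp add: psi_def)
qed

text \<open>Pairing with the l-th basis vector gives a p-th root of unity whose exponent is the l-th
  coordinate.\<close>

lemma psi_nondegenerate:
  assumes "\<And>w. psi u w = psi v w"
  shows "u = v"
proof (rule coord_eqI)
  fix l assume l: "l < s"
  have "exp (2 * of_real pi * \<i> * of_nat (coord u l) / of_nat p) =
      exp (2 * of_real pi * \<i> * of_nat (coord v l) / of_nat p)"
    using assms[of "coord_unit l"] psi_coord_unit[OF l] by simp
  then have "coord u l mod p = coord v l mod p"
    using complex_root_unity_eq[of p "coord u l" "coord v l"] p_pos by (simp add: mult_ac)
  then show "coord u l = coord v l" using coord_less[OF l] by simp
qed

lemma hom_of_nat_mult:
  fixes \<xi> :: "'b::semiring_1 \<Rightarrow> complex"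
  assumes "\<And>x y. \<xi> (x + y) = \<xi> x * \<xi> y" "\<xi> 0 = 1"
  shows "\<xi> (of_nat n * x) = \<xi> x ^ n"
  by (induction n) (simp_all add: assms distrib_right)

lemma hom_sum:
  fixes \<xi> :: "'b::comm_monoid_add \<Rightarrow> complex"
  assumes "\<And>x y. \<xi> (x + y) = \<xi> x * \<xi> y" "\<xi> 0 = 1" "finite I"
  shows "\<xi> (\<Sum>i\<in>I. f i) = (\<Prod>i\<in>I. \<xi> (f i))"
  using assms(3) by (induction I rule: finite_induct) (simp_all add: assms)

text \<open>Multiplication by p is zero, so the values at the basis vectors are p-th roots of unity.
  Their exponents are the coordinates of the representing element, and these values determine the
  homomorphism.\<close>

lemma psi_represents:
  assumes hom: "\<And>x y. \<xi> (x + y) = \<xi> x * \<xi> y" and one: "\<xi> (0 :: 'a) = (1 :: complex)"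
  shows "\<exists>v. \<forall>u. \<xi> u = psi v u"
proof -
  have "\<exists>k<p. \<xi> (coord_unit l) = exp (2 * of_real pi * \<i> * of_nat k / of_nat p)" for l
  proof -
    have "\<xi> (coord_unit l) ^ p = 1"
      using hom_of_nat_mult[OF hom one, of p "coord_unit l"] by (simp add: char_p one)
    then have "\<xi> (coord_unit l) \<in> {z. z ^ p = 1}" by simp
    then show ?thesis using complex_roots_unity[of p] p_pos by auto
  qed
  then obtain k where k: "\<And>l. k l < p"
    "\<And>l. \<xi> (coord_unit l) = exp (2 * of_real pi * \<i> * of_nat (k l) / of_nat p)"
    by metis
  obtain v where v: "\<And>l. l < s \<Longrightarrow> coord v l = k l" using coord_surj[of k] k by blast
  have gen: "\<zeta> u = (\<Prod>l<s. \<zeta> (coord_unit l) ^ coord u l)"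
    if "\<And>x y. \<zeta> (x + y) = \<zeta> x * \<zeta> y" "\<zeta> 0 = 1" for \<zeta> :: "'a \<Rightarrow> complex" and u
    by (subst coord_decomp[of u]) (simp add: hom_sum[OF that] hom_of_nat_mult[OF that])
  have "\<xi> u = psi v u" for u
  proof -
    have "\<xi> u = (\<Prod>l<s. \<xi> (coord_unit l) ^ coord u l)" by (rule gen[OF hom one])
    also have "\<dots> = (\<Prod>l<s. psi v (coord_unit l) ^ coord u l)"
      by (rule prod.cong) (auto simp: k psi_coord_unit v)
    also have "\<dots> = psi v u" by (rule gen[symmetric]) (simp_all add: psi_add_right)
    finally show ?thesis .
  qed
  then show ?thesis by blast
qed

text \<open>The product runs over the finitely many places where both digits are nonzero. Reflecting
  by \<open>- 1 - k\<close> rather than \<open>- k\<close> makes \<open>Ksub 0\<close> its own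
  annihilator (with \<open>- k\<close> it would be \<open>Ksub 1\<close>), so the two normalisations
  of Haar measure correspond.\<close>

definition pair :: "'a fls \<Rightarrow> 'a fls \<Rightarrow> complex" where
  "pair b x = (\<Prod>k | b $$ (- 1 - k) \<noteq> 0 \<and> x $$ k \<noteq> 0. psi (b $$ (- 1 - k)) (x $$ k))"

lemma pair_support: "{k. b $$ (- 1 - k) \<noteq> 0 \<and> x $$ k \<noteq> 0} \<subseteq> {fls_subdegree x .. - 1 - fls_subdegree b}"
proof
  fix k assume "k \<in> {k. b $$ (- 1 - k) \<noteq> 0 \<and> x $$ k \<noteq> 0}"
  then have "\<not> k < fls_subdegree x" "\<not> - 1 - k < fls_subdegree b" by auto
  then show "k \<in> {fls_subdegree x .. - 1 - fls_subdegree b}" by auto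
qed

lemma pair_eq_prod:
  assumes "finite J" "{k. b $$ (- 1 - k) \<noteq> 0 \<and> x $$ k \<noteq> 0} \<subseteq> J"
  shows "pair b x = (\<Prod>k\<in>J. psi (b $$ (- 1 - k)) (x $$ k))"
  unfolding pair_def using assms by (intro prod.mono_neutral_left) auto

lemma pair_commute: "pair b x = pair x b"
  unfolding pair_def
  by (rule prod.reindex_bij_witness[of _ "\<lambda>k. - 1 - k" "\<lambda>k. - 1 - k"]) (auto simp: psi_commute)

lemma norm_pair [simp]: "norm (pair b x) = 1"
  unfolding pair_def by (simp flip: prod_norm)

lemma pair_nonzero [simp]: "pair b x \<noteq> 0"
  using norm_pair[of b x] by (metis norm_zero zero_neq_one)

lemma pair_add_right: "pair b (x + y) = pair b x * pair b y"
proof -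
  let ?J = "{min (fls_subdegree x) (fls_subdegree y) .. - 1 - fls_subdegree b}"
  have J: "{k. b $$ (- 1 - k) \<noteq> 0 \<and> x $$ k \<noteq> 0} \<subseteq> ?J" "{k. b $$ (- 1 - k) \<noteq> 0 \<and> y $$ k \<noteq> 0} \<subseteq> ?J"
    by (rule order_trans[OF pair_support]; simp)+
  then have "{k. b $$ (- 1 - k) \<noteq> 0 \<and> (x + y) $$ k \<noteq> 0} \<subseteq> ?J" by fastforce
  then show ?thesis
    using J by (simp add: pair_eq_prod[of ?J] psi_add_right prod.distrib)
qed

lemma pair_add_left: "pair (b + c) x = pair b x * pair c x"
  using pair_add_right[of x b c] by (simp add: pair_commute)

lemma pair_0 [simp]: "pair 0 x = 1" "pair b 0 = 1"
  by (simp_all add: pair_def)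

lemma pair_uminus_right: "pair b (- x) = cnj (pair b x)"
proof -
  have "pair b (- x) * pair b x = 1" using pair_add_right[of b "- x" x] by simp
  moreover have "cnj (pair b x) * pair b x = 1"
    using complex_mod_sqrt_Re_mult_cnj[of "pair b x"] complex_norm_square[of "pair b x"]
    by (simp add: mult.commute)
  ultimately show ?thesis by (metis mult_right_cancel pair_nonzero)
qed

lemma pair_uminus_left: "pair (- b) x = cnj (pair b x)"
  using pair_uminus_right[of x b] by (simp add: pair_commute)

lemma pair_cnj_mult [simp]: "cnj (pair b x) * pair b x = 1" "pair b x * cnj (pair b x) = 1"
  using pair_add_right[of b "- x" x] by (simp_all add: pair_uminus_right mult.commute)

lemma pair_diff_left: "pair (b - c) x = pair b x * cnj (pair c x)"
  using pair_add_left[of b "- c" x] by (simp add: pair_uminus_left)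

lemma pair_eq_1I:
  assumes "\<And>k. b $$ (- 1 - k) = 0 \<or> x $$ k = 0"
  shows "pair b x = 1"
  unfolding pair_def using assms by (intro prod.neutral) auto

lemma pair_kball_eq_1:
  assumes "b \<in> kball 0 n" "x \<in> kball 0 (- n)"
  shows "pair b x = 1"
proof (rule pair_eq_1I)
  show "b $$ (- 1 - k) = 0 \<or> x $$ k = 0" for k
    using assms by (cases "k < - n") (auto simp: kball_def)
qed

lemma pair_H0_eq_1:
  assumes "b \<in> H0" "x \<in> H0"
  shows "pair b x = 1"
proof (rule pair_eq_1I)
  show "b $$ (- 1 - k) = 0 \<or> x $$ k = 0" for k
    using assms by (cases "k \<ge> 0") (auto simp: H0_eq)
qed

lemma pair_shift: "pair (fls_shift n b) x = pair b (fls_shift n x)"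
proof -
  have "- 1 - (k - n) = - 1 - k + n" "- 1 - (k + n) + n = - 1 - k" for k by simp_all
  then show ?thesis unfolding pair_def fls_shift_nth
    by (intro prod.reindex_bij_witness[of _ "\<lambda>k. k + n" "\<lambda>k. k - n"]) (simp_all only: mem_Collect_eq diff_add_cancel add_diff_cancel_right' simp_thms)
qed

lemma pair_monom: "pair b (fmon k u) = psi (b $$ (- 1 - k)) u"
proof -
  have "pair b (fmon k u) =
      (\<Prod>j\<in>{k}. psi (b $$ (- 1 - j)) ((fmon k u) $$ j))"
    by (rule pair_eq_prod) (auto simp only: fmon_nth split: if_splits)
  then show ?thesis by (simp only: fmon_nth) simp
qed

lemma pair_trivial_on_kball_iff: "(\<forall>x\<in>kball 0 n. pair b x = 1) \<longleftrightarrow> b \<in> kball 0 (- n)"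
proof
  assume triv: "\<forall>x\<in>kball 0 n. pair b x = 1"
  show "b \<in> kball 0 (- n)" unfolding kball_def
  proof (intro CollectI allI impI)
    fix j assume j: "j < - n"
    have "psi (b $$ j) u = psi 0 u" for u
    proof -
      have "fmon (- 1 - j) u \<in> kball 0 n"
        unfolding kball_def fmon_nth using j by auto
      then show ?thesis using triv pair_monom[of b "- 1 - j" u] by auto
    qed
    then show "b $$ j = 0 $$ j" using psi_nondegenerate by force
  qed
next
  assume "b \<in> kball 0 (- n)"
  then show "\<forall>x\<in>kball 0 n. pair b x = 1" using pair_kball_eq_1[of b "- n"] by auto
qed

text \<open>Local constancy: \<open>pair b\<close> is trivial on the ball about 0 dual to one that
  contains \<open>b\<close>, hence constant on its cosets.\<close>

lemma continuous_pair: "continuous_on UNIV (pair b)"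
  unfolding continuous_on_def
proof
  fix x :: "'a fls"
  define n where "n = fls_subdegree b"
  have b: "b \<in> kball 0 n" by (auto simp: kball_def n_def)
  have "eventually (\<lambda>y. y \<in> kball x (- n)) (nhds x)"
    using open_kball by (rule eventually_nhds_in_open) simp
  then have "eventually (\<lambda>y. pair b y = pair b x) (nhds x)"
  proof eventually_elim
    case (elim y)
    then have "y - x \<in> kball 0 (- n)" using kball_iff_diff by blast
    then have "pair b (y - x) = 1" using pair_kball_eq_1[OF b] by blast
    then show ?case using pair_add_right[of b "y - x" x] by simp
  qed
  then show "((pair b) \<longlongrightarrow> pair b x) (at x within UNIV)"
    by (intro tendsto_eventually) (simp add: eventually_at_filter eventually_mono)
qed

lemma pair_measurable [measurable]: "pair b \<in> borel_measurable borel"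
  using continuous_pair by (rule borel_measurable_continuous_onI)

lemma pair_measurable_left [measurable]: "(\<lambda>b. pair b x) \<in> borel_measurable borel"
  using pair_measurable[of x] by (simp add: pair_commute[of _ x])

text \<open>Joint measurability is what Fubini asks for. The products over |k| <= m stabilise
  pointwise, and each factor is a finite combination of products of digit indicators, one for each
  pair of coefficients.\<close>

lemma pair_joint_measurable [measurable]:
  "(\<lambda>z. pair (fst z) (snd z)) \<in> borel_measurable (borel \<Otimes>\<^sub>M borel)"
proof (rule borel_measurable_LIMSEQ_metric)
  fix m :: nat
  have eq: "psi u v = (\<Sum>u'\<in>UNIV. \<Sum>v'\<in>UNIV. psi u' v' * ((if u = u' then 1 else 0) * (if v = v' then 1 else 0)))" for u v :: 'a
  proof -
    have "(\<Sum>v'\<in>UNIV. psi u' v' * ((if u = u' then 1 else 0) * (if v = v' then 1 else 0))) =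
        (if u' = u then psi u' v else 0)" for u'
    proof -
      have "(\<Sum>v'\<in>UNIV. psi u' v' * ((if u = u' then 1 else 0) * (if v = v' then 1 else 0))) =
          (\<Sum>v'\<in>UNIV. if v' = v then psi u' v * (if u = u' then 1 else 0) else 0)"
        by (rule sum.cong) auto
      then show ?thesis by simp
    qed
    then show ?thesis by simp
  qed
  have *: "(\<lambda>z. (if fst z $$ i = u then 1 else 0) :: complex) \<in> borel_measurable (borel \<Otimes>\<^sub>M borel)"
    "(\<lambda>z. (if snd z $$ i = u then 1 else 0) :: complex) \<in> borel_measurable (borel \<Otimes>\<^sub>M borel)" for i and u :: 'a
    by (rule measurable_compose[OF measurable_fst nth_measurable[of "\<lambda>v. if v = u then 1 else 0" i]]
        measurable_compose[OF measurable_snd nth_measurable[of "\<lambda>v. if v = u then 1 else 0" i]])+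
  have "(\<lambda>z. psi (fst z $$ i) (snd z $$ k)) \<in> borel_measurable (borel \<Otimes>\<^sub>M borel)" for i k
    by (subst eq) (intro borel_measurable_sum borel_measurable_times borel_measurable_const *)
  then show "(\<lambda>z. \<Prod>k\<in>{- int m..int m}. psi (fst z $$ (- 1 - k)) (snd z $$ k)) \<in> borel_measurable (borel \<Otimes>\<^sub>M borel)"
    by (intro borel_measurable_prod)
next
  fix z :: "'a fls \<times> 'a fls"
  have "eventually (\<lambda>m. (\<Prod>k\<in>{- int m..int m}. psi (fst z $$ (- 1 - k)) (snd z $$ k)) = pair (fst z) (snd z)) sequentially"
    using eventually_ge_at_top[of "nat (\<bar>fls_subdegree (fst z)\<bar> + \<bar>fls_subdegree (snd z)\<bar> + 1)"]
  proof eventually_elim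
    case (elim m)
    then show ?case
      by (intro pair_eq_prod[symmetric] order_trans[OF pair_support]) auto
  qed
  then show "(\<lambda>m. \<Prod>k\<in>{- int m..int m}. psi (fst z $$ (- 1 - k)) (snd z $$ k)) \<longlonglongrightarrow> pair (fst z) (snd z)"
    by (rule tendsto_eventually)
qed

section \<open>The character group as a copy of K\<close>

definition Theta :: "'a fls \<Rightarrow> 'a fls character" where
  "Theta b = Abs_character (pair b)"

lemma char_eval_Theta [simp]: "char_eval (Theta b) = pair b"
  unfolding Theta_def by (rule Abs_character_inverse) (simp add: continuous_pair pair_add_right)

lemma char_eval_add: "char_eval \<xi> (x + y) = char_eval \<xi> x * char_eval \<xi> y"
  and norm_char_eval: "norm (char_eval \<xi> x) = 1"
  and continuous_char_eval: "continuous_on UNIV (char_eval \<xi>)"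
  using char_eval[of \<xi>] by auto

lemma char_eval_0: "char_eval \<xi> 0 = 1"
proof -
  have "char_eval \<xi> 0 * char_eval \<xi> 0 = char_eval \<xi> 0" using char_eval_add[of \<xi> 0 0] by simp
  moreover have "char_eval \<xi> 0 \<noteq> 0" using norm_char_eval[of \<xi> 0] by auto
  ultimately show ?thesis by simp
qed

lemma character_eqI: "(\<And>x. char_eval \<xi> x = char_eval \<zeta> x) \<Longrightarrow> \<xi> = \<zeta>"
  by (metis char_eval_inject ext)

lemma Theta_add: "Theta (b + c) = Theta b * Theta c"
  by (rule character_eqI) (simp add: times_character.rep_eq pair_add_left)

lemma pair_inject:
  assumes "\<And>x. pair b x = pair c x"
  shows "b = c"
proof (rule fls_eqI)
  fix j
  have "psi (b $$ j) u = psi (c $$ j) u" for u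
    using assms[of "fmon (- 1 - j) u"] pair_monom[of _ "- 1 - j" u] by simp
  then show "b $$ j = c $$ j" by (rule psi_nondegenerate)
qed

lemma inj_Theta: "inj Theta"
  by (rule injI) (metis char_eval_Theta pair_inject)

lemma fls_trunc_eq_sum:
  "fls_trunc n x = (\<Sum>k\<in>{fls_subdegree x..<n}. fmon k (x $$ k))"
proof (rule fls_eqI)
  fix j
  have "(\<Sum>k\<in>{fls_subdegree x..<n}. fmon k (x $$ k)) $$ j =
      (\<Sum>k\<in>{fls_subdegree x..<n}. if k = j then x $$ j else 0)"
    unfolding fls_nth_sum fmon_nth by (rule sum.cong) auto
  also have "\<dots> = fls_trunc n x $$ j"
    by (auto simp: sum.delta)
  finally show "fls_trunc n x $$ j = (\<Sum>k\<in>{fls_subdegree x..<n}. fmon k (x $$ k)) $$ j" ..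
qed

text \<open>K has characteristic p, so all values are p-th roots of unity, a finite set in which 1
  is isolated; continuity at 0 does the rest.\<close>

lemma character_trivial_on_kball:
  fixes \<xi> :: "'a fls character"
  shows "\<exists>n. \<forall>x\<in>kball 0 n. char_eval \<xi> x = 1"
proof -
  define U where "U = - ({z :: complex. z ^ p = 1} - {1})"
  have "open U"
    unfolding U_def using finite_roots_unity[of p, where ?'a = complex] p_pos
    by (intro open_Compl finite_imp_closed) simp
  then have "open (char_eval \<xi> -` U)"
    using continuous_char_eval[of \<xi>] by (simp add: continuous_on_open_vimage)
  moreover have "0 \<in> char_eval \<xi> -` U" by (simp add: U_def char_eval_0)
  ultimately obtain n where n: "kball 0 n \<subseteq> char_eval \<xi> -` U"
    using open_contains_kball by blast
  have "char_eval \<xi> x ^ p = 1" for x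
  proof -
    have "char_eval \<xi> (of_nat p * x) = char_eval \<xi> x ^ p"
      by (rule hom_of_nat_mult) (simp_all add: char_eval_add char_eval_0)
    moreover have "of_nat p * x = 0"
      by (rule fls_eqI) (simp add: fls_of_nat char_p)
    ultimately show ?thesis by (simp add: char_eval_0)
  qed
  then show ?thesis using n by (intro exI[of _ n]) (auto simp: U_def)
qed

text \<open>On the monomials at place k the character restricts to a character of the coefficient
  field, represented by some \<open>v k\<close>. Triviality on a small ball makes \<open>v k\<close>
  vanish for large k, so the reflected family is a Laurent series, and it also reduces every
  argument to a truncation, a finite sum of monomials.\<close>

theorem surj_Theta: "surj Theta"
proof -
  have "\<exists>b. \<xi> = Theta b" for \<xi>
  proof -
    obtain n where n: "\<And>x. x \<in> kball 0 n \<Longrightarrow> char_eval \<xi> x = 1"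
      using character_trivial_on_kball by blast
    have "\<exists>v. \<forall>u. char_eval \<xi> (fmon k u) = psi v u" for k
    proof (rule psi_represents)
      show "char_eval \<xi> (fmon k (u + v)) =
          char_eval \<xi> (fmon k u) * char_eval \<xi> (fmon k v)" for u v
        by (simp add: fmon_add char_eval_add)
    qed (simp add: char_eval_0)
    then obtain v where v: "\<And>k u. char_eval \<xi> (fmon k u) = psi (v k) u"
      by metis
    have v0: "v k = 0" if "k \<ge> n" for k
    proof (rule psi_nondegenerate)
      fix u :: 'a
      have "fmon k u \<in> kball 0 n"
        unfolding kball_def fmon_nth using that by auto
      then show "psi (v k) u = psi 0 u" using n v[of k u] by auto
    qed
    define b where "b = Abs_fls (\<lambda>j. v (- 1 - j))"
    have b: "b $$ j = v (- 1 - j)" for j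
      unfolding b_def by (rule nth_Abs_fls_lower_bound[of "- n"]) (use v0 in auto)
    have bn: "b \<in> kball 0 (- n)" using v0 by (auto simp: kball_def b)
    have "char_eval \<xi> x = pair b x" for x
    proof -
      have split: "x = fls_trunc n x + (x - fls_trunc n x)" by simp
      have tail: "x - fls_trunc n x \<in> kball 0 n" by (auto simp: kball_def)
      have "char_eval \<xi> x = char_eval \<xi> (fls_trunc n x)"
        by (subst split) (simp only: char_eval_add n[OF tail] mult_1_right)
      also have "\<dots> = (\<Prod>k\<in>{fls_subdegree x..<n}. char_eval \<xi> (fmon k (x $$ k)))"
        unfolding fls_trunc_eq_sum by (rule hom_sum) (simp_all add: char_eval_add char_eval_0)
      also have "\<dots> = (\<Prod>k\<in>{fls_subdegree x..<n}. pair b (fmon k (x $$ k)))"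
        unfolding v pair_monom by (simp add: b)
      also have "\<dots> = pair b (fls_trunc n x)"
        unfolding fls_trunc_eq_sum by (rule hom_sum[symmetric]) (simp_all add: pair_add_right)
      also have "\<dots> = pair b x"
        by (subst (2) split) (use pair_kball_eq_1[OF bn] tail in \<open>simp only: pair_add_right minus_minus mult_1_right\<close>)
      finally show ?thesis .
    qed
    then show ?thesis by (intro exI[of _ b] character_eqI) simp
  qed
  then show ?thesis by auto
qed

definition Theta_inv :: "'a fls character \<Rightarrow> 'a fls" where
  "Theta_inv = inv Theta"

lemma Theta_inv_Theta [simp]: "Theta_inv (Theta b) = b"
  unfolding Theta_inv_def by (rule inv_f_f[OF inj_Theta])

lemma Theta_Theta_inv [simp]: "Theta (Theta_inv \<xi>) = \<xi>"
  unfolding Theta_inv_def by (rule surj_f_inv_f[OF surj_Theta])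

lemma Theta_inv_mult: "Theta_inv (\<xi> * \<zeta>) = Theta_inv \<xi> + Theta_inv \<zeta>"
  by (metis Theta_Theta_inv Theta_add Theta_inv_Theta)

lemma annihilator_Ksub: "Theta b \<in> annihilator (Ksub n) \<longleftrightarrow> b \<in> kball 0 (- n)"
  unfolding annihilator_def Ksub_eq_kball using pair_trivial_on_kball_iff[of n b] by simp

lemma rademacher_eq_Theta: "rademacher p s coord k u = Theta (fmon (- 1 - k) u)"
proof (rule character_eqI)
  fix x
  have "pair (fmon (- 1 - k) u) x = psi u (x $$ k)"
    using pair_monom[of x "- 1 - k" u] by (simp add: pair_commute psi_commute)
  then show "char_eval (rademacher p s coord k u) x = char_eval (Theta (fmon (- 1 - k) u)) x"
    by (simp add: char_eval_rademacher[OF coords] psi_def)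
qed

lemma char_dilation_Theta: "char_dilation n (Theta b) = Theta (fls_shift n b)"
  by (rule character_eqI) (simp add: char_dilation.rep_eq pair_shift)

lemma compact_subset_kball:
  assumes "compact (C :: 'a fls set)"
  shows "\<exists>m. C \<subseteq> kball 0 m"
proof -
  have "C \<subseteq> (\<Union>i\<in>UNIV. kball 0 (- int i))" using UN_kball_UNIV by auto
  then obtain I where I: "finite I" "C \<subseteq> (\<Union>i\<in>I. kball 0 (- int i))"
    by (rule compactE_image[OF assms open_kball])
  have "kball 0 (- int i) \<subseteq> kball (0 :: 'a fls) (- int (Max I))" if "i \<in> I" for i
    using I(1) that by (intro kball_mono) auto
  then show ?thesis using I(2) by blast
qed

lemma Theta_measurable [measurable]: "Theta \<in> borel \<rightarrow>\<^sub>M borel"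
proof (rule borel_measurableI)
  fix S :: "'a fls character set" assume "open S"
  then have "generate_topology {{\<xi>. char_eval \<xi> ` C \<subseteq> U} | C U. compact C \<and> open U} S"
    by (simp add: open_character_def)
  then have "open (Theta -` S)"
  proof (induction rule: generate_topology.induct)
    case (UN K)
    then have "open (\<Union>k\<in>K. Theta -` k)" by auto
    then show ?case by (simp add: vimage_Union)
  next
    case (Basis S)
    then obtain C U where S: "S = {\<xi>. char_eval \<xi> ` C \<subseteq> U}" "compact C" by auto
    obtain m where m: "C \<subseteq> kball 0 m" using compact_subset_kball[OF S(2)] by blast
    \<comment> \<open>Elements that differ by a member of \<open>Ksub (- m)\<close> define the same
      character on \<open>Ksub m\<close>, hence on \<open>C\<close>; so the preimage is a union of
      balls.\<close>
    have "Theta -` S = (\<Union>b\<in>Theta -` S. kball b (- m))"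
    proof (intro equalityI subsetI)
      fix c assume "c \<in> (\<Union>b\<in>Theta -` S. kball b (- m))"
      then obtain b where b: "Theta b \<in> S" "c - b \<in> kball 0 (- m)" using kball_iff_diff by blast
      have "pair c x = pair b x" if "x \<in> C" for x
      proof -
        have "pair (c - b) x = 1" using pair_kball_eq_1[OF b(2)] m that by auto
        then show ?thesis using pair_add_left[of "c - b" b x] by simp
      qed
      then have "pair c ` C = pair b ` C" by (rule image_cong[OF refl])
      then show "c \<in> Theta -` S" using b(1) by (simp add: S(1))
    next
      fix c assume "c \<in> Theta -` S"
      then show "c \<in> (\<Union>b\<in>Theta -` S. kball b (- m))" by (intro UN_I[of c]) auto
    qed
    then show ?case by (metis open_UN open_kball)
  qed auto
  then show "Theta -` S \<inter> space borel \<in> sets borel" by auto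
qed

lemma char_eval_measurable: "(\<lambda>\<xi>. char_eval \<xi> x) \<in> borel_measurable (borel :: 'a fls character measure)"
proof (rule borel_measurableI)
  fix U :: "complex set" assume "open U"
  then have "open {\<xi> :: 'a fls character. char_eval \<xi> ` {x} \<subseteq> U}"
    unfolding open_character_def
    by (intro generate_topology.Basis CollectI exI[of _ "{x}"] exI[of _ U]) simp
  then have "{\<xi> :: 'a fls character. char_eval \<xi> ` {x} \<subseteq> U} \<in> sets borel" by (rule borel_open)
  also have "{\<xi>. char_eval \<xi> ` {x} \<subseteq> U} = (\<lambda>\<xi>. char_eval \<xi> x) -` U \<inter> space borel" by auto
  finally show "(\<lambda>\<xi>. char_eval \<xi> x) -` U \<inter> space borel \<in> sets (borel :: 'a fls character measure)" .
qed

text \<open>The preimage of a ball is a countable intersection of conditions on the values at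
  monomials, and evaluation at a point is measurable because points are compact.\<close>

lemma Theta_inv_measurable [measurable]: "Theta_inv \<in> borel \<rightarrow>\<^sub>M borel"
proof -
  have "Theta_inv \<in> measurable borel (sigma UNIV (range (case_prod kball)))"
  proof (rule measurable_measure_of)
    fix A :: "'a fls set" assume "A \<in> range (case_prod kball)"
    then obtain a n where A: "A = kball a n" by auto
    have eq: "Theta_inv -` A = (\<Inter>j\<in>{..<n}. \<Inter>u\<in>UNIV.
        {\<xi>. char_eval \<xi> (fmon (- 1 - j) u) = psi (a $$ j) u})"
    proof (intro equalityI subsetI INT_I CollectI)
      fix \<xi> j u assume "\<xi> \<in> Theta_inv -` A" "j \<in> {..<n}"
      then have "Theta_inv \<xi> $$ j = a $$ j" by (simp add: A kball_def)
      then show "char_eval \<xi> (fmon (- 1 - j) u) = psi (a $$ j) u"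
        using pair_monom[of "Theta_inv \<xi>" "- 1 - j" u] char_eval_Theta[of "Theta_inv \<xi>"] by simp
    next
      fix \<xi> assume *: "\<xi> \<in> (\<Inter>j\<in>{..<n}. \<Inter>u\<in>UNIV.
        {\<xi>. char_eval \<xi> (fmon (- 1 - j) u) = psi (a $$ j) u})"
      have "Theta_inv \<xi> $$ j = a $$ j" if "j < n" for j
      proof (rule psi_nondegenerate)
        fix u :: 'a
        have "char_eval \<xi> (fmon (- 1 - j) u) = psi (a $$ j) u"
          using * that by blast
        then show "psi (Theta_inv \<xi> $$ j) u = psi (a $$ j) u"
          using pair_monom[of "Theta_inv \<xi>" "- 1 - j" u] char_eval_Theta[of "Theta_inv \<xi>"] by simp
      qed
      then show "\<xi> \<in> Theta_inv -` A" by (simp add: A kball_def)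
    qed
    have meas: "{\<xi> :: 'a fls character. char_eval \<xi> x = z} \<in> sets borel" for x z
    proof -
      have "(\<lambda>\<xi>. char_eval \<xi> x) -` {z} \<inter> space borel \<in> sets (borel :: 'a fls character measure)"
        by (rule measurable_sets[OF char_eval_measurable]) simp
      also have "(\<lambda>\<xi>. char_eval \<xi> x) -` {z} \<inter> space borel = {\<xi> :: 'a fls character. char_eval \<xi> x = z}"
        by auto
      finally show ?thesis .
    qed
    show "Theta_inv -` A \<inter> space borel \<in> sets borel"
      unfolding space_borel Int_UNIV_right eq
      by (intro sets.countable_INT'' meas) (simp_all add: countable_finite)
  qed auto
  also have "measurable borel (sigma UNIV (range (case_prod kball))) = measurable borel (borel :: 'a fls measure)"
    by (rule measurable_cong_sets) (simp_all add: borel_fls_eq)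
  finally show ?thesis .
qed

text \<open>Carried back to K, the measure \<nu> is translation invariant and gives
  \<open>Ksub 0\<close> measure 1, so its values on balls are those of \<mu>.\<close>

lemma distr_Theta:
  assumes "is_haar_X \<nu>"
  shows "distr \<mu> borel Theta = \<nu>"
proof -
  have sets_nu [measurable_cong, simp]: "sets \<nu> = sets borel" using assms by (simp add: is_haar_X_def)
  have space_nu: "space \<nu> = UNIV" using sets_eq_imp_space_eq[OF sets_nu] by simp
  have [measurable]: "Theta_inv \<in> \<nu> \<rightarrow>\<^sub>M borel"
    using Theta_inv_measurable by (simp add: measurable_cong_sets[OF sets_nu refl])
  have mult [measurable]: "(\<lambda>\<xi>. \<psi> * \<xi>) \<in> \<nu> \<rightarrow>\<^sub>M borel" for \<psi>
  proof -
    have "(\<lambda>\<xi>. \<psi> * \<xi>) = (\<lambda>\<xi>. Theta (Theta_inv \<psi> + Theta_inv \<xi>))"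
      by (simp add: Theta_add)
    then show ?thesis by simp
  qed
  define N where "N = distr \<nu> borel Theta_inv"
  have "distr N borel (\<lambda>x. a + x) = N" for a
  proof -
    have "distr N borel (\<lambda>x. a + x) = distr \<nu> borel (\<lambda>\<xi>. Theta_inv (Theta a * \<xi>))"
      unfolding N_def by (subst distr_distr) (auto simp: Theta_inv_mult comp_def)
    also have "\<dots> = distr (distr \<nu> borel (\<lambda>\<xi>. Theta a * \<xi>)) borel Theta_inv"
      by (subst distr_distr) (auto simp: comp_def)
    also have "\<dots> = N" using assms by (simp add: is_haar_X_def N_def)
    finally show ?thesis .
  qed
  moreover have "emeasure N (Ksub 0) = 1"
  proof -
    have "emeasure N (Ksub 0) = emeasure \<nu> (Theta_inv -` Ksub 0 \<inter> space \<nu>)"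
      unfolding N_def by (rule emeasure_distr) (auto simp: Ksub_eq_kball)
    also have "Theta_inv -` Ksub 0 \<inter> space \<nu> = annihilator (Ksub 0)"
    proof -
      have "Theta_inv \<xi> \<in> kball 0 0 \<longleftrightarrow> \<xi> \<in> annihilator (Ksub 0)" for \<xi>
        using annihilator_Ksub[of "Theta_inv \<xi>" 0] by simp
      then show ?thesis by (auto simp: space_nu Ksub_eq_kball)
    qed
    finally show ?thesis using assms by (simp add: is_haar_X_def)
  qed
  ultimately interpret N: haar_K N
    by unfold_locales (simp add: is_haar_K_def N_def)
  have "N = \<mu>"
    by (rule kball_measure_eqI) (auto simp: emeasure_kball N.emeasure_kball q_def N.q_def)
  moreover have "distr N borel Theta = distr \<nu> borel (Theta \<circ> Theta_inv)"
    unfolding N_def by (rule distr_distr) auto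
  ultimately have "distr \<mu> borel Theta = distr \<nu> borel (\<lambda>\<xi>. Theta (Theta_inv \<xi>))"
    by (simp add: comp_def)
  also have "\<dots> = \<nu>" by (simp add: distr_id2)
  finally show ?thesis .
qed

end

section \<open>The Fourier transform\<close>

lemma L2_tendsto_map:
  assumes "L2_tendsto M f g F"
    and T: "\<And>h. h \<in> L2 M \<Longrightarrow> T h \<in> L2 M'" "\<And>h. h \<in> L2 M \<Longrightarrow> L2_norm M' (T h) = C * L2_norm M h"
    and diff: "\<And>h h'. T (\<lambda>x. h x - h' x) = (\<lambda>x. T h x - T h' x)"
  shows "L2_tendsto M' (\<lambda>i. T (f i)) (T g) F"
  unfolding L2_tendsto_def
proof (intro conjI)
  have lim: "((\<lambda>i. L2_norm M (\<lambda>x. f i x - g x)) \<longlongrightarrow> 0) F" and g: "g \<in> L2 M"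
    and ev: "eventually (\<lambda>i. f i \<in> L2 M) F"
    using assms(1) by (auto simp: L2_tendsto_def)
  show "T g \<in> L2 M'" using g T by blast
  show "\<forall>\<^sub>F i in F. T (f i) \<in> L2 M'" using ev by eventually_elim (rule T)
  have "((\<lambda>i. C * L2_norm M (\<lambda>x. f i x - g x)) \<longlongrightarrow> 0) F"
    using lim by (rule tendsto_mult_right_zero)
  then show "((\<lambda>i. L2_norm M' (\<lambda>x. T (f i) x - T g x)) \<longlongrightarrow> 0) F"
  proof (rule Lim_transform_eventually)
    show "\<forall>\<^sub>F i in F. C * L2_norm M (\<lambda>x. f i x - g x) = L2_norm M' (\<lambda>x. T (f i) x - T g x)"
      using ev by eventually_elim (use g T(2) diff L2_diff in metis)
  qed
qed

lemma L2_norm_power2_complex: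
  assumes "f \<in> L2 M"
  shows "(\<integral>x. f x * cnj (f x) \<partial>M) = complex_of_real ((L2_norm M f)\<^sup>2)"
proof -
  have "(\<integral>x. f x * cnj (f x) \<partial>M) = (\<integral>x. complex_of_real ((cmod (f x))\<^sup>2) \<partial>M)"
    by (simp only: complex_norm_square)
  also have "\<dots> = complex_of_real (\<integral>x. (cmod (f x))\<^sup>2 \<partial>M)"
    by (rule integral_complex_of_real)
  finally show ?thesis by (simp add: L2_norm_power2)
qed

context local_field
begin

definition ft :: "('a fls \<Rightarrow> complex) \<Rightarrow> 'a fls \<Rightarrow> complex" where
  "ft f b = (\<integral>x. f x * cnj (pair b x) \<partial>\<mu>)"

lemma fourier_Theta: "fourier \<mu> f (Theta b) = ft f b"
  by (simp add: fourier_def ft_def)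

lemma ft_integrable:
  assumes "integrable \<mu> f"
  shows "integrable \<mu> (\<lambda>x. f x * cnj (pair b x))"
proof (rule Bochner_Integration.integrable_bound[OF assms])
  show "(\<lambda>x. f x * cnj (pair b x)) \<in> borel_measurable \<mu>"
    using borel_measurable_integrable[OF assms] by simp
  show "AE x in \<mu>. cmod (f x * cnj (pair b x)) \<le> cmod (f x)"
    by (simp add: norm_mult)
qed

lemma ft_add: "integrable \<mu> f \<Longrightarrow> integrable \<mu> g \<Longrightarrow> ft (\<lambda>x. f x + g x) b = ft f b + ft g b"
  by (simp add: ft_def distrib_right ft_integrable)

lemma ft_scale: "ft (\<lambda>x. c * f x) b = c * ft f b"
  by (simp add: ft_def mult.assoc)

lemma ft_sum: "(\<And>i. i \<in> I \<Longrightarrow> integrable \<mu> (f i)) \<Longrightarrow> ft (\<lambda>x. \<Sum>i\<in>I. f i x) b = (\<Sum>i\<in>I. ft (f i) b)"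
  by (simp add: ft_def sum_distrib_right ft_integrable)

lemma ft_cnj: "ft (\<lambda>x. cnj (f x)) b = cnj (ft f (- b))"
  by (simp add: ft_def pair_uminus_left flip: Bochner_Integration.integral_cnj)

lemma minus_measurable [measurable]: "(\<lambda>x. x - a) \<in> borel \<rightarrow>\<^sub>M (borel :: 'a fls measure)"
  using plus_measurable[of "- a"] by simp

lemma ft_translate:
  assumes "f \<in> borel_measurable borel"
  shows "ft (\<lambda>x. f (x - a)) b = cnj (pair b a) * ft f b"
proof -
  have "ft (\<lambda>x. f (x - a)) b = (\<integral>x. f (a + x - a) * cnj (pair b (a + x)) \<partial>\<mu>)"
    unfolding ft_def
    by (intro integral_translate[symmetric] borel_measurable_times borel_measurable_cnj pair_measurable
        measurable_compose[OF minus_measurable assms])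
  also have "\<dots> = (\<integral>x. cnj (pair b a) * (f x * cnj (pair b x)) \<partial>\<mu>)"
    by (simp add: pair_add_right mult_ac)
  finally show ?thesis by (simp add: ft_def)
qed

lemma ft_shift:
  assumes "f \<in> borel_measurable borel"
  shows "ft (\<lambda>x. f (fls_shift n x)) b = q powi (- n) * ft f (fls_shift (- n) b)"
proof -
  have "pair b x = pair (fls_shift (- n) b) (fls_shift n x)" for x
    using pair_shift[of n "fls_shift (- n) b" x] by simp
  then have "ft (\<lambda>x. f (fls_shift n x)) b =
      (\<integral>x. f (fls_shift n x) * cnj (pair (fls_shift (- n) b) (fls_shift n x)) \<partial>\<mu>)"
    by (simp add: ft_def)
  also have "\<dots> = q powi (- n) *\<^sub>R ft f (fls_shift (- n) b)"
    unfolding ft_def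
    by (intro integral_shift[where f = "\<lambda>x. f x * cnj (pair (fls_shift (- n) b) x)"]
        borel_measurable_times borel_measurable_cnj pair_measurable assms)
  finally show ?thesis by (simp add: scaleR_conv_of_real)
qed

text \<open>Fubini for the kernel \<open>pair\<close>, whose symmetry makes the inner integral over
  the frequency a transform again.\<close>

theorem ft_mult_formula:
  assumes f: "integrable \<mu> f" and g: "integrable \<mu> g"
  shows "(\<integral>b. ft f b * g b \<partial>\<mu>) = (\<integral>x. f x * ft g x \<partial>\<mu>)"
proof -
  interpret P: pair_sigma_finite \<mu> \<mu> ..
  have [measurable]: "f \<in> borel_measurable borel" "g \<in> borel_measurable borel"
    using borel_measurable_integrable[OF f] borel_measurable_integrable[OF g] by simp_all
  let ?h = "\<lambda>b x. f x * cnj (pair b x) * g b"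
  have meas: "case_prod ?h \<in> borel_measurable (\<mu> \<Otimes>\<^sub>M \<mu>)"
  proof -
    have "(\<lambda>z. f (snd z) * cnj (pair (fst z) (snd z)) * g (fst z)) \<in> borel_measurable (borel \<Otimes>\<^sub>M borel)"
      by measurable
    then show ?thesis
      by (simp add: case_prod_beta' measurable_cong_sets[OF sets_pair_measure_cong[OF sets_mu sets_mu] refl])
  qed
  have int: "integrable (\<mu> \<Otimes>\<^sub>M \<mu>) (case_prod ?h)"
  proof (rule P.Fubini_integrable[OF meas])
    show "integrable \<mu> (\<lambda>b. \<integral>x. norm (case_prod ?h (b, x)) \<partial>\<mu>)"
      using g by (simp add: norm_mult)
    show "AE b in \<mu>. integrable \<mu> (\<lambda>x. case_prod ?h (b, x))"
      using f by (simp add: ft_integrable)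
  qed
  have "(\<integral>b. ft f b * g b \<partial>\<mu>) = (\<integral>b. (\<integral>x. ?h b x \<partial>\<mu>) \<partial>\<mu>)"
    by (simp add: ft_def)
  also have "\<dots> = (\<integral>x. (\<integral>b. ?h b x \<partial>\<mu>) \<partial>\<mu>)"
    using P.Fubini_integral[OF int] by simp
  also have "\<dots> = (\<integral>x. f x * ft g x \<partial>\<mu>)"
    by (simp add: ft_def pair_commute mult_ac flip: integral_mult_right_zero)
  finally show ?thesis .
qed

section \<open>Test functions: characters restricted to balls\<close>

definition modulated :: "'a fls \<Rightarrow> 'a fls \<Rightarrow> int \<Rightarrow> 'a fls \<Rightarrow> complex" where
  "modulated a c n x = pair c x * indicator (kball a n) x"

lemma modulated_borel [measurable]: "modulated a c n \<in> borel_measurable borel"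
  unfolding modulated_def by measurable

lemma modulated_integrable: "integrable \<mu> (modulated a c n)"
proof (rule Bochner_Integration.integrable_bound)
  show "integrable \<mu> (indicator (kball a n) :: _ \<Rightarrow> real)" by simp
  show "AE x in \<mu>. norm (modulated a c n x) \<le> norm (indicator (kball a n) x :: real)"
    by (intro AE_I2) (simp add: modulated_def norm_mult split: split_indicator)
qed simp

lemma modulated_L2: "modulated a c n \<in> L2 \<mu>"
proof (rule L2_bound[of "indicator (kball a n)" _ _ 1])
  show "indicator (kball a n) \<in> L2 \<mu>" using indicator_L2[of "kball a n"] by simp
  show "AE x in \<mu>. cmod (modulated a c n x) \<le> 1 * cmod (indicator (kball a n) x)"
    by (intro AE_I2) (simp add: modulated_def norm_mult split: split_indicator)
qed simp

text \<open>If \<open>c\<close> is nontrivial on the ball, translating by a point \<open>x0\<close>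
  of it with \<open>pair c x0\<close> different from 1 multiplies the integral by that value, so the
  integral is 0.\<close>

lemma integral_modulated_0:
  "(\<integral>x. modulated 0 c n x \<partial>\<mu>) = complex_of_real (q powi (- n)) * indicator (kball 0 (- n)) c"
proof (cases "c \<in> kball 0 (- n)")
  case True
  then have "modulated 0 c n = (\<lambda>x. complex_of_real (indicator (kball 0 n) x))"
    using pair_kball_eq_1[OF True] by (auto simp: modulated_def indicator_def)
  then show ?thesis using True by simp
next
  case False
  then obtain x0 where x0: "x0 \<in> kball 0 n" "pair c x0 \<noteq> 1"
    using pair_trivial_on_kball_iff by blast
  have "modulated 0 c n (x0 + x) = pair c x0 * modulated 0 c n x" for x
  proof -
    have "x0 + x \<in> kball 0 n \<longleftrightarrow> x \<in> kball 0 n" using x0(1) by (auto simp: kball_def)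
    then show ?thesis by (simp add: modulated_def pair_add_right indicator_def)
  qed
  then have "(\<integral>x. modulated 0 c n x \<partial>\<mu>) = pair c x0 * (\<integral>x. modulated 0 c n x \<partial>\<mu>)"
    using integral_translate[of "modulated 0 c n" x0] by simp
  then show ?thesis using x0(2) False by simp
qed

text \<open>Moving the ball to 0 leaves the integral of the character of \<open>c - b\<close> over a
  subgroup. Centre and frequency change places and the radius is inverted, so up to scalars the
  family is closed under the transform.\<close>

lemma ft_modulated: "ft (modulated a c n) b = (q powi (- n) * pair c a) * modulated c (- a) (- n) b"
proof -
  have "ft (modulated a c n) b = (\<integral>x. modulated a (c - b) n x \<partial>\<mu>)"
    by (simp add: ft_def modulated_def pair_diff_left mult_ac)
  also have "\<dots> = (\<integral>x. modulated a (c - b) n (a + x) \<partial>\<mu>)"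
    by (rule integral_translate[symmetric]) simp
  also have "\<dots> = (\<integral>x. pair (c - b) a * modulated 0 (c - b) n x \<partial>\<mu>)"
  proof -
    have "indicator (kball a n) (a + x) = (indicator (kball 0 n) x :: complex)" for x
      by (auto simp: indicator_def kball_def)
    then show ?thesis by (simp add: modulated_def pair_add_right mult_ac)
  qed
  also have "\<dots> = pair (c - b) a * (complex_of_real (q powi (- n)) * indicator (kball 0 (- n)) (c - b))"
    by (simp add: integral_modulated_0)
  also have "indicator (kball 0 (- n)) (c - b) = (indicator (kball c (- n)) b :: complex)"
    by (auto simp: indicator_def kball_def)
  finally show ?thesis
    by (simp add: modulated_def[of c] pair_diff_left pair_uminus_left pair_commute[of b a] mult_ac)
qed

definition modulateds :: "('a fls \<Rightarrow> complex) set" where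
  "modulateds = range (\<lambda>(a, c, n). modulated a c n)"

definition test_functions :: "('a fls \<Rightarrow> complex) set" where
  "test_functions = L2_span modulateds"

lemma modulated_test: "modulated a c n \<in> test_functions"
  unfolding test_functions_def modulateds_def by (intro L2_span_base) (auto intro: image_eqI[of _ _ "(a, c, n)"])

lemma test_functionsE:
  assumes "t \<in> test_functions"
  obtains I and d :: "('a fls \<Rightarrow> complex) \<Rightarrow> complex" where "finite I" "I \<subseteq> modulateds" "t = (\<lambda>x. \<Sum>f\<in>I. d f * f x)"
  using assms unfolding test_functions_def by (rule L2_spanE)

lemma test_functions_induct [consumes 1, case_names modulated add scale]:
  assumes "t \<in> test_functions"
    and mod: "\<And>a c n. P (modulated a c n)"
    and add: "\<And>f g. f \<in> test_functions \<Longrightarrow> g \<in> test_functions \<Longrightarrow> P f \<Longrightarrow> P g \<Longrightarrow> P (\<lambda>x. f x + g x)"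
    and scale: "\<And>f d. f \<in> test_functions \<Longrightarrow> P f \<Longrightarrow> P (\<lambda>x. d * f x)"
  shows "P t"
proof -
  obtain I d where I: "finite I" "I \<subseteq> modulateds" "t = (\<lambda>x. \<Sum>f\<in>I. d f * f x)"
    using assms(1) by (rule test_functionsE)
  have "(\<lambda>x. \<Sum>f\<in>I. d f * f x) \<in> test_functions \<and> P (\<lambda>x. \<Sum>f\<in>I. d f * f x)"
    using I(1,2)
  proof (induction I rule: finite_induct)
    case empty
    \<comment> \<open>The zero function enters as a multiple of some modulated indicator, because
      the induction has no clause of its own for it.\<close>
    have "(\<lambda>x. 0 * modulated 0 0 0 x) \<in> test_functions \<and> P (\<lambda>x. 0 * modulated 0 0 0 x)"
      using modulated_test mod scale L2_span_scale unfolding test_functions_def by blast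
    then show ?case by simp
  next
    case (insert f I)
    then obtain a c n where f: "f = modulated a c n" by (auto simp: modulateds_def)
    have "(\<lambda>x. d f * f x) \<in> test_functions" "P (\<lambda>x. d f * f x)"
      using modulated_test mod scale L2_span_scale unfolding test_functions_def f by blast+
    then show ?case
      using insert add L2_span_add[of "\<lambda>x. d f * f x" modulateds "\<lambda>x. \<Sum>f\<in>I. d f * f x"]
      unfolding test_functions_def by auto
  qed
  then show ?thesis using I(3) by simp
qed

lemma test_add: "f \<in> test_functions \<Longrightarrow> g \<in> test_functions \<Longrightarrow> (\<lambda>x. f x + g x) \<in> test_functions"
  and test_scale: "f \<in> test_functions \<Longrightarrow> (\<lambda>x. d * f x) \<in> test_functions"
  unfolding test_functions_def by (rule L2_span_add L2_span_scale; assumption)+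

lemma test_integrable: "t \<in> test_functions \<Longrightarrow> integrable \<mu> t"
  by (induction rule: test_functions_induct) (auto intro: modulated_integrable)

lemma test_L2: "t \<in> test_functions \<Longrightarrow> t \<in> L2 \<mu>"
  by (induction rule: test_functions_induct) (auto intro: modulated_L2 L2_add L2_scale)

lemma ft_test: "t \<in> test_functions \<Longrightarrow> ft t \<in> test_functions"
proof (induction rule: test_functions_induct)
  case (modulated a c n)
  have "ft (modulated a c n) = (\<lambda>b. (q powi (- n) * pair c a) * modulated c (- a) (- n) b)"
    by (rule ext) (rule ft_modulated)
  then show ?case using test_scale[OF modulated_test] by simp
next
  case (add f g)
  then have "ft (\<lambda>x. f x + g x) = (\<lambda>b. ft f b + ft g b)" by (intro ext ft_add test_integrable)
  then show ?case using add test_add by simp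
next
  case (scale f d)
  have "ft (\<lambda>x. d * f x) = (\<lambda>b. d * ft f b)" by (intro ext ft_scale)
  then show ?case using scale test_scale by simp
qed

text \<open>Exchanging centre and frequency twice negates both, which the reflection at
  \<open>- x\<close> undoes; the powers of q cancel.\<close>

lemma ft_ft_test: "t \<in> test_functions \<Longrightarrow> ft (ft t) (- x) = t x"
proof (induction arbitrary: x rule: test_functions_induct)
  case (modulated a c n)
  have "ft (modulated a c n) = (\<lambda>b. (q powi (- n) * pair c a) * modulated c (- a) (- n) b)"
    by (rule ext) (rule ft_modulated)
  then have "ft (ft (modulated a c n)) (- x) =
      (q powi (- n) * pair c a) * ((q powi n * pair (- a) c) * modulated (- a) (- c) n (- x))"
    by (simp add: ft_scale ft_modulated)
  also have "\<dots> = (q powi (- n) * q powi n) * (pair c a * cnj (pair a c)) * modulated (- a) (- c) n (- x)"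
    by (simp add: pair_uminus_left mult_ac)
  also have "q powi (- n) * q powi n = 1"
    using q_pos by (simp flip: power_int_add)
  also have "pair c a * cnj (pair a c) = 1" by (simp add: pair_commute[of c a])
  also have "modulated (- a) (- c) n (- x) = modulated a c n x"
    by (auto simp: modulated_def pair_uminus_left pair_uminus_right indicator_def kball_def)
  finally show ?case by simp
next
  case (add f g)
  have "ft (\<lambda>x. f x + g x) = (\<lambda>b. ft f b + ft g b)"
    using add by (intro ext ft_add test_integrable)
  then show ?case using add by (simp add: ft_add test_integrable ft_test)
next
  case (scale f d)
  have "ft (\<lambda>x. d * f x) = (\<lambda>b. d * ft f b)" by (intro ext ft_scale)
  then show ?case using scale by (simp add: ft_scale)
qed

lemma test_surj: "t \<in> test_functions \<Longrightarrow> \<exists>u\<in>test_functions. ft u = t"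
proof (induction rule: test_functions_induct)
  case (modulated a c n)
  let ?d = "q powi n * pair a (- c)"
  have "ft (\<lambda>x. (1 / ?d) * modulated (- c) a (- n) x) = modulated a c n"
  proof
    fix b
    have "ft (\<lambda>x. (1 / ?d) * modulated (- c) a (- n) x) b = (1 / ?d) * (?d * modulated a c n b)"
      by (simp only: ft_scale ft_modulated minus_minus)
    also have "\<dots> = modulated a c n b" using q_pos by simp
    finally show "ft (\<lambda>x. (1 / ?d) * modulated (- c) a (- n) x) b = modulated a c n b" .
  qed
  then show ?case using test_scale[OF modulated_test] by blast
next
  case (add f g)
  then obtain u v where uv: "u \<in> test_functions" "v \<in> test_functions" "ft u = f" "ft v = g" by blast
  then have "ft (\<lambda>x. u x + v x) = (\<lambda>x. f x + g x)"
    by (intro ext) (simp add: ft_add test_integrable)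
  then show ?case using test_add[OF uv(1,2)] by blast
next
  case (scale f d)
  then obtain u where u: "u \<in> test_functions" "ft u = f" by blast
  then have "ft (\<lambda>x. d * u x) = (\<lambda>x. d * f x)" by (intro ext) (simp add: ft_scale)
  then show ?case using test_scale[OF u(1)] by blast
qed

text \<open>The multiplication formula is used with the conjugate of \<open>ft t\<close> as second
  function. Its transform at x is the conjugate of \<open>ft (ft t) (- x)\<close>, which inversion
  identifies with the conjugate of \<open>t x\<close>.\<close>

lemma test_Parseval:
  assumes t: "t \<in> test_functions"
  shows "L2_norm \<mu> (ft t) = L2_norm \<mu> t"
proof -
  have int: "integrable \<mu> (\<lambda>b. cnj (ft t b))"
    using test_integrable[OF ft_test[OF t]] by simp
  have "complex_of_real ((L2_norm \<mu> (ft t))\<^sup>2) = (\<integral>b. ft t b * cnj (ft t b) \<partial>\<mu>)"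
    by (rule L2_norm_power2_complex[symmetric]) (rule test_L2[OF ft_test[OF t]])
  also have "\<dots> = (\<integral>x. t x * ft (\<lambda>b. cnj (ft t b)) x \<partial>\<mu>)"
    by (rule ft_mult_formula[OF test_integrable[OF t] int])
  also have "\<dots> = (\<integral>x. t x * cnj (t x) \<partial>\<mu>)"
    by (simp add: ft_cnj ft_ft_test[OF t])
  also have "\<dots> = complex_of_real ((L2_norm \<mu> t)\<^sup>2)"
    by (rule L2_norm_power2_complex) (rule test_L2[OF t])
  finally have "(L2_norm \<mu> (ft t))\<^sup>2 = (L2_norm \<mu> t)\<^sup>2" by (simp only: of_real_eq_iff)
  then show ?thesis by simp
qed

lemma test_dense: "L2_closure \<mu> test_functions = L2 \<mu>"
proof
  have "kball_indicators \<subseteq> modulateds"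
  proof
    fix f assume "f \<in> kball_indicators"
    then obtain a n where "f = (\<lambda>x. indicator (kball a n) x)" by (auto simp: kball_indicators_def)
    then have "f = modulated a 0 n" by (auto simp: modulated_def)
    then show "f \<in> modulateds" by (auto simp: modulateds_def intro: image_eqI[of _ _ "(a, 0, n)"])
  qed
  then have "L2_span kball_indicators \<subseteq> test_functions"
    unfolding test_functions_def L2_span_def by blast
  then show "L2 \<mu> \<subseteq> L2_closure \<mu> test_functions"
    using kball_indicators_dense L2_closure_mono unfolding L2_closed_span_eq by blast
qed (rule L2_closure_subset_L2)

section \<open>The transform on L2 and Plancherel's theorem\<close>

definition has_ft :: "('a fls \<Rightarrow> complex) \<Rightarrow> ('a fls \<Rightarrow> complex) \<Rightarrow> bool" where
  "has_ft f F \<longleftrightarrow>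
     (\<exists>g :: nat \<Rightarrow> 'a fls \<Rightarrow> complex. (\<forall>n. integrable \<mu> (g n) \<and> g n \<in> L2 \<mu>) \<and>
        L2_tendsto \<mu> g f sequentially \<and> L2_tendsto \<mu> (\<lambda>n. ft (g n)) F sequentially)"

lemma has_ft_L2: "has_ft f F \<Longrightarrow> f \<in> L2 \<mu>" "has_ft f F \<Longrightarrow> F \<in> L2 \<mu>"
  by (auto simp: has_ft_def L2_tendsto_def)

lemma has_ft_test:
  assumes "t \<in> test_functions"
  shows "has_ft t (ft t)"
  unfolding has_ft_def using assms ft_test[OF assms]
  by (intro exI[of _ "\<lambda>_. t"]) (simp add: L2_tendsto_def test_L2 test_integrable)

lemma has_ft_add:
  assumes "has_ft f F" "has_ft f' F'"
  shows "has_ft (\<lambda>x. f x + f' x) (\<lambda>b. F b + F' b)"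
proof -
  obtain g where g: "\<And>n. integrable \<mu> (g n)" "\<And>n. g n \<in> L2 \<mu>"
    "L2_tendsto \<mu> g f sequentially" "L2_tendsto \<mu> (\<lambda>n. ft (g n)) F sequentially"
    using assms(1) unfolding has_ft_def by blast
  obtain g' where g': "\<And>n. integrable \<mu> (g' n)" "\<And>n. g' n \<in> L2 \<mu>"
    "L2_tendsto \<mu> g' f' sequentially" "L2_tendsto \<mu> (\<lambda>n. ft (g' n)) F' sequentially"
    using assms(2) unfolding has_ft_def by blast
  have "ft (\<lambda>x. g n x + g' n x) = (\<lambda>b. ft (g n) b + ft (g' n) b)" for n
    by (rule ext) (rule ft_add[OF g(1) g'(1)])
  then show ?thesis
    unfolding has_ft_def
    using g g' L2_add[OF g(2) g'(2)] L2_tendsto_add[OF g(3) g'(3)] L2_tendsto_add[OF g(4) g'(4)]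
    by (intro exI[of _ "\<lambda>n x. g n x + g' n x"]) simp
qed

lemma has_ft_scale:
  assumes "has_ft f F"
  shows "has_ft (\<lambda>x. c * f x) (\<lambda>b. c * F b)"
proof -
  obtain g where g: "\<And>n. integrable \<mu> (g n)" "\<And>n. g n \<in> L2 \<mu>"
    "L2_tendsto \<mu> g f sequentially" "L2_tendsto \<mu> (\<lambda>n. ft (g n)) F sequentially"
    using assms(1) unfolding has_ft_def by blast
  have "ft (\<lambda>x. c * g n x) = (\<lambda>b. c * ft (g n) b)" for n
    by (rule ext) (rule ft_scale)
  then show ?thesis
    unfolding has_ft_def
    using g L2_scale[OF g(2)] L2_tendsto_scale[OF g(3)] L2_tendsto_scale[OF g(4)]
    by (intro exI[of _ "\<lambda>n x. c * g n x"]) simp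
qed

lemma has_ft_diff:
  assumes "has_ft f F" "has_ft f' F'"
  shows "has_ft (\<lambda>x. f x - f' x) (\<lambda>b. F b - F' b)"
  using has_ft_add[OF assms(1) has_ft_scale[OF assms(2), of "- 1"]] by simp

lemma has_ft_zero: "has_ft (\<lambda>_. 0) (\<lambda>_. 0)"
  using has_ft_scale[OF has_ft_test[OF modulated_test[of 0 0 0]], of 0] by simp

lemma has_ft_sum:
  assumes "\<And>i. i \<in> I \<Longrightarrow> has_ft (f i) (F i)"
  shows "has_ft (\<lambda>x. \<Sum>i\<in>I. f i x) (\<lambda>b. \<Sum>i\<in>I. F i b)"
  using assms by (induction I rule: infinite_finite_induct) (auto intro: has_ft_add has_ft_zero)

lemma L2_mult_pair:
  assumes "f \<in> L2 \<mu>"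
  shows "(\<lambda>b. cnj (pair b a) * f b) \<in> L2 \<mu>" "L2_norm \<mu> (\<lambda>b. cnj (pair b a) * f b) = L2_norm \<mu> f"
proof -
  have [measurable]: "f \<in> borel_measurable borel" using L2_mu_borel[OF assms] .
  show "(\<lambda>b. cnj (pair b a) * f b) \<in> L2 \<mu>"
    by (rule L2_bound[OF assms, of _ 1]) (simp_all add: norm_mult)
  show "L2_norm \<mu> (\<lambda>b. cnj (pair b a) * f b) = L2_norm \<mu> f"
    by (simp add: L2_norm_def norm_mult)
qed

lemma has_ft_translate:
  assumes "has_ft f F"
  shows "has_ft (\<lambda>x. f (x - a)) (\<lambda>b. cnj (pair b a) * F b)"
proof -
  obtain g where g: "\<And>n. integrable \<mu> (g n)" "\<And>n. g n \<in> L2 \<mu>"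
    "L2_tendsto \<mu> g f sequentially" "L2_tendsto \<mu> (\<lambda>n. ft (g n)) F sequentially"
    using assms(1) unfolding has_ft_def by blast
  have "ft (\<lambda>x. g n (x - a)) = (\<lambda>b. cnj (pair b a) * ft (g n) b)" for n
    by (rule ext) (rule ft_translate[OF L2_mu_borel[OF g(2)]])
  moreover have "integrable \<mu> (\<lambda>x. g n (x - a))" for n
    using integrable_translate[OF g(1), of n "- a"] by simp
  moreover have "L2_tendsto \<mu> (\<lambda>n x. g n (x - a)) (\<lambda>x. f (x - a)) sequentially"
    using g(3) L2_translate_minus by (intro L2_tendsto_map[where T = "\<lambda>h x. h (x - a)" and C = 1]) auto
  moreover have "L2_tendsto \<mu> (\<lambda>n b. cnj (pair b a) * ft (g n) b) (\<lambda>b. cnj (pair b a) * F b) sequentially"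
    using g(4) L2_mult_pair
    by (intro L2_tendsto_map[where T = "\<lambda>h b. cnj (pair b a) * h b" and C = 1]) (auto simp: right_diff_distrib)
  ultimately show ?thesis
    unfolding has_ft_def using L2_translate_minus(1)[OF g(2)]
    by (intro exI[of _ "\<lambda>n x. g n (x - a)"]) simp
qed

lemma has_ft_shift:
  assumes "has_ft f F"
  shows "has_ft (\<lambda>x. f (fls_shift n x)) (\<lambda>b. complex_of_real (q powi (- n)) * F (fls_shift (- n) b))"
proof -
  obtain g where g: "\<And>n. integrable \<mu> (g n)" "\<And>n. g n \<in> L2 \<mu>"
    "L2_tendsto \<mu> g f sequentially" "L2_tendsto \<mu> (\<lambda>n. ft (g n)) F sequentially"
    using assms(1) unfolding has_ft_def by blast
  have "ft (\<lambda>x. g k (fls_shift n x)) = (\<lambda>b. complex_of_real (q powi (- n)) * ft (g k) (fls_shift (- n) b))" for k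
    by (rule ext) (rule ft_shift[OF L2_mu_borel[OF g(2)]])
  moreover have "integrable \<mu> (\<lambda>x. g k (fls_shift n x))" for k
    by (rule integrable_shift[OF g(1)])
  moreover have "L2_tendsto \<mu> (\<lambda>k x. g k (fls_shift n x)) (\<lambda>x. f (fls_shift n x)) sequentially"
    using g(3) L2_shift
    by (intro L2_tendsto_map[where T = "\<lambda>h x. h (fls_shift n x)" and C = "sqrt (q powi (- n))"]) auto
  moreover have "L2_tendsto \<mu> (\<lambda>k b. complex_of_real (q powi (- n)) * ft (g k) (fls_shift (- n) b))
      (\<lambda>b. complex_of_real (q powi (- n)) * F (fls_shift (- n) b)) sequentially"
    using g(4) L2_shift[where n = "- n"]
    by (intro L2_tendsto_scale L2_tendsto_map[where T = "\<lambda>h x. h (fls_shift (- n) x)" and C = "sqrt (q powi (- (- n)))"]) auto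
  ultimately show ?thesis
    unfolding has_ft_def using L2_shift(1)[OF g(2)]
    by (intro exI[of _ "\<lambda>k x. g k (fls_shift n x)"]) simp
qed

lemma has_ft_mult_formula:
  assumes "has_ft f F" "u \<in> test_functions"
  shows "(\<integral>b. F b * u b \<partial>\<mu>) = (\<integral>x. f x * ft u x \<partial>\<mu>)"
proof -
  obtain g where g: "\<And>n. integrable \<mu> (g n)" "\<And>n. g n \<in> L2 \<mu>"
    "L2_tendsto \<mu> g f sequentially" "L2_tendsto \<mu> (\<lambda>n. ft (g n)) F sequentially"
    using assms(1) unfolding has_ft_def by blast
  have "(\<lambda>n. \<integral>b. ft (g n) b * u b \<partial>\<mu>) \<longlonglongrightarrow> (\<integral>b. F b * u b \<partial>\<mu>)"
    by (rule L2_tendsto_integral[OF g(4) test_L2[OF assms(2)]])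
  moreover have "(\<lambda>n. \<integral>b. g n b * ft u b \<partial>\<mu>) \<longlonglongrightarrow> (\<integral>x. f x * ft u x \<partial>\<mu>)"
    by (rule L2_tendsto_integral[OF g(3) test_L2[OF ft_test[OF assms(2)]]])
  ultimately show ?thesis
    using ft_mult_formula[OF g(1) test_integrable[OF assms(2)]] LIMSEQ_unique by simp
qed

text \<open>Test functions converging to the conjugate of \<open>f\<close> turn the assumption into
  ||f||^2 <= C ||f||.\<close>

lemma L2_norm_le_by_duality:
  assumes f: "f \<in> L2 \<mu>" and "C \<ge> 0"
    and dual: "\<And>u. u \<in> test_functions \<Longrightarrow> cmod (\<integral>x. f x * u x \<partial>\<mu>) \<le> C * L2_norm \<mu> u"
  shows "L2_norm \<mu> f \<le> C"
proof -
  have "(\<lambda>x. cnj (f x)) \<in> L2_closure \<mu> test_functions" using L2_cnj[OF f] test_dense by simp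
  then obtain u where u: "\<And>n. u n \<in> test_functions" "L2_tendsto \<mu> u (\<lambda>x. cnj (f x)) sequentially"
    using L2_closure_sequence[of _ \<mu> test_functions] test_L2 by blast
  have "(\<lambda>n. cmod (\<integral>x. u n x * f x \<partial>\<mu>)) \<longlonglongrightarrow> cmod (\<integral>x. cnj (f x) * f x \<partial>\<mu>)"
    by (intro tendsto_norm L2_tendsto_integral[OF u(2) f])
  moreover have "(\<lambda>n. C * L2_norm \<mu> (u n)) \<longlonglongrightarrow> C * L2_norm \<mu> (\<lambda>x. cnj (f x))"
    by (intro tendsto_mult_left L2_tendsto_norm[OF u(2)])
  ultimately have "cmod (\<integral>x. cnj (f x) * f x \<partial>\<mu>) \<le> C * L2_norm \<mu> (\<lambda>x. cnj (f x))"
    using dual[OF u(1)] by (intro LIMSEQ_le) (auto simp: mult.commute)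
  then have "(L2_norm \<mu> f)\<^sup>2 \<le> C * L2_norm \<mu> f"
    using L2_norm_power2_complex[OF f] by (simp add: L2_norm_cnj mult.commute norm_power)
  then have "L2_norm \<mu> f * L2_norm \<mu> f \<le> C * L2_norm \<mu> f" by (simp add: power2_eq_square)
  then show ?thesis
    using \<open>C \<ge> 0\<close> L2_norm_nonneg[of \<mu> f] by (cases "L2_norm \<mu> f = 0") (auto simp: mult_le_cancel_right)
qed

text \<open>Two duality estimates. In the second one the test function is written as a transform by
  \<open>test_surj\<close>, so that the multiplication formula can be read backwards.\<close>

theorem Plancherel:
  assumes "has_ft f F"
  shows "L2_norm \<mu> F = L2_norm \<mu> f"
proof (rule antisym)
  note L2 = has_ft_L2[OF assms]
  show "L2_norm \<mu> F \<le> L2_norm \<mu> f"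
  proof (rule L2_norm_le_by_duality[OF L2(2)])
    fix u assume u: "u \<in> test_functions"
    have "cmod (\<integral>x. F x * u x \<partial>\<mu>) = cmod (\<integral>x. f x * ft u x \<partial>\<mu>)"
      using has_ft_mult_formula[OF assms u] by simp
    also have "\<dots> \<le> L2_norm \<mu> f * L2_norm \<mu> (ft u)"
      by (rule L2_Cauchy_Schwarz(2)[OF L2(1) test_L2[OF ft_test[OF u]]])
    finally show "cmod (\<integral>x. F x * u x \<partial>\<mu>) \<le> L2_norm \<mu> f * L2_norm \<mu> u"
      by (simp only: test_Parseval[OF u])
  qed simp
  show "L2_norm \<mu> f \<le> L2_norm \<mu> F"
  proof (rule L2_norm_le_by_duality[OF L2(1)])
    fix v assume "v \<in> test_functions"
    then obtain u where u: "u \<in> test_functions" "v = ft u" using test_surj by blast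
    have "cmod (\<integral>x. f x * v x \<partial>\<mu>) = cmod (\<integral>x. F x * u x \<partial>\<mu>)"
      using has_ft_mult_formula[OF assms u(1)] u(2) by simp
    also have "\<dots> \<le> L2_norm \<mu> F * L2_norm \<mu> u"
      by (rule L2_Cauchy_Schwarz(2)[OF L2(2) test_L2[OF u(1)]])
    finally show "cmod (\<integral>x. f x * v x \<partial>\<mu>) \<le> L2_norm \<mu> F * L2_norm \<mu> v"
      by (simp only: u(2) test_Parseval[OF u(1)])
  qed simp
qed

text \<open>Test functions approximating \<open>F\<close> are pulled back through
  \<open>test_surj\<close>. Plancherel for their differences makes the preimages a Cauchy sequence,
  and completeness supplies \<open>f\<close>.\<close>

theorem has_ft_exists:
  assumes "F \<in> L2 \<mu>"
  shows "\<exists>f. has_ft f F"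
proof -
  obtain u where u: "\<And>n. u n \<in> test_functions" "L2_tendsto \<mu> u F sequentially"
    using L2_closure_sequence[of F \<mu> test_functions] test_dense test_L2 assms by blast
  have "\<exists>t. \<forall>n. t n \<in> test_functions \<and> ft (t n) = u n"
    using test_surj[OF u(1)] by metis
  then obtain t where t: "\<And>n. t n \<in> test_functions" "\<And>n. ft (t n) = u n" by blast
  have diff: "L2_norm \<mu> (\<lambda>x. t m x - t n x) = L2_norm \<mu> (\<lambda>x. u m x - u n x)" for m n
  proof -
    have "has_ft (\<lambda>x. t m x - t n x) (\<lambda>x. u m x - u n x)"
      using has_ft_diff[OF has_ft_test[OF t(1)] has_ft_test[OF t(1)]] by (simp add: t(2))
    then show ?thesis by (simp add: Plancherel)
  qed
  have uL2: "u n \<in> L2 \<mu>" for n by (rule test_L2[OF u(1)])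
  have "\<exists>f. L2_tendsto \<mu> t f sequentially"
  proof (rule L2_complete)
    show "t n \<in> L2 \<mu>" for n by (rule test_L2[OF t(1)])
    fix e :: real assume "e > 0"
    moreover have "(\<lambda>n. L2_norm \<mu> (\<lambda>x. u n x - F x)) \<longlonglongrightarrow> 0"
      using u(2) by (simp add: L2_tendsto_def)
    ultimately have "eventually (\<lambda>n. L2_norm \<mu> (\<lambda>x. u n x - F x) < e / 2) sequentially"
      by (intro order_tendstoD(2)) auto
    then obtain N where N: "\<And>n. n \<ge> N \<Longrightarrow> L2_norm \<mu> (\<lambda>x. u n x - F x) < e / 2"
      by (auto simp: eventually_sequentially)
    have "L2_norm \<mu> (\<lambda>x. t m x - t n x) < e" if "m \<ge> N" "n \<ge> N" for m n
      using N[OF that(1)] N[OF that(2)] L2_norm_triangle_diff[OF uL2[of m] assms uL2[of n]]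
        L2_norm_minus_commute[of \<mu> F "u n"] unfolding diff by linarith
    then show "\<exists>N. \<forall>m\<ge>N. \<forall>n\<ge>N. L2_norm \<mu> (\<lambda>x. t m x - t n x) < e" by blast
  qed
  then obtain f where "L2_tendsto \<mu> t f sequentially" by blast
  then have "has_ft f F"
    unfolding has_ft_def using u(2) t test_L2 test_integrable by (intro exI[of _ t]) simp
  then show ?thesis by blast
qed

section \<open>Return from K to the character group\<close>

lemma borel_measurable_Theta_iff:
  "(\<lambda>b. G (Theta b)) \<in> borel_measurable borel \<longleftrightarrow> G \<in> borel_measurable (borel :: 'a fls character measure)"
proof
  assume "(\<lambda>b. G (Theta b)) \<in> borel_measurable borel"
  then have "(\<lambda>\<xi>. G (Theta (Theta_inv \<xi>))) \<in> borel_measurable borel"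
    by (rule measurable_compose[OF Theta_inv_measurable])
  then show "G \<in> borel_measurable borel" by simp
qed (rule measurable_compose[OF Theta_measurable])

lemma L2_nu_iff:
  assumes "is_haar_X \<nu>"
  shows "G \<in> L2 \<nu> \<longleftrightarrow> (\<lambda>b. G (Theta b)) \<in> L2 \<mu>"
proof (cases "G \<in> borel_measurable borel")
  case True
  have "integrable \<nu> (\<lambda>\<xi>. (cmod (G \<xi>))\<^sup>2) \<longleftrightarrow> integrable \<mu> (\<lambda>b. (cmod (G (Theta b)))\<^sup>2)"
    unfolding distr_Theta[OF assms, symmetric] using True
    by (intro integrable_distr_eq) simp_all
  then show ?thesis
    using assms True borel_measurable_Theta_iff[of G]
    by (simp add: L2_def is_haar_X_def cong: measurable_cong_sets)
next
  case False
  then show ?thesis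
    using assms borel_measurable_Theta_iff[of G]
    by (simp add: L2_def is_haar_X_def cong: measurable_cong_sets)
qed

lemma L2_norm_nu:
  assumes "is_haar_X \<nu>" "G \<in> L2 \<nu>"
  shows "L2_norm \<nu> G = L2_norm \<mu> (\<lambda>b. G (Theta b))"
proof -
  have [measurable]: "G \<in> borel_measurable borel"
    using L2_borel[OF assms(2)] assms(1) by (simp add: is_haar_X_def cong: measurable_cong_sets)
  have "(\<integral>\<xi>. (cmod (G \<xi>))\<^sup>2 \<partial>\<nu>) = (\<integral>b. (cmod (G (Theta b)))\<^sup>2 \<partial>\<mu>)"
    unfolding distr_Theta[OF assms(1), symmetric]
    by (intro integral_distr) simp_all
  then show ?thesis by (simp add: L2_norm_def)
qed

lemma L2_tendsto_nu_iff:
  assumes nu: "is_haar_X \<nu>"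
  shows "L2_tendsto \<nu> G H F \<longleftrightarrow> L2_tendsto \<mu> (\<lambda>i b. G i (Theta b)) (\<lambda>b. H (Theta b)) F"
proof -
  have "((\<lambda>i. L2_norm \<nu> (\<lambda>\<xi>. G i \<xi> - H \<xi>)) \<longlongrightarrow> 0) F \<longleftrightarrow>
      ((\<lambda>i. L2_norm \<mu> (\<lambda>b. G i (Theta b) - H (Theta b))) \<longlongrightarrow> 0) F"
    if H: "H \<in> L2 \<nu>" and G: "eventually (\<lambda>i. G i \<in> L2 \<nu>) F"
  proof (rule tendsto_cong)
    show "\<forall>\<^sub>F i in F. L2_norm \<nu> (\<lambda>\<xi>. G i \<xi> - H \<xi>) = L2_norm \<mu> (\<lambda>b. G i (Theta b) - H (Theta b))"
      using G by eventually_elim (rule L2_norm_nu[OF nu L2_diff[OF _ H]])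
  qed
  then show ?thesis
    unfolding L2_tendsto_def L2_nu_iff[OF nu] by blast
qed

lemma has_L2_fourier_iff:
  assumes "is_haar_X \<nu>"
  shows "has_L2_fourier \<mu> \<nu> f F \<longleftrightarrow> has_ft f (\<lambda>b. F (Theta b))"
  unfolding has_L2_fourier_def has_ft_def L2_tendsto_nu_iff[OF assms] fourier_Theta by simp

end

section \<open>Multiresolution analyses from compactly supported Fourier transforms\<close>

text \<open>\<open>L2_span\<close> sums over functions while \<open>e\<close> may repeat a function;
  one index is chosen for each.\<close>

lemma L2_span_imageE:
  assumes "g \<in> L2_span (e ` I)"
  obtains J c where "finite J" "J \<subseteq> I" "g = (\<lambda>x. \<Sum>j\<in>J. c j * e j x)"
proof -
  obtain F c where F: "finite F" "F \<subseteq> e ` I" "g = (\<lambda>x. \<Sum>f\<in>F. c f * f x)"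
    using assms by (rule L2_spanE)
  define J where "J = inv_into I e ` F"
  have inv: "inv_into I e f \<in> I" "e (inv_into I e f) = f" if "f \<in> F" for f
    using F(2) that by (auto intro: inv_into_into f_inv_into_f)
  have "inj_on (inv_into I e) F" by (rule inj_on_inv_into[OF F(2)])
  then have "g = (\<lambda>x. \<Sum>j\<in>J. c (e j) * e j x)"
    unfolding F(3) J_def by (simp add: sum.reindex inv)
  moreover have "finite J" "J \<subseteq> I" using F(1) inv by (auto simp: J_def)
  ultimately show thesis using that[of J "\<lambda>j. c (e j)"] by blast
qed

text \<open>Serves for dilations, translations, multiplication by an indicator and the difference f
  (x - a) - f x.\<close>

lemma L2_closed_span_map:
  assumes S: "S \<subseteq> L2 M" and f: "f \<in> L2_closed_span M S"
    and T: "\<And>h. h \<in> L2 M \<Longrightarrow> T h \<in> L2 M'" "\<And>h. h \<in> L2 M \<Longrightarrow> L2_norm M' (T h) \<le> C * L2_norm M h"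
    and diff: "\<And>h h'. T (\<lambda>x. h x - h' x) = (\<lambda>x. T h x - T h' x)"
    and lin: "\<And>I c. finite I \<Longrightarrow> T (\<lambda>x. \<Sum>f\<in>I. c f * f x) = (\<lambda>x. \<Sum>f\<in>I. c f * T f x)"
    and gen: "\<And>h. h \<in> S \<Longrightarrow> T h \<in> S'"
  shows "T f \<in> L2_closed_span M' S'"
  unfolding L2_closed_span_eq
proof (rule L2_closureI)
  have f': "f \<in> L2_closure M (L2_span S)" using f by (simp add: L2_closed_span_eq)
  then have fL2: "f \<in> L2 M" using L2_closure_subset_L2 by blast
  then show "T f \<in> L2 M'" by (rule T)
  fix e :: real assume "e > 0"
  then have "e / (\<bar>C\<bar> + 1) > 0" by (simp add: add_nonneg_pos)
  then obtain g where g: "g \<in> L2_span S" "L2_norm M (\<lambda>x. f x - g x) < e / (\<bar>C\<bar> + 1)"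
    using L2_closureD[OF f'] by blast
  obtain I c where I: "finite I" "I \<subseteq> S" "g = (\<lambda>x. \<Sum>f\<in>I. c f * f x)"
    using g(1) by (rule L2_spanE)
  have gL2: "g \<in> L2 M" using g(1) L2_span_subset_L2[OF S] by blast
  have "T g = (\<lambda>x. \<Sum>f\<in>I. c f * T f x)" unfolding I(3) by (rule lin[OF I(1)])
  also have "\<dots> \<in> L2_span S'"
    using I(2) gen by (intro L2_span_sum L2_span_scale L2_span_base) auto
  finally have Tg: "T g \<in> L2_span S'" .
  have "L2_norm M' (\<lambda>x. T f x - T g x) = L2_norm M' (T (\<lambda>x. f x - g x))" by (simp only: diff)
  also have "\<dots> \<le> C * L2_norm M (\<lambda>x. f x - g x)" by (rule T(2)[OF L2_diff[OF fL2 gL2]])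
  also have "\<dots> \<le> (\<bar>C\<bar> + 1) * L2_norm M (\<lambda>x. f x - g x)" by (intro mult_right_mono) auto
  also have "\<dots> < e" using g(2) by (simp add: less_divide_eq mult.commute add_nonneg_pos)
  finally show "\<exists>g\<in>L2_span S'. L2_norm M' (\<lambda>x. T f x - g x) < e" using Tg by (rule bexI)
qed

lemma kbox_subset_H0: "kbox m 0 \<subseteq> H0"
  by (auto simp: kbox_def H0_eq)

lemma fls_trunc_kbox: "x \<in> kball 0 m \<Longrightarrow> fls_trunc n x \<in> kbox m n"
  by (auto simp: kbox_def kball_def)

lemma kball_kbox_unique:
  assumes "l \<in> kbox m n" "x \<in> kball l n"
  shows "l = fls_trunc n x"
  using assms by (intro fls_eqI) (auto simp: kbox_def kball_def)

text \<open>The balls of index n about the members of \<open>kbox m n\<close> partition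
  \<open>Ksub m\<close>, and a point lies in the one about its truncation.\<close>

lemma sum_indicator_kbox:
  fixes x :: "'a::{zero,finite} fls"
  assumes "m \<le> n"
  shows "(\<Sum>l\<in>kbox m n. indicator (kball l n) x * G l) =
    (indicator (kball 0 m) x * G (fls_trunc n x) :: 'b::semiring_1)"
proof (cases "x \<in> kball 0 m")
  case True
  have "indicator (kball l n) x * G l = 0" if "l \<in> kbox m n" "l \<noteq> fls_trunc n x" for l
    using kball_kbox_unique[OF that(1), of x] that(2) by (auto simp: indicator_def)
  then have "(\<Sum>l\<in>kbox m n. indicator (kball l n) x * G l) =
      (\<Sum>l\<in>{fls_trunc n x}. indicator (kball l n) x * G l)"
    using fls_trunc_kbox[OF True, of n] finite_kbox[of m n]
    by (intro sum.mono_neutral_right) auto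
  then show ?thesis using kball_trunc(2)[of x n] True by simp
next
  case False
  have "x \<notin> kball l n" if l: "l \<in> kbox m n" for l
  proof
    assume "x \<in> kball l n"
    then have "x \<in> kball 0 m" using l assms by (auto simp: kball_def kbox_def)
    with False show False ..
  qed
  then show ?thesis using False by (simp add: indicator_def)
qed

section \<open>Periodization, and trigonometric polynomials on \<open>Ksub 0\<close>\<close>

context local_field
begin

text \<open>H0 represents the cosets of \<open>Ksub 0\<close>. The support meets only the finitely
  many with a representative in the box, and translation folds each of them onto
  \<open>Ksub 0\<close>.\<close>

lemma integral_kball_decomp:
  fixes G :: "'a fls \<Rightarrow> real"
  assumes G: "integrable \<mu> G" and supp: "\<And>x. x \<notin> kball 0 (- int R) \<Longrightarrow> G x = 0"
  shows "(\<integral>x. G x \<partial>\<mu>) = (\<integral>x. indicator (kball 0 0) x * (\<Sum>l\<in>kbox (- int R) 0. G (x + l)) \<partial>\<mu>)"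
    and "integrable \<mu> (\<lambda>x. indicator (kball 0 0) x * (\<Sum>l\<in>kbox (- int R) 0. G (x + l)))"
proof -
  have int: "integrable \<mu> (\<lambda>x. indicator (kball l 0) x * G x)" for l
    using integrable_mult_indicator[of "kball l 0" \<mu> G] G by simp
  have ind: "indicator (kball l 0) (l + x) * G (l + x) = indicator (kball 0 0) x * G (x + l)" for l x
    by (auto simp: indicator_def kball_def add.commute)
  have int2: "integrable \<mu> (\<lambda>x. indicator (kball 0 0) x * G (x + l))" for l
    using integrable_translate[OF int, of l l] by (simp only: ind)
  have eq: "G x = (\<Sum>l\<in>kbox (- int R) 0. indicator (kball l 0) x * G x)" for x
    using sum_indicator_kbox[of "- int R" 0 x "\<lambda>_. G x"] supp[of x] by (auto simp: indicator_def)
  have "(\<integral>x. G x \<partial>\<mu>) = (\<Sum>l\<in>kbox (- int R) 0. \<integral>x. indicator (kball l 0) x * G x \<partial>\<mu>)"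
    by (subst eq) (rule Bochner_Integration.integral_sum, rule int)
  also have "\<dots> = (\<Sum>l\<in>kbox (- int R) 0. \<integral>x. indicator (kball 0 0) x * G (x + l) \<partial>\<mu>)"
  proof (rule sum.cong[OF refl])
    fix l
    have "(\<integral>x. indicator (kball l 0) x * G x \<partial>\<mu>) = (\<integral>x. indicator (kball l 0) (l + x) * G (l + x) \<partial>\<mu>)"
      using borel_measurable_integrable[OF int] by (intro integral_translate[symmetric]) simp
    then show "(\<integral>x. indicator (kball l 0) x * G x \<partial>\<mu>) = (\<integral>x. indicator (kball 0 0) x * G (x + l) \<partial>\<mu>)"
      by (simp only: ind)
  qed
  also have "\<dots> = (\<integral>x. (\<Sum>l\<in>kbox (- int R) 0. indicator (kball 0 0) x * G (x + l)) \<partial>\<mu>)"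
    by (rule Bochner_Integration.integral_sum[symmetric], rule int2)
  finally show "(\<integral>x. G x \<partial>\<mu>) = (\<integral>x. indicator (kball 0 0) x * (\<Sum>l\<in>kbox (- int R) 0. G (x + l)) \<partial>\<mu>)"
    by (simp add: sum_distrib_left)
  show "integrable \<mu> (\<lambda>x. indicator (kball 0 0) x * (\<Sum>l\<in>kbox (- int R) 0. G (x + l)))"
    unfolding sum_distrib_left by (rule Bochner_Integration.integrable_sum, rule int2)
qed

text \<open>The norm of L2 on \<open>Ksub 0\<close>, a fundamental domain for translation by H0,
  hence the natural norm for H0-periodic functions.\<close>

definition norm0 :: "('a fls \<Rightarrow> complex) \<Rightarrow> real" where
  "norm0 T = L2_norm \<mu> (\<lambda>b. indicator (kball 0 0) b * T b)"

definition trig :: "'a fls set \<Rightarrow> ('a fls \<Rightarrow> complex) \<Rightarrow> 'a fls \<Rightarrow> complex" where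
  "trig J c b = (\<Sum>h\<in>J. c h * cnj (pair b h))"

lemma trig_borel [measurable]: "trig J c \<in> borel_measurable borel"
  unfolding trig_def by measurable

lemma trig_bound: "cmod (trig J c b) \<le> (\<Sum>h\<in>J. cmod (c h))"
proof -
  have "cmod (trig J c b) \<le> (\<Sum>h\<in>J. cmod (c h * cnj (pair b h)))"
    unfolding trig_def by (rule norm_sum)
  then show ?thesis by (simp add: norm_mult)
qed

lemma trig_periodic:
  assumes "J \<subseteq> H0" "l \<in> H0"
  shows "trig J c (b + l) = trig J c b"
  unfolding trig_def
proof (rule sum.cong[OF refl])
  fix h assume "h \<in> J"
  then have "pair l h = 1" using pair_H0_eq_1 assms by blast
  then show "c h * cnj (pair (b + l) h) = c h * cnj (pair b h)" by (simp add: pair_add_left)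
qed

lemma ft_unit_step: "ft (modulated h 0 0) b = indicator (kball 0 0) b * cnj (pair b h)"
  by (simp add: ft_modulated modulated_def pair_uminus_left pair_commute[of h b] mult.commute)

text \<open>On \<open>Ksub 0\<close> the characters from H0 are the transforms of the indicators of
  the pairwise disjoint unit balls about points of H0, so Parseval yields their
  orthonormality.\<close>

lemma norm0_trig:
  assumes J: "finite J" "J \<subseteq> H0"
  shows "(norm0 (trig J c))\<^sup>2 = (\<Sum>h\<in>J. (cmod (c h))\<^sup>2)"
proof -
  let ?t = "\<lambda>x. \<Sum>h\<in>J. c h * modulated h 0 0 x"
  have t: "?t \<in> test_functions"
    unfolding test_functions_def
    by (intro L2_span_sum L2_span_scale) (use modulated_test test_functions_def in blast)
  have "ft ?t = (\<lambda>b. indicator (kball 0 0) b * trig J c b)"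
    by (rule ext)
       (simp add: ft_sum ft_scale ft_unit_step modulated_integrable trig_def sum_distrib_left mult_ac)
  then have "norm0 (trig J c) = L2_norm \<mu> ?t"
    using test_Parseval[OF t] by (simp add: norm0_def)
  also have "(L2_norm \<mu> ?t)\<^sup>2 = (\<integral>x. (\<Sum>h\<in>J. (cmod (c h))\<^sup>2 * indicator (kball h 0) x) \<partial>\<mu>)"
    unfolding L2_norm_power2
  proof (rule Bochner_Integration.integral_cong[OF refl])
    fix x
    show "(cmod (?t x))\<^sup>2 = (\<Sum>h\<in>J. (cmod (c h))\<^sup>2 * indicator (kball h 0) x)"
    proof (cases "\<exists>h\<in>J. x \<in> kball h 0")
      case True
      then obtain h where h: "h \<in> J" "x \<in> kball h 0" by blast
      have other: "x \<notin> kball h' 0" if "h' \<in> J" "h' \<noteq> h" for h'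
      proof
        assume "x \<in> kball h' 0"
        moreover have "h \<in> H0" "h' \<in> H0" using h that J by auto
        ultimately have "h' $$ k = h $$ k" for k
          using h(2) by (cases "k < 0") (auto simp: kball_def H0_eq)
        with that show False using fls_eqI by blast
      qed
      have "?t x = (\<Sum>h'\<in>{h}. c h' * modulated h' 0 0 x)"
        using J h other by (intro sum.mono_neutral_right) (auto simp: modulated_def indicator_def)
      moreover have "(\<Sum>h\<in>J. (cmod (c h))\<^sup>2 * indicator (kball h 0) x) =
          (\<Sum>h'\<in>{h}. (cmod (c h'))\<^sup>2 * indicator (kball h' 0) x)"
        using J h other by (intro sum.mono_neutral_right) (auto simp: indicator_def)
      ultimately show ?thesis using h by (simp add: modulated_def)
    next
      case False
      then show ?thesis by (simp add: modulated_def indicator_def)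
    qed
  qed
  also have "\<dots> = (\<Sum>h\<in>J. (cmod (c h))\<^sup>2)"
    by (subst Bochner_Integration.integral_sum) auto
  finally show ?thesis .
qed

text \<open>Up to a factor the indicator is the transform of the character \<open>pair a\<close>
  restricted to \<open>Ksub (- n)\<close>. Since \<open>a\<close> lies in \<open>Ksub 0\<close>,
  that character is constant on unit balls and so is a finite combination of their
  indicators.\<close>

lemma indicator_kball_trig:
  assumes n: "n \<ge> 0" and a: "a \<in> kball 0 0"
  shows "indicator (kball a n) b = (1 / complex_of_real (q powi n)) *
    (\<Sum>h\<in>kbox (- n) 0. pair a h * (indicator (kball 0 0) b * cnj (pair b h)))"
proof -
  have "modulated 0 a (- n) x = (\<Sum>h\<in>kbox (- n) 0. pair a h * modulated h 0 0 x)" for x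
  proof -
    have "pair a x = pair a (fls_trunc 0 x)"
    proof -
      have "x - fls_trunc 0 x \<in> kball 0 (- 0)" by (auto simp: kball_def)
      then have "pair a (x - fls_trunc 0 x) = 1" using pair_kball_eq_1[OF a] by blast
      then show ?thesis using pair_add_right[of a "x - fls_trunc 0 x" "fls_trunc 0 x"] by simp
    qed
    then show ?thesis
      using sum_indicator_kbox[of "- n" 0 x "pair a"] n by (simp add: modulated_def mult.commute)
  qed
  then have "modulated 0 a (- n) = (\<lambda>x. \<Sum>h\<in>kbox (- n) 0. pair a h * modulated h 0 0 x)"
    by blast
  then have "ft (modulated 0 a (- n)) b = (\<Sum>h\<in>kbox (- n) 0. pair a h * ft (modulated h 0 0) b)"
    by (simp add: ft_sum ft_scale modulated_integrable)
  moreover have "ft (modulated 0 a (- n)) b = complex_of_real (q powi n) * indicator (kball a n) b"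
    by (simp add: ft_modulated modulated_def)
  moreover have "complex_of_real (q powi n) \<noteq> 0" using q_pos by simp
  ultimately show ?thesis by (simp add: ft_unit_step field_simps)
qed

definition unit_chars :: "('a fls \<Rightarrow> complex) set" where
  "unit_chars = (\<lambda>h b. indicator (kball 0 0) b * cnj (pair b h)) ` H0"

lemma unit_chars_L2: "unit_chars \<subseteq> L2 \<mu>"
proof -
  have "(\<lambda>b. indicator (kball 0 0) b * cnj (pair b h)) \<in> L2 \<mu>" for h
    using L2_mult_pair(1)[of "indicator (kball 0 0)" h] indicator_L2[of "kball 0 0"]
    by (simp add: mult.commute)
  then show ?thesis by (auto simp: unit_chars_def)
qed

lemma L2_mult_indicator:
  assumes "f \<in> L2 \<mu>" "S \<in> sets borel"
  shows "(\<lambda>b. indicator S b * f b) \<in> L2 \<mu>" "L2_norm \<mu> (\<lambda>b. indicator S b * f b) \<le> L2_norm \<mu> f"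
proof -
  have "(\<lambda>b. indicator S b * f b) \<in> borel_measurable \<mu>"
    using assms L2_mu_borel[OF assms(1)] by simp
  moreover have "AE b in \<mu>. cmod (indicator S b * f b) \<le> 1 * cmod (f b)"
    by (intro AE_I2) (simp add: norm_mult split: split_indicator)
  ultimately show "(\<lambda>b. indicator S b * f b) \<in> L2 \<mu>" "L2_norm \<mu> (\<lambda>b. indicator S b * f b) \<le> L2_norm \<mu> f"
    using L2_norm_mono[of f \<mu> "\<lambda>b. indicator S b * f b" 1] assms(1) by simp_all
qed

text \<open>Completeness of the characters from H0 on \<open>Ksub 0\<close>. Indicators of balls are
  dense, and cutting one down to \<open>Ksub 0\<close> leaves nothing, all of \<open>Ksub 0\<close>,
  or a smaller ball covered by \<open>indicator_kball_trig\<close>.\<close>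

lemma restrict_in_unit_chars:
  assumes "f \<in> L2 \<mu>"
  shows "(\<lambda>b. indicator (kball 0 0) b * f b) \<in> L2_closed_span \<mu> unit_chars"
proof -
  let ?W = "L2_closed_span \<mu> unit_chars"
  have W: "L2_closed_subspace \<mu> ?W" using unit_chars_L2 by (rule L2_closed_subspace_closed_span)
  have char: "(\<lambda>b. indicator (kball 0 0) b * cnj (pair b h)) \<in> ?W" if "h \<in> H0" for h
    using L2_closed_span_superset(2)[OF unit_chars_L2] that by (auto simp: unit_chars_def)
  have step: "(\<lambda>b. indicator (kball 0 0) b * indicator (kball a n) b) \<in> ?W" for a n
  proof -
    have eq: "(\<lambda>b. indicator (kball 0 0) b * indicator (kball a n) b :: complex) =
        (\<lambda>b. indicator (kball 0 0 \<inter> kball a n) b)"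
      by (auto simp: indicator_def)
    consider "kball 0 0 \<inter> kball a n = {}" | "kball 0 0 \<inter> kball a n = kball 0 0"
      | "n \<ge> 0" "a \<in> kball 0 0" "kball 0 0 \<inter> kball a n = kball a n"
    proof (cases "n \<ge> 0")
      case True
      show thesis
      proof (cases "kball 0 0 \<inter> kball a n = {}")
        case False
        then obtain x where x: "x \<in> kball 0 0" "x \<in> kball a n" by blast
        have "a \<in> kball 0 0" using x True by (auto simp: kball_def)
        moreover from this have "kball a n \<subseteq> kball 0 0" using True by (auto simp: kball_def)
        ultimately show thesis using that(3) True by blast
      qed (rule that(1))
    next
      case False
      show thesis
      proof (cases "kball 0 0 \<inter> kball a n = {}")
        case False
        then obtain x where x: "x \<in> kball 0 0" "x \<in> kball a n" by blast
        then have "kball 0 0 \<subseteq> kball a n" using \<open>\<not> n \<ge> 0\<close> by (auto simp: kball_def)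
        then show thesis using that(2) by blast
      qed (rule that(1))
    qed
    then show ?thesis
    proof cases
      case 1
      then show ?thesis unfolding eq using L2_closed_subspace_zero[OF W] by (simp add: indicator_def[abs_def])
    next
      case 2
      then show ?thesis unfolding eq using char[OF H0_zero] by simp
    next
      case 3
      have "(\<lambda>b. (1 / complex_of_real (q powi n)) *
          (\<Sum>h\<in>kbox (- n) 0. pair a h * (indicator (kball 0 0) b * cnj (pair b h)))) \<in> ?W"
        using kbox_subset_H0
        by (intro L2_closed_subspace_scale[OF W] L2_closed_subspace_sum[OF W] char) blast
      moreover have "(\<lambda>b. indicator (kball a n) b) = (\<lambda>b. (1 / complex_of_real (q powi n)) *
          (\<Sum>h\<in>kbox (- n) 0. pair a h * (indicator (kball 0 0) b * cnj (pair b h))))"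
        by (rule ext) (rule indicator_kball_trig[OF 3(1,2)])
      ultimately show ?thesis unfolding eq 3(3) by (simp only:)
    qed
  qed
  have f': "f \<in> L2_closed_span \<mu> kball_indicators" using assms kball_indicators_dense by simp
  have "(\<lambda>b. indicator (kball 0 0) b * f b) \<in> L2_closed_span \<mu> ?W"
  proof (rule L2_closed_span_map[OF kball_indicators_L2 f', where C = 1])
    show "(\<lambda>b. indicator (kball 0 0) b * h b) \<in> ?W" if "h \<in> kball_indicators" for h
      using step that by (auto simp: kball_indicators_def)
  qed (auto simp: L2_mult_indicator right_diff_distrib sum_distrib_left mult.left_commute)
  then show ?thesis
    using L2_closed_span_minimal[OF W order_refl] by blast
qed

lemma trig_approx:
  assumes P: "P \<in> borel_measurable borel" "\<And>b. cmod (P b) \<le> C" and "e > 0"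
  shows "\<exists>J c. finite J \<and> J \<subseteq> H0 \<and> norm0 (\<lambda>b. P b - trig J c b) < e"
proof -
  let ?f = "\<lambda>b. indicator (kball 0 0) b * P b"
  have f: "?f \<in> L2 \<mu>"
  proof (rule L2_bound[of "indicator (kball 0 0)" _ _ C])
    show "indicator (kball 0 0) \<in> L2 \<mu>" using indicator_L2[of "kball 0 0"] by simp
    show "?f \<in> borel_measurable \<mu>" using P(1) by simp
    show "AE b in \<mu>. cmod (?f b) \<le> C * cmod (indicator (kball 0 0) b)"
      using P(2) by (intro AE_I2) (simp add: norm_mult split: split_indicator)
  qed
  have "(\<lambda>b. indicator (kball 0 0) b * ?f b) = ?f" by (auto simp: indicator_def)
  then have "?f \<in> L2_closure \<mu> (L2_span unit_chars)"
    using restrict_in_unit_chars[OF f] by (simp add: L2_closed_span_eq)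
  then obtain g where g: "g \<in> L2_span unit_chars" "L2_norm \<mu> (\<lambda>b. ?f b - g b) < e"
    using L2_closureD \<open>e > 0\<close> by blast
  obtain J c where J: "finite J" "J \<subseteq> H0"
    "g = (\<lambda>b. \<Sum>h\<in>J. c h * (indicator (kball 0 0) b * cnj (pair b h)))"
    using g(1) unfolding unit_chars_def by (rule L2_span_imageE)
  have "g = (\<lambda>b. indicator (kball 0 0) b * trig J c b)"
    unfolding J(3) by (simp add: trig_def sum_distrib_left mult.left_commute)
  then have "norm0 (\<lambda>b. P b - trig J c b) < e"
    using g(2) by (simp add: norm0_def right_diff_distrib)
  then show ?thesis using J by blast
qed

end

text \<open>The interface between the tree and the analysis. \<open>M\<close> is the mask after one
  dilation, which makes all of H0 its periods; \<open>R\<close> bounds the support of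
  \<open>F\<close>; \<open>lower\<close> and \<open>upper\<close> express the Riesz bounds through
  the periodization of |F|^2.\<close>

locale refinable = local_field \<mu> p s coord
  for \<mu> :: "'a::{field,finite} fls measure" and p s coord +
  fixes \<phi> F M :: "'a fls \<Rightarrow> complex" and R N :: nat and A B C :: real
  assumes ft_phi: "has_ft \<phi> F"
    and F_support: "F b \<noteq> 0 \<Longrightarrow> b \<in> kball 0 (- int R)"
    and refinement: "F (fls_shift 1 b) = M b * F b"
    and M_borel: "M \<in> borel_measurable borel"
    and M_periodic: "h \<in> H0 \<Longrightarrow> M (b + h) = M b"
    and M_bound: "cmod (M b) \<le> C"
    and F_eq_1: "b \<in> kball 0 (int N) \<Longrightarrow> F b = 1"
    and F_eq_0: "b \<in> kball 0 (int N) \<Longrightarrow> h \<in> H0 \<Longrightarrow> h \<noteq> 0 \<Longrightarrow> F (b + h) = 0"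
    and A_pos: "0 < A" and B_pos: "0 < B"
    and lower: "b \<in> kball 0 0 \<Longrightarrow> A \<le> (\<Sum>l\<in>kbox (- int R) 0. (cmod (F (b + l)))\<^sup>2)"
    and upper: "b \<in> kball 0 0 \<Longrightarrow> (\<Sum>l\<in>kbox (- int R) 0. (cmod (F (b + l)))\<^sup>2) \<le> B"
begin

lemma phi_L2: "\<phi> \<in> L2 \<mu>" and F_L2: "F \<in> L2 \<mu>"
  using has_ft_L2[OF ft_phi] by blast+

lemma L2_bounded_mult:
  assumes "P \<in> borel_measurable borel" "\<And>b. cmod (P b) \<le> K" "f \<in> L2 \<mu>"
  shows "(\<lambda>b. P b * f b) \<in> L2 \<mu>"
proof (rule L2_bound[OF assms(3), of _ K])
  show "(\<lambda>b. P b * f b) \<in> borel_measurable \<mu>" using assms(1) L2_mu_borel[OF assms(3)] by simp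
  show "AE b in \<mu>. cmod (P b * f b) \<le> K * cmod (f b)"
    using assms(2) by (intro AE_I2) (simp add: norm_mult mult_right_mono)
qed

text \<open>Folding along H0 pulls the periodic factor out: the squared norm becomes the integral
  over \<open>Ksub 0\<close> of |P|^2 times the periodization of |F|^2, which lies between A and
  B.\<close>

lemma norm_periodic_mult:
  assumes P: "P \<in> borel_measurable borel" "\<And>b. cmod (P b) \<le> K" "\<And>b h. h \<in> H0 \<Longrightarrow> P (b + h) = P b"
  shows "A * (norm0 P)\<^sup>2 \<le> (L2_norm \<mu> (\<lambda>b. P b * F b))\<^sup>2"
    and "(L2_norm \<mu> (\<lambda>b. P b * F b))\<^sup>2 \<le> B * (norm0 P)\<^sup>2"
proof -
  let ?G = "\<lambda>b. (cmod (P b * F b))\<^sup>2"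
  let ?\<Phi> = "\<lambda>b. \<Sum>l\<in>kbox (- int R) 0. (cmod (F (b + l)))\<^sup>2"
  let ?D = "\<lambda>b. (cmod (indicator (kball 0 0) b * P b))\<^sup>2"
  have G: "integrable \<mu> ?G"
    by (rule L2_integrable[OF L2_bounded_mult[OF P(1,2) F_L2]])
  have supp: "?G x = 0" if "x \<notin> kball 0 (- int R)" for x
    using F_support[of x] that by auto
  have eq: "indicator (kball 0 0) b * (\<Sum>l\<in>kbox (- int R) 0. ?G (b + l)) = ?D b * ?\<Phi> b" for b
  proof -
    have "(\<Sum>l\<in>kbox (- int R) 0. ?G (b + l)) = (\<Sum>l\<in>kbox (- int R) 0. (cmod (P b))\<^sup>2 * (cmod (F (b + l)))\<^sup>2)"
    proof (rule sum.cong[OF refl])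
      fix l :: "'a fls" assume "l \<in> kbox (- int R) 0"
      then have "P (b + l) = P b" using P(3) kbox_subset_H0 by blast
      then show "?G (b + l) = (cmod (P b))\<^sup>2 * (cmod (F (b + l)))\<^sup>2"
        by (simp add: norm_mult power_mult_distrib)
    qed
    then show ?thesis by (simp add: sum_distrib_left norm_mult power_mult_distrib split: split_indicator)
  qed
  have norm_eq: "(L2_norm \<mu> (\<lambda>b. P b * F b))\<^sup>2 = (\<integral>b. ?D b * ?\<Phi> b \<partial>\<mu>)"
    using integral_kball_decomp(1)[OF G supp] by (simp only: L2_norm_power2 eq)
  have int: "integrable \<mu> (\<lambda>b. ?D b * ?\<Phi> b)"
  proof -
    have "integrable \<mu> (\<lambda>b. indicator (kball 0 0) b * (\<Sum>l\<in>kbox (- int R) 0. ?G (b + l)))"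
      by (rule integral_kball_decomp(2)[OF G]) (rule supp)
    then show ?thesis by (simp only: eq)
  qed
  have ind: "indicator (kball 0 0) \<in> L2 \<mu>" using indicator_L2[of "kball 0 0"] by simp
  have "(\<lambda>b. P b * indicator (kball 0 0) b) \<in> L2 \<mu>" by (rule L2_bounded_mult[OF P(1,2) ind])
  then have D: "integrable \<mu> ?D" by (simp add: L2_def mult.commute)
  have D_eq: "(norm0 P)\<^sup>2 = (\<integral>b. ?D b \<partial>\<mu>)" by (simp add: norm0_def L2_norm_power2)
  show "A * (norm0 P)\<^sup>2 \<le> (L2_norm \<mu> (\<lambda>b. P b * F b))\<^sup>2"
  proof -
    have "A * (norm0 P)\<^sup>2 = (\<integral>b. A * ?D b \<partial>\<mu>)" by (simp add: D_eq)
    also have "\<dots> \<le> (\<integral>b. ?D b * ?\<Phi> b \<partial>\<mu>)"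
    proof (rule integral_mono)
      show "A * ?D b \<le> ?D b * ?\<Phi> b" for b
      proof (cases "b \<in> kball 0 0")
        case True
        from mult_right_mono[OF lower[OF this] zero_le_power2[of "cmod (indicator (kball 0 0) b * P b)"]]
        show ?thesis by (simp only: mult.commute)
      qed simp
    qed (use D int in auto)
    finally show ?thesis by (simp add: norm_eq)
  qed
  show "(L2_norm \<mu> (\<lambda>b. P b * F b))\<^sup>2 \<le> B * (norm0 P)\<^sup>2"
  proof -
    have "(\<integral>b. ?D b * ?\<Phi> b \<partial>\<mu>) \<le> (\<integral>b. B * ?D b \<partial>\<mu>)"
    proof (rule integral_mono)
      show "?D b * ?\<Phi> b \<le> B * ?D b" for b
      proof (cases "b \<in> kball 0 0")
        case True
        from mult_right_mono[OF upper[OF this] zero_le_power2[of "cmod (indicator (kball 0 0) b * P b)"]]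
        show ?thesis by (simp only: mult.commute)
      qed simp
    qed (use D int in auto)
    also have "\<dots> = B * (norm0 P)\<^sup>2" by (simp add: D_eq)
    finally show ?thesis by (simp add: norm_eq)
  qed
qed

lemma ft_trig_combination:
  "has_ft (\<lambda>x. \<Sum>h\<in>J. c h * \<phi> (x - h)) (\<lambda>b. trig J c b * F b)"
proof -
  have "has_ft (\<lambda>x. \<Sum>h\<in>J. c h * \<phi> (x - h)) (\<lambda>b. \<Sum>h\<in>J. c h * (cnj (pair b h) * F b))"
    by (intro has_ft_sum has_ft_scale has_ft_translate ft_phi)
  then show ?thesis by (simp add: trig_def sum_distrib_right mult.assoc)
qed

text \<open>By Plancherel a combination of shifts has the norm of a trigonometric polynomial times
  \<open>F\<close>, and on \<open>Ksub 0\<close> that polynomial has the norm of its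
  coefficients.\<close>

lemma riesz_system_shifts: "riesz_system \<mu> A B H0 (\<lambda>h x. \<phi> (x - h))"
proof (rule riesz_systemI[OF A_pos B_pos])
  show "(\<lambda>x. \<phi> (x - h)) \<in> L2 \<mu>" for h by (rule L2_translate_minus(1)[OF phi_L2])
  fix J :: "'a fls set" and c :: "'a fls \<Rightarrow> complex" assume J: "finite J" "J \<subseteq> H0"
  have norm: "L2_norm \<mu> (\<lambda>b. trig J c b * F b) = L2_norm \<mu> (\<lambda>x. \<Sum>h\<in>J. c h * \<phi> (x - h))"
    by (rule Plancherel[OF ft_trig_combination])
  show "A * (\<Sum>h\<in>J. (cmod (c h))\<^sup>2) \<le> (L2_norm \<mu> (\<lambda>x. \<Sum>h\<in>J. c h * \<phi> (x - h)))\<^sup>2"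
    unfolding norm[symmetric] norm0_trig[OF J, symmetric]
    by (rule norm_periodic_mult(1)[OF trig_borel trig_bound]) (rule trig_periodic[OF J(2)])
  show "(L2_norm \<mu> (\<lambda>x. \<Sum>h\<in>J. c h * \<phi> (x - h)))\<^sup>2 \<le> B * (\<Sum>h\<in>J. (cmod (c h))\<^sup>2)"
    unfolding norm[symmetric] norm0_trig[OF J, symmetric]
    by (rule norm_periodic_mult(2)[OF trig_borel trig_bound]) (rule trig_periodic[OF J(2)])
qed

section \<open>The spaces V n and their axioms\<close>

definition gens :: "int \<Rightarrow> ('a fls \<Rightarrow> complex) set" where
  "gens n = (\<lambda>h x. \<phi> (fls_shift n x - h)) ` H0"

abbreviation V :: "int \<Rightarrow> ('a fls \<Rightarrow> complex) set" where
  "V \<equiv> MRA_space \<mu> \<phi>"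

lemma V_eq: "V n = L2_closed_span \<mu> (gens n)"
  by (simp add: MRA_space_def gens_def)

lemma gens_L2: "gens n \<subseteq> L2 \<mu>"
  unfolding gens_def by (auto intro: L2_shift(1)[OF L2_translate_minus(1)[OF phi_L2]])

lemma V_subspace: "L2_closed_subspace \<mu> (V n)"
  unfolding V_eq by (rule L2_closed_subspace_closed_span[OF gens_L2])

lemma V_L2: "f \<in> V n \<Longrightarrow> f \<in> L2 \<mu>"
  using L2_closed_subspace_subset[OF V_subspace] by blast

lemma gens_V: "h \<in> H0 \<Longrightarrow> (\<lambda>x. \<phi> (fls_shift n x - h)) \<in> V n"
  unfolding V_eq using L2_closed_span_superset(2)[OF gens_L2] by (auto simp: gens_def)

lemma V_dilation: "f \<in> V n \<Longrightarrow> (\<lambda>x. f (fls_shift k x)) \<in> V (n + k)"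
  unfolding V_eq
proof (rule L2_closed_span_map[OF gens_L2, where C = "sqrt (q powi (- k))" and T = "\<lambda>f x. f (fls_shift k x)"])
  fix h assume "h \<in> gens n"
  then show "(\<lambda>x. h (fls_shift k x)) \<in> gens (n + k)" by (auto simp: gens_def add.commute)
qed (auto simp: L2_shift)

lemma V_dilation_iff: "f \<in> V n \<longleftrightarrow> (\<lambda>x. f (fls_shift k x)) \<in> V (n + k)"
  using V_dilation[of f n k] V_dilation[of "\<lambda>x. f (fls_shift k x)" "n + k" "- k"] by auto

lemma V_translate:
  assumes "f \<in> V n" "fls_shift n a \<in> H0"
  shows "(\<lambda>x. f (x - a)) \<in> V n"
  using assms(1) unfolding V_eq
proof (rule L2_closed_span_map[OF gens_L2, where C = 1 and T = "\<lambda>f x. f (x - a)"])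
  fix g assume "g \<in> gens n"
  then obtain h where h: "h \<in> H0" "g = (\<lambda>x. \<phi> (fls_shift n x - h))" by (auto simp: gens_def)
  have "fls_shift n (x - a) - h = fls_shift n x - (fls_shift n a + h)" for x
    by (rule fls_eqI) simp
  then show "(\<lambda>x. g (x - a)) \<in> gens n"
    unfolding gens_def h(2) using H0_add[OF assms(2) h(1)]
    by (intro image_eqI[of _ _ "fls_shift n a + h"]) (simp_all add: diff_diff_eq)
qed (auto simp: L2_translate_minus)

lemma V_translate_0: "f \<in> V 0 \<Longrightarrow> h \<in> H0 \<Longrightarrow> (\<lambda>x. f (x - h)) \<in> V 0"
  by (rule V_translate) simp_all

text \<open>Trigonometric polynomials times \<open>F\<close> are the transforms of finite
  combinations of shifts. They approximate \<open>P\<close> in L2 of \<open>Ksub 0\<close>, and the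
  bound B converts this into approximation of the product P F in L2 of K.\<close>

lemma in_V0I:
  assumes f: "has_ft f (\<lambda>b. P b * F b)"
    and P: "P \<in> borel_measurable borel" "\<And>b. cmod (P b) \<le> K" "\<And>b h. h \<in> H0 \<Longrightarrow> P (b + h) = P b"
  shows "f \<in> V 0"
proof -
  have "f \<in> L2_closure \<mu> (V 0)"
  proof (rule L2_closureI)
    show "f \<in> L2 \<mu>" by (rule has_ft_L2(1)[OF f])
    fix e :: real assume "e > 0"
    then have "e / sqrt B > 0" using B_pos by simp
    then obtain J c where J: "finite J" "J \<subseteq> H0" "norm0 (\<lambda>b. P b - trig J c b) < e / sqrt B"
      using trig_approx[OF P(1,2)] by blast
    let ?g = "\<lambda>x. \<Sum>h\<in>J. c h * \<phi> (x - h)"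
    have g: "?g \<in> V 0"
    proof (intro L2_closed_subspace_sum[OF V_subspace] L2_closed_subspace_scale[OF V_subspace])
      show "(\<lambda>x. \<phi> (x - h)) \<in> V 0" if "h \<in> J" for h
        using gens_V[of h 0] J(2) that by auto
    qed
    have "L2_norm \<mu> (\<lambda>x. f x - ?g x) < e"
    proof -
      let ?Q = "\<lambda>b. P b - trig J c b"
      have "has_ft (\<lambda>x. f x - ?g x) (\<lambda>b. P b * F b - trig J c b * F b)"
        by (rule has_ft_diff[OF f ft_trig_combination])
      then have "has_ft (\<lambda>x. f x - ?g x) (\<lambda>b. ?Q b * F b)"
        by (simp only: left_diff_distrib)
      then have "L2_norm \<mu> (\<lambda>x. f x - ?g x) = L2_norm \<mu> (\<lambda>b. ?Q b * F b)"
        by (rule Plancherel[symmetric])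
      moreover have "(L2_norm \<mu> (\<lambda>b. ?Q b * F b))\<^sup>2 \<le> B * (norm0 ?Q)\<^sup>2"
      proof (rule norm_periodic_mult(2))
        show "?Q \<in> borel_measurable borel" using P(1) by simp
        show "cmod (?Q b) \<le> K + (\<Sum>h\<in>J. cmod (c h))" for b
          using norm_triangle_ineq4[of "P b" "trig J c b"] P(2)[of b] trig_bound[of J c b] by linarith
        show "?Q (b + h) = ?Q b" if "h \<in> H0" for b h
          using P(3)[OF that] trig_periodic[OF J(2) that] by simp
      qed
      then have "(L2_norm \<mu> (\<lambda>b. ?Q b * F b))\<^sup>2 \<le> (sqrt B * norm0 ?Q)\<^sup>2"
        using B_pos by (simp add: power_mult_distrib)
      then have "L2_norm \<mu> (\<lambda>b. ?Q b * F b) \<le> sqrt B * norm0 ?Q"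
        by (rule power2_le_imp_le) (use B_pos in \<open>simp add: norm0_def\<close>)
      moreover have "sqrt B * norm0 ?Q < e"
        using J(3) B_pos by (simp add: pos_less_divide_eq mult.commute)
      ultimately show ?thesis by linarith
    qed
    then show "\<exists>g\<in>V 0. L2_norm \<mu> (\<lambda>x. f x - g x) < e" using g by (rule bexI)
  qed
  then show ?thesis using L2_closed_subspace_closure[OF V_subspace] by blast
qed

lemma V_mono_Suc: "V n \<subseteq> V (n + 1)"
proof -
  \<comment> \<open>The factor q is the Jacobian of the inverse dilation.\<close>
  have "has_ft (\<lambda>x. \<phi> (fls_shift (- 1) x)) (\<lambda>b. (complex_of_real q * M b) * F b)"
    using has_ft_shift[OF ft_phi, of "- 1"] by (simp add: refinement mult.assoc)
  then have "(\<lambda>x. \<phi> (fls_shift (- 1) x)) \<in> V 0"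
  proof (rule in_V0I)
    show "(\<lambda>b. complex_of_real q * M b) \<in> borel_measurable borel" using M_borel by simp
    show "cmod (complex_of_real q * M b) \<le> q * C" for b
      using q_pos M_bound[of b] by (simp add: norm_mult)
    show "complex_of_real q * M (b + h) = complex_of_real q * M b" if "h \<in> H0" for b h
      using M_periodic[OF that] by simp
  qed
  from V_dilation[OF this, of 1] have phi1: "\<phi> \<in> V 1" by simp
  \<comment> \<open>V 1 is invariant under every translation whose dilate lies in H0, and dilation
    maps H0 into itself.\<close>
  have "gens 0 \<subseteq> V 1"
  proof
    fix g assume "g \<in> gens 0"
    then obtain h where h: "h \<in> H0" "g = (\<lambda>x. \<phi> (x - h))" by (auto simp: gens_def)
    have "fls_shift 1 h \<in> H0" using h(1) by (auto simp: H0_eq)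
    then show "g \<in> V 1" unfolding h(2) using V_translate[OF phi1] by blast
  qed
  then have V01: "V 0 \<subseteq> V 1" unfolding V_eq[of 0] by (rule L2_closed_span_minimal[OF V_subspace])
  show ?thesis
  proof
    fix f assume "f \<in> V n"
    then have "(\<lambda>x. f (fls_shift (- n) x)) \<in> V 1" using V_dilation[of f n "- n"] V01 by auto
    from V_dilation[OF this, of n] show "f \<in> V (n + 1)" by (simp add: add.commute)
  qed
qed

lemma V_mono: "m \<le> n \<Longrightarrow> V m \<subseteq> V n"
proof (induction n rule: int_ge_induct)
  case (step i)
  then show ?case using V_mono_Suc[of i] by blast
qed simp

lemma indicator_in_V0: "(\<lambda>x. indicator (kball 0 (- int N)) x) \<in> V 0"
proof -
  \<comment> \<open>\<open>S\<close> is the union of the cosets of \<open>Ksub (int N)\<close> by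
    H0; \<open>F\<close> is 1 on the coset of 0 and vanishes on the others.\<close>
  define S where "S = {b :: 'a fls. \<forall>j\<in>{0..<int N}. b $$ j = 0}"
  have "(\<lambda>b. indicator S b :: complex) = (\<lambda>b. \<Prod>j\<in>{0..<int N}. (\<lambda>v. if v = 0 then 1 else 0) (b $$ j))"
    by (auto simp: S_def indicator_def intro!: prod_zero[symmetric])
  also have "\<dots> \<in> borel_measurable borel"
    by (intro borel_measurable_prod nth_measurable)
  finally have S_borel: "(\<lambda>b. indicator S b :: complex) \<in> borel_measurable borel" .
  have key: "indicator S b * F b = indicator (kball 0 (int N)) b" for b
  proof -
    define h where "h = fls_trunc 0 b"
    have h: "h \<in> H0" by (simp add: h_def H0_eq)
    show ?thesis
    proof (cases "b \<in> S")
      case True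
      then have bh: "b - h \<in> kball 0 (int N)" by (auto simp: S_def kball_def h_def)
      show ?thesis
      proof (cases "h = 0")
        case True
        then show ?thesis using bh F_eq_1[of b] \<open>b \<in> S\<close> by simp
      next
        case False
        then obtain j where "j < 0" "b $$ j \<noteq> 0"
          unfolding h_def by (metis fls_eqI fls_trunc_nth fls_zero_nth)
        then have "b \<notin> kball 0 (int N)" by (auto simp: kball_def intro!: exI[of _ j])
        then show ?thesis using F_eq_0[OF bh h False] by simp
      qed
    next
      case False
      then show ?thesis by (auto simp: S_def kball_def indicator_def)
    qed
  qed
  have "ft (modulated 0 0 (- int N)) = (\<lambda>b. (complex_of_real (q powi int N) * indicator S b) * F b)"
    by (rule ext) (simp add: ft_modulated modulated_def mult.assoc key)
  then have "has_ft (modulated 0 0 (- int N)) (\<lambda>b. (complex_of_real (q powi int N) * indicator S b) * F b)"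
    using has_ft_test[OF modulated_test[of 0 0 "- int N"]] by simp
  then have "modulated 0 0 (- int N) \<in> V 0"
  proof (rule in_V0I)
    show "(\<lambda>b. complex_of_real (q powi int N) * indicator S b) \<in> borel_measurable borel"
      using S_borel by (intro borel_measurable_times borel_measurable_const)
    show "cmod (complex_of_real (q powi int N) * indicator S b) \<le> q powi int N" for b
      using q_pos by (simp add: norm_mult norm_power split: split_indicator)
    show "complex_of_real (q powi int N) * indicator S (b + h) = complex_of_real (q powi int N) * indicator S b"
      if "h \<in> H0" for b h
      using that by (auto simp: S_def H0_eq indicator_def)
  qed
  moreover have "modulated 0 0 (- int N) = (\<lambda>x. indicator (kball 0 (- int N)) x)"
    by (rule ext) (simp add: modulated_def)
  ultimately show ?thesis by simp
qed

lemma indicator_in_V: "(\<lambda>x. indicator (kball a k) x) \<in> V (k + int N)"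
proof -
  \<comment> \<open>The dilation by k + N carries balls of index k to balls of index - N. Of the
    dilated centre, \<open>h\<close> is the part in H0; the remainder lies in \<open>Ksub 0\<close>,
    hence in \<open>Ksub (- int N)\<close>.\<close>
  define n where "n = k + int N"
  define h where "h = fls_shift n (fls_trunc n a)"
  have h: "h \<in> H0" by (simp add: h_def H0_eq)
  have "(\<lambda>x. indicator (kball 0 (- int N)) (x - h)) \<in> V 0"
    by (rule V_translate_0[OF indicator_in_V0 h])
  from V_dilation[OF this, of n]
  have "(\<lambda>x. indicator (kball 0 (- int N)) (fls_shift n x - h)) \<in> V n" by simp
  moreover have "fls_shift n x - h \<in> kball 0 (- int N) \<longleftrightarrow> x \<in> kball a k" for x
  proof
    assume "fls_shift n x - h \<in> kball 0 (- int N)"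
    then have *: "x $$ (j + n) = fls_trunc n a $$ (j + n)" if "j < - int N" for j
      using that by (simp add: kball_def h_def)
    show "x \<in> kball a k" unfolding kball_def
    proof (intro CollectI allI impI)
      fix j assume "j < k"
      then show "x $$ j = a $$ j" using *[of "j - n"] by (simp add: n_def)
    qed
  next
    assume x: "x \<in> kball a k"
    show "fls_shift n x - h \<in> kball 0 (- int N)" unfolding kball_def
    proof (intro CollectI allI impI)
      fix j assume "j < - int N"
      then have "j + n < k" "j + n < n" by (simp_all add: n_def)
      then show "(fls_shift n x - h) $$ j = 0 $$ j" using x by (simp add: h_def kball_def)
    qed
  qed
  ultimately show ?thesis by (simp add: indicator_def n_def)
qed

text \<open>Indicators of balls are dense, so it is enough that each finite combination of them lies
  in one V n; the spaces are nested, and the largest index involved will do.\<close>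

lemma closure_Union_V: "L2_closure \<mu> (\<Union>n. V n) = L2 \<mu>"
proof
  show "L2 \<mu> \<subseteq> L2_closure \<mu> (\<Union>n. V n)"
  proof -
    have "L2_span kball_indicators \<subseteq> (\<Union>n. V n)"
    proof
      fix g assume "g \<in> L2_span kball_indicators"
      then obtain I and c :: "('a fls \<Rightarrow> complex) \<Rightarrow> complex"
        where I: "finite I" "I \<subseteq> kball_indicators" "g = (\<lambda>x. \<Sum>f\<in>I. c f * f x)"
        by (rule L2_spanE)
      have "\<exists>n. (\<lambda>x. \<Sum>f\<in>I. c f * f x) \<in> V n" using I(1,2)
      proof (induction I rule: finite_induct)
        case empty
        then show ?case using L2_closed_subspace_zero[OF V_subspace] by auto
      next
        case (insert f I)
        then obtain m where m: "(\<lambda>x. \<Sum>f\<in>I. c f * f x) \<in> V m" by blast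
        obtain a k where f: "f = (\<lambda>x. indicator (kball a k) x)"
          using insert.prems by (auto simp: kball_indicators_def)
        have "(\<lambda>x. c f * f x) \<in> V (k + int N)"
          unfolding f by (rule L2_closed_subspace_scale[OF V_subspace indicator_in_V])
        then have "(\<lambda>x. c f * f x) \<in> V (max m (k + int N))"
          using V_mono[of "k + int N" "max m (k + int N)"] by auto
        moreover have "(\<lambda>x. \<Sum>f\<in>I. c f * f x) \<in> V (max m (k + int N))"
          using m V_mono[of m "max m (k + int N)"] by auto
        ultimately have "(\<lambda>x. c f * f x + (\<Sum>f\<in>I. c f * f x)) \<in> V (max m (k + int N))"
          by (rule L2_closed_subspace_add[OF V_subspace])
        then show ?case using insert.hyps by auto
      qed
      then show "g \<in> (\<Union>n. V n)" using I(3) by blast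
    qed
    then show ?thesis
      using kball_indicators_dense L2_closure_mono unfolding L2_closed_span_eq by blast
  qed
qed (rule L2_closure_subset_L2)

text \<open>The support of \<open>F\<close> lies in \<open>Ksub (- int R)\<close>, which is
  annihilated by \<open>Ksub (int R)\<close>, so translation by \<open>a\<close> multiplies
  \<open>F\<close> by 1.\<close>

lemma phi_invariant:
  assumes "a \<in> kball 0 (int R)"
  shows "L2_norm \<mu> (\<lambda>x. \<phi> (x - a) - \<phi> x) = 0"
proof -
  have zero: "cnj (pair b a) * F b - F b = 0" for b
  proof (cases "F b = 0")
    case False
    then have "pair b a = 1" using pair_kball_eq_1[OF F_support[OF False]] assms by simp
    then show ?thesis by simp
  qed simp
  then have "has_ft (\<lambda>x. \<phi> (x - a) - \<phi> x) (\<lambda>_. 0)"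
    using has_ft_diff[OF has_ft_translate[OF ft_phi, of a] ft_phi] by (simp only: zero)
  from Plancherel[OF this] show ?thesis by simp
qed

text \<open>Dilation transports the invariance of \<phi>. The operator f (x - a) - f x sends the
  generators to functions of norm 0, and these form a closed subspace.\<close>

lemma V_invariant:
  assumes f: "f \<in> V n" and a: "a \<in> kball 0 (n + int R)"
  shows "L2_norm \<mu> (\<lambda>x. f (x - a) - f x) = 0"
proof -
  let ?T = "\<lambda>f x. f (x - a) - f x :: complex"
  let ?Z = "{f \<in> L2 \<mu>. L2_norm \<mu> f = 0}"
  have "?T f \<in> L2_closed_span \<mu> ?Z"
  proof (rule L2_closed_span_map[OF gens_L2, where C = 2 and T = ?T])
    show "f \<in> L2_closed_span \<mu> (gens n)" using f by (simp add: V_eq)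
    show T_L2: "?T h \<in> L2 \<mu>" if "h \<in> L2 \<mu>" for h
      by (rule L2_diff[OF L2_translate_minus(1)[OF that] that])
    show "L2_norm \<mu> (?T h) \<le> 2 * L2_norm \<mu> h" if "h \<in> L2 \<mu>" for h
      using L2_norm_triangle_diff[OF L2_translate_minus(1)[OF that, of a] L2_zero that]
        L2_translate_minus(2)[OF that, of a] L2_norm_minus_commute[of \<mu> h "\<lambda>_. 0"]
        L2_norm_minus_commute[of \<mu> "\<lambda>_. 0" h] by simp
    show "?T g \<in> ?Z" if g: "g \<in> gens n" for g
    proof -
      obtain h where h: "h \<in> H0" "g = (\<lambda>x. \<phi> (fls_shift n x - h))" using g by (auto simp: gens_def)
      let ?d = "\<lambda>x. \<phi> (x - fls_shift n a) - \<phi> x"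
      have d: "?d \<in> L2 \<mu>" by (intro L2_diff L2_translate_minus(1) phi_L2)
      have "fls_shift n a \<in> kball 0 (int R)" using a by (auto simp: kball_def)
      then have d0: "L2_norm \<mu> ?d = 0" by (rule phi_invariant)
      have "fls_shift n (x - a) - h = (fls_shift n x - h) - fls_shift n a" for x
        by (rule fls_eqI) simp
      then have eq: "?T g = (\<lambda>x. ?d (fls_shift n x - h))" unfolding h(2) by (simp only:)
      have "L2_norm \<mu> (\<lambda>x. ?d (fls_shift n x - h)) = 0"
        using L2_shift(2)[OF L2_translate_minus(1)[OF d, of h], of n]
          L2_translate_minus(2)[OF d, of h] d0 by simp
      moreover have "?T g \<in> L2 \<mu>" using T_L2 g gens_L2 by blast
      ultimately show ?thesis using eq by simp
    qed
  qed (auto simp: sum_subtractf right_diff_distrib)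
  then have "?T f \<in> L2_closure \<mu> (L2_span ?Z)" by (simp add: L2_closed_span_eq)
  moreover have "L2_span ?Z \<subseteq> ?Z"
  proof
    fix g assume "g \<in> L2_span ?Z"
    then obtain I and c :: "('a fls \<Rightarrow> complex) \<Rightarrow> complex"
      where I: "finite I" "I \<subseteq> ?Z" "g = (\<lambda>x. \<Sum>f\<in>I. c f * f x)"
      by (rule L2_spanE)
    have "(\<lambda>x. \<Sum>f\<in>I. c f * f x) \<in> ?Z" using I(1,2)
    proof (induction I rule: finite_induct)
      case (insert f I)
      then have "(\<lambda>x. c f * f x) \<in> L2 \<mu>" "L2_norm \<mu> (\<lambda>x. c f * f x) = 0"
        "(\<lambda>x. \<Sum>f\<in>I. c f * f x) \<in> L2 \<mu>" "L2_norm \<mu> (\<lambda>x. \<Sum>f\<in>I. c f * f x) = 0"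
        by (auto simp: L2_scale L2_norm_scale)
      then have "(\<lambda>x. c f * f x + (\<Sum>f\<in>I. c f * f x)) \<in> ?Z"
        using L2_norm_triangle[of "\<lambda>x. c f * f x" \<mu> "\<lambda>x. \<Sum>f\<in>I. c f * f x"]
          L2_norm_nonneg[of \<mu> "\<lambda>x. c f * f x + (\<Sum>f\<in>I. c f * f x)"]
        by (auto intro: L2_add)
      then show ?case using insert.hyps by simp
    qed simp
    then show "g \<in> ?Z" using I(3) by simp
  qed
  ultimately have "?T f \<in> L2_closure \<mu> ?Z" using L2_closure_mono by blast
  then have T: "?T f \<in> L2 \<mu>" "\<And>e. e > 0 \<Longrightarrow> \<exists>g\<in>?Z. L2_norm \<mu> (\<lambda>x. ?T f x - g x) < e"
    unfolding L2_closure_def by blast+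
  have "L2_norm \<mu> (?T f) < e" if e: "e > 0" for e
  proof -
    obtain g where g: "g \<in> ?Z" "L2_norm \<mu> (\<lambda>x. ?T f x - g x) < e" using T(2)[OF e] by blast
    have "\<bar>L2_norm \<mu> (?T f) - L2_norm \<mu> g\<bar> \<le> L2_norm \<mu> (\<lambda>x. ?T f x - g x)"
      using T(1) g(1) by (intro L2_norm_diff_ge) auto
    then show ?thesis using g by simp
  qed
  then show ?thesis using L2_norm_nonneg[of \<mu> "?T f"] by (metis less_irrefl order_le_less)
qed

text \<open>A ball about 0 and a disjoint translate of it carry the same mass of f, so the ball
  holds at most half of the total. As the balls exhaust K, this forces the norm to be 0.\<close>

lemma Inter_V_zero:
  assumes f: "\<And>n. f \<in> V n"
  shows "AE x in \<mu>. f x = 0"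
proof -
  have fL2: "f \<in> L2 \<mu>" by (rule V_L2[OF f])
  have inv: "L2_norm \<mu> (\<lambda>x. f (x - a) - f x) = 0" for a
  proof (rule V_invariant[OF f])
    show "a \<in> kball 0 (fls_subdegree a - int R + int R)" by (simp add: kball_def)
  qed
  define I where "I k = (L2_norm \<mu> (\<lambda>x. indicator (kball 0 (- int k)) x * f x))\<^sup>2" for k :: nat
  have I_le: "2 * I k \<le> (L2_norm \<mu> f)\<^sup>2" for k
  proof -
    \<comment> \<open>A single digit just below the places of the ball makes its translate by
      \<open>c\<close> disjoint from it.\<close>
    define c where "c = fmon (- int k - 1) (1 :: 'a)"
    let ?K = "kball 0 (- int k) :: 'a fls set" and ?K' = "kball c (- int k)"
    have disj: "x \<notin> ?K'" if "x \<in> ?K" for x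
      using that by (auto simp: kball_def c_def dest: spec[of _ "- int k - 1"])
    have "L2_norm \<mu> (\<lambda>x. indicator ?K' x * f x) = L2_norm \<mu> (\<lambda>x. indicator ?K x * f x)"
    proof -
      have "(\<lambda>x. indicator ?K' x * f (x - c)) = (\<lambda>x. indicator ?K (x - c) * f (x - c))"
        by (auto simp: indicator_def kball_def)
      then have "L2_norm \<mu> (\<lambda>x. indicator ?K' x * f (x - c)) = L2_norm \<mu> (\<lambda>x. indicator ?K x * f x)"
        using L2_translate_minus(2)[OF L2_mult_indicator(1)[OF fL2], of ?K c] by simp
      moreover have "\<bar>L2_norm \<mu> (\<lambda>x. indicator ?K' x * f (x - c)) - L2_norm \<mu> (\<lambda>x. indicator ?K' x * f x)\<bar> \<le>
          L2_norm \<mu> (\<lambda>x. indicator ?K' x * f (x - c) - indicator ?K' x * f x)"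
        by (intro L2_norm_diff_ge L2_mult_indicator(1) L2_translate_minus(1) fL2) auto
      moreover have "\<dots> \<le> L2_norm \<mu> (\<lambda>x. f (x - c) - f x)"
        using L2_mult_indicator(2)[OF L2_diff[OF L2_translate_minus(1)[OF fL2] fL2], of ?K' c]
        by (simp add: right_diff_distrib)
      ultimately show ?thesis using inv[of c] by simp
    qed
    then have "2 * I k = (\<integral>x. (cmod (indicator ?K x * f x))\<^sup>2 \<partial>\<mu>) + (\<integral>x. (cmod (indicator ?K' x * f x))\<^sup>2 \<partial>\<mu>)"
      by (simp add: I_def flip: L2_norm_power2)
    also have "\<dots> = (\<integral>x. (cmod (indicator ?K x * f x))\<^sup>2 + (cmod (indicator ?K' x * f x))\<^sup>2 \<partial>\<mu>)"
      by (intro Bochner_Integration.integral_add[symmetric] L2_integrable L2_mult_indicator(1) fL2) auto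
    also have "\<dots> \<le> (\<integral>x. (cmod (f x))\<^sup>2 \<partial>\<mu>)"
    proof (rule integral_mono)
      show "integrable \<mu> (\<lambda>x. (cmod (indicator ?K x * f x))\<^sup>2 + (cmod (indicator ?K' x * f x))\<^sup>2)"
        by (intro Bochner_Integration.integrable_add L2_integrable L2_mult_indicator(1) fL2) auto
      show "integrable \<mu> (\<lambda>x. (cmod (f x))\<^sup>2)" by (rule L2_integrable[OF fL2])
      show "(cmod (indicator ?K x * f x))\<^sup>2 + (cmod (indicator ?K' x * f x))\<^sup>2 \<le> (cmod (f x))\<^sup>2" for x
        using disj[of x] by (cases "x \<in> ?K"; cases "x \<in> ?K'") (auto simp: indicator_def)
    qed
    finally show ?thesis by (simp add: L2_norm_power2)
  qed
  have "L2_tendsto \<mu> (\<lambda>k x. indicator (kball 0 (- int k)) x * f x) f sequentially"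
  proof (rule L2_dominated_convergence[where w = f and C = 1])
    show "(\<lambda>x. indicator (kball 0 (- int k)) x * f x) \<in> borel_measurable \<mu>" for k
      using L2_mu_borel[OF fL2] by simp
    show "f \<in> borel_measurable \<mu>" using L2_borel[OF fL2] .
    show "cmod (indicator (kball 0 (- int k)) x * f x) \<le> 1 * cmod (f x)" for k x
      by (simp add: norm_mult split: split_indicator)
    fix x
    have "eventually (\<lambda>k. indicator (kball 0 (- int k)) x * f x = f x) sequentially"
      using eventually_ge_at_top[of "nat (- fls_subdegree x)"]
    proof eventually_elim
      case (elim k)
      then have "x \<in> kball 0 (- int k)" by (auto simp: kball_def)
      then show ?case by simp
    qed
    then show "(\<lambda>k. indicator (kball 0 (- int k)) x * f x) \<longlonglongrightarrow> f x" by (rule tendsto_eventually)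
  qed (rule fL2)
  then have "I \<longlonglongrightarrow> (L2_norm \<mu> f)\<^sup>2"
    unfolding I_def by (intro tendsto_power L2_tendsto_norm)
  then have "(\<lambda>k. 2 * I k) \<longlonglongrightarrow> 2 * (L2_norm \<mu> f)\<^sup>2" by (intro tendsto_mult_left)
  then have "2 * (L2_norm \<mu> f)\<^sup>2 \<le> (L2_norm \<mu> f)\<^sup>2"
    by (rule LIMSEQ_le_const2) (use I_le in auto)
  then have "L2_norm \<mu> f = 0" by simp
  then show ?thesis using L2_norm_eq_0_iff[OF fL2] by blast
qed

theorem generates_MRA: "generates_riesz_MRA \<mu> A B \<phi>"
proof -
  have basis: "riesz_basis \<mu> A B H0 (\<lambda>h x. \<phi> (x - h)) (V 0)"
    unfolding riesz_basis_def using riesz_system_shifts by (simp add: MRA_space_def)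
  have "(\<Inter>n. V n) = {f \<in> L2 \<mu>. AE x in \<mu>. f x = 0}"
  proof (intro equalityI subsetI)
    fix f assume "f \<in> {f \<in> L2 \<mu>. AE x in \<mu>. f x = 0}"
    then have "f \<in> V n" for n
      using L2_closed_subspace_AE[OF V_subspace L2_closed_subspace_zero[OF V_subspace], of f n]
      by (auto simp: eq_commute[of "0 :: complex"])
    then show "f \<in> (\<Inter>n. V n)" by blast
  next
    fix f assume f: "f \<in> (\<Inter>n. V n)"
    then have "AE x in \<mu>. f x = 0" by (intro Inter_V_zero) blast
    moreover have "f \<in> L2 \<mu>" using f V_L2[of f 0] by blast
    ultimately show "f \<in> {f \<in> L2 \<mu>. AE x in \<mu>. f x = 0}" by simp
  qed
  then have "riesz_MRA \<mu> V"
    unfolding riesz_MRA_def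
  proof (intro conjI allI ballI)
    show "L2_closed_subspace \<mu> (V n)" for n by (rule V_subspace)
    show "V n \<subseteq> V (n + 1)" for n by (rule V_mono_Suc)
    show "L2_closure \<mu> (\<Union>n. V n) = L2 \<mu>" by (rule closure_Union_V)
    show "f \<in> V n \<longleftrightarrow> (\<lambda>x. f (dilation 1 x)) \<in> V (n + 1)" for n f by (rule V_dilation_iff)
    show "(\<lambda>x. f (x - h)) \<in> V 0" if "f \<in> V 0" "h \<in> H0" for f h using that by (rule V_translate_0)
    show "\<exists>\<phi>\<in>L2 \<mu>. \<exists>A B. riesz_basis \<mu> A B H0 (\<lambda>h x. \<phi> (x - h)) (V 0)"
      using phi_L2 basis by (intro bexI[of _ \<phi>] exI[of _ A] exI[of _ B])
  qed
  then show ?thesis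
    unfolding generates_riesz_MRA_def using phi_L2 basis by blast
qed

end

section \<open>Paths in valid trees\<close>

lemma dpath_conv_nth:
  "dpath V E xs \<longleftrightarrow> xs \<noteq> [] \<and> set xs \<subseteq> V \<and> (\<forall>i. Suc i < length xs \<longrightarrow> (xs ! i, xs ! Suc i) \<in> E)"
  by (auto simp: dpath_def successively_conv_nth)

lemma dpath_take: "dpath V E xs \<Longrightarrow> n > 0 \<Longrightarrow> dpath V E (take n xs)"
  by (auto simp: dpath_conv_nth dest: in_set_takeD)

lemma dpath_drop: "dpath V E xs \<Longrightarrow> n < length xs \<Longrightarrow> dpath V E (drop n xs)"
  by (auto simp: dpath_conv_nth dest: in_set_dropD)

lemma dpath_append:
  assumes "dpath V E xs" "dpath V E ys" "(last xs, hd ys) \<in> E"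
  shows "dpath V E (xs @ ys)"
  using assms by (auto simp: dpath_def successively_append_iff)

locale valid_tree =
  fixes N :: nat and V :: "'v set" and E :: "('v \<times> 'v) set" and r :: 'v
    and lab :: "'v \<Rightarrow> 'a::{field,finite}"
  assumes N_pos: "N \<ge> 1" and valid: "N_valid_tree N V E r lab"
begin

definition rpath :: "'v \<Rightarrow> 'v list" where
  "rpath v = (THE xs. dpath V E xs \<and> hd xs = r \<and> last xs = v)"

abbreviation level :: "'v \<Rightarrow> nat" where
  "level \<equiv> tree_level V E r"

lemma rooted: "rooted_tree V E r" and root_V: "r \<in> V"
  using valid by (auto simp: N_valid_tree_def rooted_tree_def)

lemma rpath:
  assumes "v \<in> V"
  shows "dpath V E (rpath v)" "hd (rpath v) = r" "last (rpath v) = v" "rpath v \<noteq> []"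
proof -
  have "\<exists>!xs. dpath V E xs \<and> hd xs = r \<and> last xs = v"
    using rooted assms by (simp add: rooted_tree_def)
  from theI'[OF this] show "dpath V E (rpath v)" "hd (rpath v) = r" "last (rpath v) = v"
    unfolding rpath_def by blast+
  then show "rpath v \<noteq> []" by (simp add: dpath_def)
qed

lemma rpath_unique:
  assumes "dpath V E xs" "hd xs = r"
  shows "xs = rpath (last xs)"
proof -
  have v: "last xs \<in> V" using assms(1) by (auto simp: dpath_def)
  then have "\<exists>!xs'. dpath V E xs' \<and> hd xs' = r \<and> last xs' = last xs"
    using rooted by (simp add: rooted_tree_def)
  then show ?thesis using assms rpath[OF v] by blast
qed

lemma level_eq: "level v = length (rpath v) - 1"
  by (simp add: tree_level_def rpath_def)

lemma take_rpath:
  assumes "v \<in> V" "i < length (rpath v)"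
  shows "take (Suc i) (rpath v) = rpath (rpath v ! i)"
proof -
  have "last (take (Suc i) (rpath v)) = rpath v ! i"
    using assms by (cases "length (rpath v) = Suc i") (auto simp: last_conv_nth rpath min_def)
  moreover have "hd (take (Suc i) (rpath v)) = r" using rpath[OF assms(1)] by (simp add: hd_take)
  ultimately show ?thesis
    using rpath_unique[OF dpath_take[OF rpath(1)[OF assms(1)]], of "Suc i"] by simp
qed

lemma rpath_V: "v \<in> V \<Longrightarrow> i < length (rpath v) \<Longrightarrow> rpath v ! i \<in> V"
  using rpath(1)[of v] by (auto simp: dpath_def)

lemma level_rpath:
  assumes "v \<in> V" "i < length (rpath v)"
  shows "level (rpath v ! i) = i"
  using assms by (simp add: level_eq flip: take_rpath)

text \<open>Extending a root path along an edge gives a root path, so uniqueness of root paths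
  leaves a node with at most one parent.\<close>

lemma rpath_edge:
  assumes "(u, v) \<in> E"
  shows "rpath v = rpath u @ [v]"
proof -
  have uv: "u \<in> V" "v \<in> V" using assms rooted by (auto simp: rooted_tree_def)
  have "dpath V E (rpath u @ [v])"
    using uv rpath[OF uv(1)] assms by (intro dpath_append) (auto simp: dpath_def)
  moreover have "hd (rpath u @ [v]) = r" using rpath[OF uv(1)] by simp
  ultimately show ?thesis using rpath_unique[of "rpath u @ [v]"] by simp
qed

text \<open>Such an edge would give the root a second path from the root, besides the trivial
  one.\<close>

lemma no_edge_to_root: "(u, r) \<notin> E"
proof
  assume *: "(u, r) \<in> E"
  then have "u \<in> V" using rooted by (auto simp: rooted_tree_def)
  then have "rpath u \<noteq> []" by (rule rpath)
  moreover have "[r] = rpath r" using rpath_unique[of "[r]"] root_V by (simp add: dpath_def)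
  ultimately show False using rpath_edge[OF *] by simp
qed

lemma lab_low_level:
  assumes "v \<in> V" "level v < N"
  shows "lab v = 0"
proof -
  obtain w where w: "{u \<in> V. level u = level v} = {w}" "lab w = 0"
    using valid assms(2) unfolding N_valid_tree_def by blast
  then have "v \<in> {w}" using assms(1) by blast
  then show ?thesis using w(2) by simp
qed

lemma ex1_path: "length \<alpha> = N \<Longrightarrow> \<exists>!xs. dpath V E xs \<and> map lab xs = \<alpha>"
  using valid by (simp add: N_valid_tree_def)

lemma path_unique:
  assumes "dpath V E xs" "dpath V E ys" "map lab xs = map lab ys" "length xs = N"
  shows "xs = ys"
  using ex1_path[of "map lab xs"] assms by (metis length_map)

lemma finite_V: "finite V"
proof -
  have "{v \<in> V. level v < N} = (\<Union>j<N. {u \<in> V. level u = j})" by auto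
  also have "finite \<dots>"
  proof (rule finite_UN_I)
    fix j assume "j \<in> {..<N}"
    then obtain w where "{u \<in> V. level u = j} = {w}" using valid unfolding N_valid_tree_def by blast
    then show "finite {u \<in> V. level u = j}" by simp
  qed simp
  finally have low: "finite {v \<in> V. level v < N}" .
  let ?f = "\<lambda>v. drop (length (rpath v) - N) (rpath v)"
  have f: "dpath V E (?f v)" "length (?f v) = N" "last (?f v) = v" if "v \<in> V" "N \<le> level v" for v
  proof -
    have len: "N < length (rpath v)" using that N_pos by (simp add: level_eq)
    then show "length (?f v) = N" by simp
    show "dpath V E (?f v)" using len N_pos rpath(1)[OF that(1)] by (intro dpath_drop) auto
    show "last (?f v) = v" using len N_pos rpath(3)[OF that(1)] by (subst last_drop) auto
  qed
  have "finite {v \<in> V. N \<le> level v}"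
  proof (rule inj_on_finite)
    show "inj_on (\<lambda>v. map lab (?f v)) {v \<in> V. N \<le> level v}"
    proof (rule inj_onI)
      fix u v assume "u \<in> {v \<in> V. N \<le> level v}" "v \<in> {v \<in> V. N \<le> level v}"
        and eq: "map lab (?f u) = map lab (?f v)"
      then have uv: "u \<in> V" "N \<le> level u" "v \<in> V" "N \<le> level v" by auto
      have "?f u = ?f v" by (rule path_unique[OF f(1)[OF uv(1,2)] f(1)[OF uv(3,4)] eq f(2)[OF uv(1,2)]])
      then show "u = v" using f(3)[OF uv(1,2)] f(3)[OF uv(3,4)] by metis
    qed
    show "(\<lambda>v. map lab (?f v)) ` {v \<in> V. N \<le> level v} \<subseteq> {xs. set xs \<subseteq> UNIV \<and> length xs = N}"
      using f(2) by auto
    show "finite {xs :: 'a list. set xs \<subseteq> UNIV \<and> length xs = N}"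
      by (rule finite_lists_length_eq) simp
  qed
  with low have "finite ({v \<in> V. level v < N} \<union> {v \<in> V. N \<le> level v})" by simp
  moreover have "{v \<in> V. level v < N} \<union> {v \<in> V. N \<le> level v} = V" by auto
  ultimately show ?thesis by simp
qed

lemma level_le_height: "v \<in> V \<Longrightarrow> level v \<le> tree_height V E r"
  unfolding tree_height_def using finite_V by (intro Max_ge) auto

text \<open>In the coordinates of \<open>K\<close>, membership of the \<open>n\<close>-th dilate of \<open>c\<close> in the tree set depends on the
  window \<open>c (- 1 - n), \<dots>, c (N - 1 - n)\<close>, whose entry of smallest index is the label nearest to the root.\<close>

definition admissible :: "(int \<Rightarrow> 'a) \<Rightarrow> nat \<Rightarrow> bool" where
  "admissible c n \<longleftrightarrow> (\<forall>j\<le>N. c (int j - 1 - int n) = 0) \<or>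
     (\<exists>xs. dpath V E xs \<and> length xs = N + 1 \<and> (\<forall>j\<le>N. lab (xs ! j) = c (int j - 1 - int n)))"

text \<open>The path spelling \<open>c 0, \<dots>, c (N - 1)\<close> starts at a node of some level \<open>L\<close>; reading the labels
  towards the root determines \<open>c (- 1), c (- 2), \<dots>\<close>, which vanish beyond the root.\<close>

lemma ancestor_word:
  fixes \<alpha> :: "int \<Rightarrow> 'a"
  obtains e :: "int \<Rightarrow> 'a" and L :: nat
  where "L + N \<le> tree_height V E r + 1" "\<forall>j<int N - int L. e j = 0"
    "\<forall>i\<in>{0..<int N}. e i = \<alpha> i" "(\<forall>i\<in>{0..<int N}. \<alpha> i = 0) \<longrightarrow> L = 0"
    "\<forall>c n. (\<forall>i\<in>{- int n..<int N}. c i = e i) \<longrightarrow>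
       (admissible c n \<longleftrightarrow> c (- 1 - int n) = e (- 1 - int n))"
proof -
  define w where "w = map (\<lambda>i. \<alpha> (int i)) [0..<N]"
  obtain xs where xs: "dpath V E xs" "map lab xs = w"
    using ex1_path[of w] by (auto simp: w_def)
  have len_xs: "length xs = N" using arg_cong[OF xs(2), of length] by (simp add: w_def)
  have lab_xs: "lab (xs ! i) = \<alpha> (int i)" if "i < N" for i
    using arg_cong[OF xs(2), of "\<lambda>l. l ! i"] that len_xs by (simp add: w_def)
  have hdV: "hd xs \<in> V" using xs(1) by (auto simp: dpath_def)
  define L where "L = level (hd xs)"
  define v where "v = last xs"
  define ys where "ys = rpath v"
  have vV: "v \<in> V" using xs(1) by (auto simp: v_def dpath_def)
  have xs_Cons: "xs = hd xs # tl xs" using len_xs N_pos by (cases xs) auto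
  have ys_eq: "ys = rpath (hd xs) @ tl xs"
  proof -
    have d: "dpath V E (rpath (hd xs) @ tl xs)"
    proof (cases "tl xs = []")
      case True
      then show ?thesis using rpath(1)[OF hdV] by simp
    next
      case False
      have "successively (\<lambda>u v. (u, v) \<in> E) (hd xs # tl xs)"
        using xs(1) xs_Cons by (simp add: dpath_def)
      then have "(hd xs, hd (tl xs)) \<in> E" "successively (\<lambda>u v. (u, v) \<in> E) (tl xs)"
        using False by (auto simp: successively_Cons)
      moreover have "set (tl xs) \<subseteq> V" using xs(1) by (auto simp: dpath_def dest: list.set_sel(2)[rotated])
      ultimately show ?thesis
        using rpath[OF hdV] False by (intro dpath_append) (auto simp: dpath_def)
    qed
    have "hd (rpath (hd xs) @ tl xs) = r" using rpath[OF hdV] by simp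
    moreover have "last (rpath (hd xs) @ tl xs) = v"
    proof (cases "tl xs = []")
      case True
      then have "v = hd xs" using xs_Cons unfolding v_def by (metis last_ConsL)
      then show ?thesis using rpath(3)[OF hdV] True by simp
    next
      case False
      then show ?thesis using xs_Cons unfolding v_def by (metis last_ConsR last_appendR)
    qed
    ultimately show ?thesis using rpath_unique[OF d] by (simp add: ys_def)
  qed
  have len_hd: "length (rpath (hd xs)) = Suc L"
    using rpath(4)[OF hdV] by (simp add: L_def level_eq)
  have len_ys: "length ys = L + N"
    using ys_eq len_hd len_xs N_pos by simp
  have drop_ys: "drop L ys = xs"
  proof -
    have "drop L (rpath (hd xs)) = [hd xs]"
      using rpath(3,4)[OF hdV] len_hd
      by (metis append_butlast_last_id append_eq_conv_conj diff_Suc_1 length_butlast)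
    then show ?thesis using ys_eq len_hd xs_Cons by simp
  qed
  have ys_path: "dpath V E ys" unfolding ys_def by (rule rpath(1)[OF vV])
  have ys0: "ys ! 0 = r"
    using rpath(2,4)[OF vV] by (simp add: ys_def hd_conv_nth)
  have ys_V: "ys ! i \<in> V" "level (ys ! i) = i" if "i < L + N" for i
    using rpath_V[OF vV] level_rpath[OF vV] that len_ys by (simp_all add: ys_def)
  have ys_low: "lab (ys ! i) = 0" if "i < N" for i
    using lab_low_level ys_V[of i] that by simp
  \<comment> \<open>The root sits at index - L and the end of the path at N - 1, so the given word
    occupies 0, ..., N - 1; to the left of the root the sequence continues with zeros.\<close>
  define e where "e j = (if - int L \<le> j then lab (ys ! nat (j + int L)) else 0)" for j
  have e_nth: "e (int i - int L) = lab (ys ! i)" for i by (simp add: e_def)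
  have e_zero: "e j = 0" if "j < int N - int L" for j
    using that ys_low[of "nat (j + int L)"] by (auto simp: e_def)
  have e_\<alpha>: "e i = \<alpha> i" if "0 \<le> i" "i < int N" for i
  proof -
    have "ys ! (L + nat i) = drop L ys ! nat i" using len_ys by simp
    then have "ys ! (L + nat i) = xs ! nat i" by (simp add: drop_ys)
    moreover have "nat (i + int L) = L + nat i" using that by simp
    ultimately show ?thesis using lab_xs[of "nat i"] that by (simp add: e_def)
  qed
  have seg_path: "dpath V E (take m (drop k ys))" if "k < L + N" "m > 0" for k m
    using dpath_take[OF dpath_drop[OF ys_path]] that len_ys by simp
  \<comment> \<open>Positions on a root path are levels, hence a segment equal to the initial one
    starts at the root.\<close>
  have root_seg: "take N ys = take N (drop k ys) \<Longrightarrow> k = 0" if "k < L + N" for k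
  proof -
    assume "take N ys = take N (drop k ys)"
    then have "take N ys ! 0 = take N (drop k ys) ! 0" by simp
    then have "ys ! 0 = ys ! k" using that len_ys N_pos by simp
    then have "level (ys ! 0) = level (ys ! k)" by simp
    then show "k = 0" using ys_V(2)[of 0] ys_V(2)[OF that] that N_pos by simp
  qed
  \<comment> \<open>The first N levels carry the label 0, so uniqueness makes the initial segment
    the only path spelling N zeros.\<close>
  have zero_path: "zs = take N ys" if "dpath V E zs" "length zs = N" "\<And>i. i < N \<Longrightarrow> lab (zs ! i) = 0" for zs
  proof (rule path_unique[OF that(1)])
    show "dpath V E (take N ys)" using dpath_take[OF ys_path] N_pos by simp
    show "map lab zs = map lab (take N ys)"
      using that len_ys ys_low by (intro nth_equalityI) auto
  qed (rule that(2))
  have L0: "L = 0" if "\<forall>i\<in>{0..<int N}. \<alpha> i = 0"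
  proof (rule root_seg)
    have "xs = take N ys" using xs(1) len_xs lab_xs that by (intro zero_path) auto
    then show "take N ys = take N (drop L ys)" using drop_ys len_xs by simp
  qed (use N_pos in simp)
  \<comment> \<open>For n < L the last N known digits spell a segment of the root path that starts
    below the root; otherwise they are N zeros and the root has been reached.\<close>
  have step: "admissible c n \<longleftrightarrow> c (- 1 - int n) = e (- 1 - int n)"
    if c: "\<And>i. - int n \<le> i \<Longrightarrow> i < int N \<Longrightarrow> c i = e i" for c n
  proof (cases "n < L")
    case True
    \<comment> \<open>The position of the node whose label is the digit at - n; its parent carries
      the digit at - 1 - n.\<close>
    define k where "k = L - n"
    have k: "0 < k" "k \<le> L" "int k = int L - int n" using True by (auto simp: k_def)
    have c_seg: "c (int i - int n) = lab (ys ! (k + i))" if "i < N" for i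
    proof -
      have "c (int i - int n) = e (int (k + i) - int L)"
        using c[of "int i - int n"] that k(3) by simp
      then show ?thesis using e_nth[of "k + i"] by simp
    qed
    have e1: "e (- 1 - int n) = lab (ys ! (k - 1))"
      using e_nth[of "k - 1"] k by (simp add: of_nat_diff algebra_simps)
    show ?thesis
    proof
      assume "admissible c n"
      then consider "\<forall>j\<le>N. c (int j - 1 - int n) = 0"
        | zs where "dpath V E zs" "length zs = N + 1" "\<forall>j\<le>N. lab (zs ! j) = c (int j - 1 - int n)"
        unfolding admissible_def by blast
      then show "c (- 1 - int n) = e (- 1 - int n)"
      proof cases
        case 1
        \<comment> \<open>The alternative of N + 1 zeros is impossible here: it would identify this
          segment with the one at the root, although k > 0.\<close>
        have "take N (drop k ys) = take N ys"
        proof (rule zero_path)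
          show "dpath V E (take N (drop k ys))" using k N_pos by (intro seg_path) auto
          show "length (take N (drop k ys)) = N" using len_ys k by simp
          fix i assume i: "i < N"
          have "c (int (Suc i) - 1 - int n) = 0" using 1 i by (metis Suc_leI)
          then show "lab (take N (drop k ys) ! i) = 0"
            using c_seg[OF i] i len_ys k by simp
        qed
        then show ?thesis using root_seg[of k] k N_pos by simp
      next
        case (2 zs)
        \<comment> \<open>The tail of \<open>zs\<close> spells the known digits and so is this
          segment; the first node of \<open>zs\<close> must then be the unique parent of its
          head.\<close>
        have "tl zs = take N (drop k ys)"
        proof (rule path_unique)
          have "tl zs = drop 1 zs" by (simp add: drop_Suc)
          then show "dpath V E (tl zs)" using dpath_drop[OF 2(1), of 1] 2(2) N_pos by simp
          show "dpath V E (take N (drop k ys))" using k N_pos by (intro seg_path) auto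
          show "map lab (tl zs) = map lab (take N (drop k ys))"
          proof (rule nth_equalityI)
            fix i assume "i < length (map lab (tl zs))"
            then have i: "i < N" using 2(2) by simp
            have "lab (zs ! Suc i) = c (int (Suc i) - 1 - int n)" using 2(3) i by (metis Suc_leI)
            then show "map lab (tl zs) ! i = map lab (take N (drop k ys)) ! i"
              using c_seg[OF i] i len_ys k 2(2) by (simp add: nth_tl)
          qed (use 2(2) len_ys k in simp)
          show "length (tl zs) = N" using 2(2) by simp
        qed
        then have "tl zs ! 0 = take N (drop k ys) ! 0" by simp
        then have "zs ! 1 = ys ! k" using 2(2) N_pos k len_ys by (simp add: nth_tl)
        then have "(zs ! 0, ys ! k) \<in> E" using 2(1,2) N_pos by (auto simp: dpath_conv_nth)
        then have "rpath (ys ! k) = rpath (zs ! 0) @ [ys ! k]" by (rule rpath_edge)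
        moreover have "rpath (ys ! k) = take (Suc k) ys"
          using take_rpath[OF vV, of k] len_ys k N_pos by (simp add: ys_def)
        moreover have "(ys ! (k - 1), ys ! k) \<in> E"
          using ys_path k len_ys N_pos by (auto simp: dpath_conv_nth dest!: spec[of _ "k - 1"])
        ultimately have "rpath (zs ! 0) = rpath (ys ! (k - 1))"
          using rpath_edge[of "ys ! (k - 1)" "ys ! k"] by simp
        moreover have "zs ! 0 \<in> V" "ys ! (k - 1) \<in> V"
          using 2(1,2) ys_V(1)[of "k - 1"] k by (auto simp: dpath_def)
        ultimately have "zs ! 0 = ys ! (k - 1)" using rpath(3) by metis
        then show ?thesis using 2(3)[rule_format, of 0] e1 by simp
      qed
    next
      assume *: "c (- 1 - int n) = e (- 1 - int n)"
      let ?zs = "take (N + 1) (drop (k - 1) ys)"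
      have "lab (?zs ! j) = c (int j - 1 - int n)" if "j \<le> N" for j
      proof (cases j)
        case 0
        then show ?thesis using * e1 len_ys k by simp
      next
        case (Suc i)
        then have "i < N" using that by simp
        then show ?thesis using c_seg[of i] Suc len_ys k by simp
      qed
      moreover have "dpath V E ?zs" using k by (intro seg_path) auto
      moreover have "length ?zs = N + 1" using len_ys k by simp
      ultimately show "admissible c n" unfolding admissible_def by blast
    qed
  next
    case False
    have c0: "c (int i - int n) = 0" if "i < N" for i
      using c[of "int i - int n"] e_zero[of "int i - int n"] that False by simp
    have e0: "e (- 1 - int n) = 0" using e_zero[of "- 1 - int n"] False by simp
    show ?thesis
    proof
      assume "admissible c n"
      then consider "\<forall>j\<le>N. c (int j - 1 - int n) = 0"
        | zs where "dpath V E zs" "length zs = N + 1" "\<forall>j\<le>N. lab (zs ! j) = c (int j - 1 - int n)"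
        unfolding admissible_def by blast
      then show "c (- 1 - int n) = e (- 1 - int n)"
      proof cases
        case 1
        then show ?thesis using e0 by (auto dest: spec[of _ 0])
      next
        case (2 zs)
        \<comment> \<open>A path spelling the window would need an edge into the root, which leaves
          only the alternative of N + 1 zeros.\<close>
        have "tl zs = take N ys"
        proof (rule zero_path)
          have "tl zs = drop 1 zs" by (simp add: drop_Suc)
          then show "dpath V E (tl zs)" using dpath_drop[OF 2(1), of 1] 2(2) N_pos by simp
          show "length (tl zs) = N" using 2(2) by simp
          fix i assume i: "i < N"
          have "lab (zs ! Suc i) = c (int (Suc i) - 1 - int n)" using 2(3) i by (metis Suc_leI)
          then show "lab (tl zs ! i) = 0" using c0[OF i] 2(2) i by (simp add: nth_tl)
        qed
        then have "tl zs ! 0 = take N ys ! 0" by simp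
        then have "zs ! 1 = r" using 2(2) N_pos len_ys ys0 by (simp add: nth_tl)
        moreover have "(zs ! 0, zs ! 1) \<in> E" using 2(1,2) N_pos by (auto simp: dpath_conv_nth)
        ultimately show ?thesis using no_edge_to_root by simp
      qed
    next
      assume *: "c (- 1 - int n) = e (- 1 - int n)"
      have "c (int j - 1 - int n) = 0" if "j \<le> N" for j
      proof (cases j)
        case 0
        then show ?thesis using * e0 by simp
      next
        case (Suc i)
        then show ?thesis using c0[of i] that by simp
      qed
      then show "admissible c n" unfolding admissible_def by blast
    qed
  qed
  have "level v = L + N - 1" by (simp add: level_eq len_ys flip: ys_def)
  then have "L + N \<le> tree_height V E r + 1" using level_le_height[OF vV] by simp
  then show thesis
    by (rule that[where e = e and L = L]) (use e_zero e_\<alpha> L0 step in auto)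
qed

text \<open>Each n settles one further digit, the one to the left of the digits at - n, ..., N - 1
  that are known by then.\<close>

lemma all_admissible_iff:
  assumes step: "\<And>c n. (\<And>i. - int n \<le> i \<Longrightarrow> i < int N \<Longrightarrow> c i = e i) \<Longrightarrow>
       admissible c n \<longleftrightarrow> c (- 1 - int n) = e (- 1 - int n)"
    and init: "\<And>i. 0 \<le> i \<Longrightarrow> i < int N \<Longrightarrow> c i = e i"
  shows "(\<forall>n. admissible c n) \<longleftrightarrow> (\<forall>j<int N. c j = e j)"
proof
  assume adm: "\<forall>n. admissible c n"
  have "\<forall>i. - int n \<le> i \<longrightarrow> i < int N \<longrightarrow> c i = e i" for n
  proof (induction n)
    case 0
    then show ?case using init by simp
  next
    case (Suc n)
    then have "c (- 1 - int n) = e (- 1 - int n)" using step[of n c] adm by blast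
    show ?case
    proof (intro allI impI)
      fix i assume i: "- int (Suc n) \<le> i" "i < int N"
      show "c i = e i"
      proof (cases "i = - 1 - int n")
        case False
        then have "- int n \<le> i" using i(1) by simp
        then show ?thesis using Suc i(2) by blast
      qed (use \<open>c (- 1 - int n) = e (- 1 - int n)\<close> in simp)
    qed
  qed
  then have near: "c i = e i" if "- int n \<le> i" "i < int N" for n i using that by blast
  show "\<forall>j<int N. c j = e j"
  proof (intro allI impI)
    fix j assume "j < int N"
    then show "c j = e j" using near[of "nat (- j)" j] by simp
  qed
next
  assume "\<forall>j<int N. c j = e j"
  then show "\<forall>n. admissible c n" using step N_pos by simp
qed

end

section \<open>The mask and its infinite product\<close>

context local_field
begin

lemma Theta_0: "Theta 0 = 1"
  by (rule character_eqI) (simp add: one_character.rep_eq)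

lemma Theta_sum: "Theta (\<Sum>i\<in>I. f i) = (\<Prod>i\<in>I. Theta (f i))"
  by (induction I rule: infinite_finite_induct) (simp_all add: Theta_0 Theta_add)

lemma prod_rademacher:
  "(\<Prod>i\<in>I. rademacher p s coord (k i) (u i)) = Theta (\<Sum>i\<in>I. fmon (- 1 - k i) (u i))"
  by (simp add: Theta_sum rademacher_eq_Theta)

lemma Theta_in_coset_iff:
  "Theta b \<in> (\<lambda>\<xi>. \<xi> * Theta c) ` annihilator (Ksub n) \<longleftrightarrow> b - c \<in> kball 0 (- n)"
proof
  assume "Theta b \<in> (\<lambda>\<xi>. \<xi> * Theta c) ` annihilator (Ksub n)"
  then obtain \<xi> where \<xi>: "\<xi> \<in> annihilator (Ksub n)" "Theta b = \<xi> * Theta c" by blast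
  have "Theta b = Theta (Theta_inv \<xi> + c)" using \<xi>(2) by (simp add: Theta_add)
  then have "b = Theta_inv \<xi> + c" using inj_Theta by (simp add: inj_eq)
  moreover have "Theta_inv \<xi> \<in> kball 0 (- n)" using \<xi>(1) annihilator_Ksub[of "Theta_inv \<xi>" n] by simp
  ultimately show "b - c \<in> kball 0 (- n)" by simp
next
  assume "b - c \<in> kball 0 (- n)"
  then have "Theta (b - c) \<in> annihilator (Ksub n)" by (simp add: annihilator_Ksub)
  moreover have "Theta b = Theta (b - c) * Theta c" by (simp flip: Theta_add)
  ultimately show "Theta b \<in> (\<lambda>\<xi>. \<xi> * Theta c) ` annihilator (Ksub n)" by blast
qed

end

locale tree_mask = local_field \<mu> p s coord + valid_tree N V E r lab
  for \<mu> :: "'a::{field,finite} fls measure" and p s coord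
    and N and V :: "'v set" and E r and lab :: "'v \<Rightarrow> 'a" +
  fixes H :: nat and A B :: real and m0 :: "'a fls character \<Rightarrow> complex"
  assumes H: "H = tree_height V E r"
    and A_pos: "0 < A" and A_le_B: "A \<le> B"
    and m0_measurable: "m0 \<in> borel_measurable borel"
    and m0_one: "\<forall>\<xi> \<in> annihilator (Ksub (- int N)). m0 \<xi> = 1"
    and m0_nonzero: "\<forall>\<xi> \<in> annihilator (Ksub 1). m0 \<xi> \<noteq> 0 \<longleftrightarrow> \<xi> \<in> tree_set p s coord N V E lab"
    and m0_bounds: "\<forall>\<xi> \<in> tree_set p s coord N V E lab. A \<le> (cmod (m0 \<xi>))\<^sup>2 \<and> (cmod (m0 \<xi>))\<^sup>2 \<le> B"
    and m0_periodic: "\<forall>(n::nat) (\<alpha> :: nat \<Rightarrow> 'a) \<xi>.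
          m0 (\<xi> * (\<Prod>j=1..n. rademacher p s coord (int j) (\<alpha> j))) = m0 \<xi>"
begin

definition m :: "'a fls \<Rightarrow> complex" where
  "m b = m0 (Theta b)"

definition F :: "'a fls \<Rightarrow> complex" where
  "F b = (\<Prod>n. m (fls_shift (- int n) b))"

lemma F_eq_product: "(\<Prod>n. m0 (char_dilation (- int n) (Theta b))) = F b"
  by (simp add: F_def m_def char_dilation_Theta)

lemma m_borel [measurable]: "m \<in> borel_measurable borel"
  unfolding m_def using m0_measurable Theta_measurable by (rule measurable_compose[rotated])

lemma m_eq_1: "b \<in> kball 0 (int N) \<Longrightarrow> m b = 1"
  using m0_one annihilator_Ksub[of b "- int N"] by (simp add: m_def)

text \<open>The j-th factor of a period is a digit at place - 1 - j with j >= 1. The periods are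
  therefore supported at places <= -2, one place short of H0.\<close>

lemma m_periodic:
  assumes h: "\<And>k. k \<ge> - 1 \<Longrightarrow> h $$ k = 0"
  shows "m (b + h) = m b"
proof -
  define n where "n = nat (- fls_subdegree h)"
  have "h = (\<Sum>j=1..n. fmon (- 1 - int j) (h $$ (- 1 - int j)))"
  proof (rule fls_eqI)
    fix k
    have "(\<Sum>j=1..n. fmon (- 1 - int j) (h $$ (- 1 - int j))) $$ k =
        (\<Sum>j=1..n. if j = nat (- 1 - k) \<and> k < 0 then h $$ k else 0)"
      unfolding fls_nth_sum fmon_nth by (rule sum.cong) auto
    also have "\<dots> = h $$ k"
    proof (cases "nat (- 1 - k) \<in> {1..n} \<and> k < 0")
      case True
      then show ?thesis by (simp add: sum.delta)
    next
      case False
      then have "k \<ge> - 1 \<or> k < fls_subdegree h" by (auto simp: n_def)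
      then have "h $$ k = 0" using h by auto
      then show ?thesis by (intro trans[OF sum.neutral]) auto
    qed
    finally show "h $$ k = (\<Sum>j=1..n. fmon (- 1 - int j) (h $$ (- 1 - int j))) $$ k" ..
  qed
  then have "Theta h = Theta (\<Sum>j=1..n. fmon (- 1 - int j) (h $$ (- 1 - int j)))"
    by (rule arg_cong)
  then have "Theta h = (\<Prod>j=1..n. rademacher p s coord (int j) (h $$ (- 1 - int j)))"
    unfolding prod_rademacher .
  then show ?thesis
    using m0_periodic[THEN spec[of _ n], THEN spec[of _ "\<lambda>j. h $$ (- 1 - int j)"], THEN spec[of _ "Theta b"]] by (simp add: m_def Theta_add)
qed

text \<open>The factor of index - j sits at place j - 1, so a coset of the tree set prescribes the
  digits at -1, ..., N - 1, and the digits below -1 vanish by assumption.\<close>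

lemma Theta_in_tree_set_iff:
  assumes b: "b \<in> kball 0 (- 1)"
  shows "Theta b \<in> tree_set p s coord N V E lab \<longleftrightarrow> admissible (fls_nth b) 0"
proof -
  have "b \<in> kball 0 (int N) \<longleftrightarrow> (\<forall>j\<le>N. b $$ (int j - 1) = 0)"
  proof
    assume *: "\<forall>j\<le>N. b $$ (int j - 1) = 0"
    show "b \<in> kball 0 (int N)" unfolding kball_def
    proof (intro CollectI allI impI)
      fix j assume j: "j < int N"
      show "b $$ j = 0 $$ j"
      proof (cases "j < - 1")
        case True
        then show ?thesis using b by (simp add: kball_def)
      next
        case False
        then show ?thesis using *[rule_format, of "nat (j + 1)"] j by simp
      qed
    qed
  qed (auto simp: kball_def)
  moreover have "Theta b \<in> (\<lambda>\<xi>. \<xi> * (\<Prod>j\<le>N. rademacher p s coord (- int j) (lab (xs ! j)))) `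
      annihilator (Ksub (- int N)) \<longleftrightarrow> (\<forall>j\<le>N. lab (xs ! j) = b $$ (int j - 1))" for xs
  proof -
    define c where "c = (\<Sum>j\<le>N. fmon (- 1 - (- int j)) (lab (xs ! j)))"
    have c: "c $$ (int i - 1) = lab (xs ! i)" if "i \<le> N" for i
    proof -
      have "c $$ (int i - 1) = (\<Sum>j\<le>N. if j = i then lab (xs ! i) else 0)"
        unfolding c_def fls_nth_sum fmon_nth by (rule sum.cong) auto
      then show ?thesis using that by simp
    qed
    have c0: "c $$ k = 0" if "k < - 1" for k
      unfolding c_def fls_nth_sum fmon_nth using that by (intro sum.neutral) auto
    have "Theta b \<in> (\<lambda>\<xi>. \<xi> * (\<Prod>j\<le>N. rademacher p s coord (- int j) (lab (xs ! j)))) `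
      annihilator (Ksub (- int N)) \<longleftrightarrow> b - c \<in> kball 0 (int N)"
      unfolding prod_rademacher c_def[symmetric] Theta_in_coset_iff by simp
    also have "\<dots> \<longleftrightarrow> (\<forall>j\<le>N. lab (xs ! j) = b $$ (int j - 1))"
    proof
      assume *: "b - c \<in> kball 0 (int N)"
      have "b $$ (int j - 1) = c $$ (int j - 1)" if "j \<le> N" for j
        using * that by (auto simp: kball_def)
      then show "\<forall>j\<le>N. lab (xs ! j) = b $$ (int j - 1)" using c by simp
    next
      assume *: "\<forall>j\<le>N. lab (xs ! j) = b $$ (int j - 1)"
      have "b $$ k = c $$ k" if "k < int N" for k
      proof (cases "k < - 1")
        case True
        then show ?thesis using b c0 by (simp add: kball_def)
      next
        case False
        then show ?thesis using *[rule_format, of "nat (k + 1)"] c[of "nat (k + 1)"] that by simp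
      qed
      then show "b - c \<in> kball 0 (int N)" by (simp add: kball_def)
    qed
    finally show ?thesis .
  qed
  ultimately show ?thesis
    unfolding tree_set_def admissible_def using annihilator_Ksub[of b "- int N"] by auto
qed

text \<open>\<open>m0_nonzero\<close> speaks of the annihilator of \<open>Ksub 1\<close> only.
  Periodicity removes the digits below place -1, which moves any \<open>b\<close> into that set
  without touching the window.\<close>

lemma m_nonzero_iff: "m b \<noteq> 0 \<longleftrightarrow> admissible (fls_nth b) 0"
  and m_bounds: "m b \<noteq> 0 \<Longrightarrow> A \<le> (cmod (m b))\<^sup>2 \<and> (cmod (m b))\<^sup>2 \<le> B"
proof -
  define h where "h = fls_trunc (- 1) b"
  define b' where "b' = b - h"
  have mb: "m b = m b'"
    using m_periodic[of h b'] by (simp add: b'_def h_def)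
  have b': "b' \<in> kball 0 (- 1)" by (auto simp: kball_def b'_def h_def)
  have adm: "admissible (fls_nth b') 0 \<longleftrightarrow> admissible (fls_nth b) 0"
    unfolding admissible_def by (simp add: b'_def h_def)
  have m0: "m b = m0 (Theta b')" unfolding mb by (rule m_def)
  have tree: "Theta b' \<in> tree_set p s coord N V E lab \<longleftrightarrow> m b \<noteq> 0"
    using m0_nonzero annihilator_Ksub[of b' 1] b' by (simp add: m0)
  then show "m b \<noteq> 0 \<longleftrightarrow> admissible (fls_nth b) 0"
    using Theta_in_tree_set_iff[OF b'] adm by blast
  show "A \<le> (cmod (m b))\<^sup>2 \<and> (cmod (m b))\<^sup>2 \<le> B" if "m b \<noteq> 0"
    using m0_bounds tree that by (simp add: m0)
qed

lemma A_le_1: "A \<le> 1" and one_le_B: "1 \<le> B"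
  using m_bounds[of 0] m_eq_1[of 0] by simp_all

lemma m_shift_nonzero_iff: "m (fls_shift (- int n) b) \<noteq> 0 \<longleftrightarrow> admissible (fls_nth b) n"
  unfolding m_nonzero_iff admissible_def by simp

lemma m_shift_eq_1:
  assumes "\<And>j. j < int N - int n \<Longrightarrow> b $$ j = 0"
  shows "m (fls_shift (- int n) b) = 1"
  using assms by (intro m_eq_1) (simp add: kball_def)

text \<open>After L or more dilations the vanishing digits fill all places below N, and there the
  mask is 1.\<close>

lemma F_prod:
  assumes "\<And>j. j < int N - int L \<Longrightarrow> b $$ j = 0"
  shows "F b = (\<Prod>n<L. m (fls_shift (- int n) b))"
  unfolding F_def
proof (rule prodinf_finite)
  fix n assume "n \<notin> {..<L}"
  then show "m (fls_shift (- int n) b) = 1" using assms by (intro m_shift_eq_1) simp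
qed simp

lemma F_prod_large:
  assumes "L \<ge> nat (int N - fls_subdegree b)"
  shows "F b = (\<Prod>n<L. m (fls_shift (- int n) b))"
  using assms by (intro F_prod fls_eq0_below_subdegree) simp

lemma F_nonzero_iff: "F b \<noteq> 0 \<longleftrightarrow> (\<forall>n. admissible (fls_nth b) n)"
proof -
  define L where "L = nat (int N - fls_subdegree b)"
  have "m (fls_shift (- int n) b) = 1" if "n \<ge> L" for n
    using that by (intro m_shift_eq_1 fls_eq0_below_subdegree) (simp add: L_def)
  then have "(\<forall>n<L. m (fls_shift (- int n) b) \<noteq> 0) \<longleftrightarrow> (\<forall>n. m (fls_shift (- int n) b) \<noteq> 0)"
    by (metis not_le zero_neq_one)
  then show ?thesis
    using F_prod_large[of b L] by (auto simp: L_def m_shift_nonzero_iff)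
qed

lemma F_refinement: "F (fls_shift 1 b) = m (fls_shift 1 b) * F b"
proof -
  \<comment> \<open>Large enough for both products, which then differ by a single factor.\<close>
  define L where "L = nat (int N - fls_subdegree b) + nat (int N - fls_subdegree (fls_shift 1 b))"
  have "F (fls_shift 1 b) = (\<Prod>n<Suc L. m (fls_shift (- int n) (fls_shift 1 b)))"
    by (rule F_prod_large) (simp add: L_def)
  also have "\<dots> = m (fls_shift 1 b) * (\<Prod>n<L. m (fls_shift (- int (Suc n)) (fls_shift 1 b)))"
    by (subst prod.lessThan_Suc_shift) simp
  also have "(\<Prod>n<L. m (fls_shift (- int (Suc n)) (fls_shift 1 b))) = F b"
    by (subst F_prod_large[of b L]) (simp_all add: L_def)
  finally show ?thesis .
qed

lemma F_borel: "F \<in> borel_measurable borel"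
proof (rule borel_measurable_LIMSEQ_metric)
  show "(\<lambda>b. \<Prod>n<L. m (fls_shift (- int n) b)) \<in> borel_measurable borel" for L
    by measurable
  show "(\<lambda>L. \<Prod>n<L. m (fls_shift (- int n) b)) \<longlonglongrightarrow> F b" for b
  proof (rule tendsto_eventually)
    show "\<forall>\<^sub>F L in sequentially. (\<Prod>n<L. m (fls_shift (- int n) b)) = F b"
      using eventually_ge_at_top[of "nat (int N - fls_subdegree b)"]
      by eventually_elim (rule F_prod_large[symmetric])
  qed
qed

text \<open>\<open>ancestor_word\<close> in terms of \<open>F\<close>: once the digits at 0, ..., N
  - 1 are given, a single choice of the negative digits makes \<open>F\<close> nonzero, whatever the
  digits from N on.\<close>

lemma F_structure:
  fixes \<alpha> :: "int \<Rightarrow> 'a"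
  obtains e :: "int \<Rightarrow> 'a"
  where "\<forall>j < - int (H + 1). e j = 0"
    "(\<forall>i\<in>{0..<int N}. \<alpha> i = 0) \<longrightarrow> (\<forall>j<int N. e j = 0)"
    "\<forall>b. (\<forall>i\<in>{0..<int N}. b $$ i = \<alpha> i) \<longrightarrow> (F b \<noteq> 0 \<longleftrightarrow> (\<forall>j<0. b $$ j = e j))"
    "\<forall>b. (\<forall>i\<in>{0..<int N}. b $$ i = \<alpha> i) \<longrightarrow> F b \<noteq> 0 \<longrightarrow>
       A ^ (H - N + 2) \<le> (cmod (F b))\<^sup>2 \<and> (cmod (F b))\<^sup>2 \<le> B ^ (H - N + 2)"
proof -
  obtain e :: "int \<Rightarrow> 'a" and L :: nat where e:
    "L + N \<le> H + 1" "\<forall>j<int N - int L. e j = 0"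
    "\<forall>i\<in>{0..<int N}. e i = \<alpha> i" "(\<forall>i\<in>{0..<int N}. \<alpha> i = 0) \<longrightarrow> L = 0"
    "\<forall>c n. (\<forall>i\<in>{- int n..<int N}. c i = e i) \<longrightarrow>
       (admissible c n \<longleftrightarrow> c (- 1 - int n) = e (- 1 - int n))"
    by (rule ancestor_word[of \<alpha>, folded H])
  have iff: "F b \<noteq> 0 \<longleftrightarrow> (\<forall>j<int N. b $$ j = e j)"
    if "\<And>i. 0 \<le> i \<Longrightarrow> i < int N \<Longrightarrow> b $$ i = \<alpha> i" for b
    unfolding F_nonzero_iff using that e(3,5) by (intro all_admissible_iff) auto
  have sub: "F b \<noteq> 0 \<longleftrightarrow> (\<forall>j<0. b $$ j = e j)" if b: "\<forall>i\<in>{0..<int N}. b $$ i = \<alpha> i" for b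
  proof -
    have "(\<forall>j<int N. b $$ j = e j) \<longleftrightarrow> (\<forall>j<0. b $$ j = e j)"
    proof
      assume neg: "\<forall>j<0. b $$ j = e j"
      show "\<forall>j<int N. b $$ j = e j"
      proof (intro allI impI)
        fix j assume "j < int N"
        then show "b $$ j = e j" using neg b e(3) by (cases "j < 0") auto
      qed
    qed simp
    then show ?thesis using iff[of b] b by simp
  qed
  have bounds: "A ^ (H - N + 2) \<le> (cmod (F b))\<^sup>2 \<and> (cmod (F b))\<^sup>2 \<le> B ^ (H - N + 2)"
    if b: "\<forall>i\<in>{0..<int N}. b $$ i = \<alpha> i" and nz: "F b \<noteq> 0" for b
  proof -
    have be: "\<forall>j<int N. b $$ j = e j" using iff[of b] b nz by simp
    have F: "F b = (\<Prod>n<L. m (fls_shift (- int n) b))"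
    proof (rule F_prod)
      show "b $$ j = 0" if "j < int N - int L" for j
        using be e(2) that by simp
    qed
    have bd: "A \<le> (cmod (m (fls_shift (- int n) b)))\<^sup>2" "(cmod (m (fls_shift (- int n) b)))\<^sup>2 \<le> B" for n
      using m_bounds nz m_shift_nonzero_iff[of n b] F_nonzero_iff[of b] by blast+
    have sq: "(cmod (F b))\<^sup>2 = (\<Prod>n<L. (cmod (m (fls_shift (- int n) b)))\<^sup>2)"
      by (simp add: F prod_norm[symmetric] prod_power_distrib)
    have L: "L \<le> H - N + 2" using e(1) by simp
    have "A ^ (H - N + 2) \<le> A ^ L" using A_pos A_le_1 L by (intro power_decreasing) auto
    also have "\<dots> = (\<Prod>n<L. A)" by simp
    also have "\<dots> \<le> (cmod (F b))\<^sup>2" unfolding sq using A_pos bd by (intro prod_mono) auto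
    finally have lo: "A ^ (H - N + 2) \<le> (cmod (F b))\<^sup>2" .
    have "(cmod (F b))\<^sup>2 \<le> (\<Prod>n<L. B)" unfolding sq using bd by (intro prod_mono) auto
    also have "\<dots> = B ^ L" by simp
    also have "\<dots> \<le> B ^ (H - N + 2)" using one_le_B L by (intro power_increasing) auto
    finally show ?thesis using lo by simp
  qed
  show thesis
  proof (rule that[of e])
    \<comment> \<open>Here N - L >= 2 N - H - 1 >= - (H + 1).\<close>
    show "\<forall>j < - int (H + 1). e j = 0" using e(1,2) by simp
    show "(\<forall>i\<in>{0..<int N}. \<alpha> i = 0) \<longrightarrow> (\<forall>j<int N. e j = 0)" using e(2,4) by simp
  qed (use sub bounds in blast)+
qed

lemma F_support: "F b \<noteq> 0 \<Longrightarrow> b \<in> kball 0 (- int (H + 1))"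
proof -
  assume nz: "F b \<noteq> 0"
  obtain e :: "int \<Rightarrow> 'a" where e: "\<forall>j < - int (H + 1). e j = 0"
    "(\<forall>i\<in>{0..<int N}. b $$ i = 0) \<longrightarrow> (\<forall>j<int N. e j = 0)"
    "\<forall>c. (\<forall>i\<in>{0..<int N}. c $$ i = b $$ i) \<longrightarrow> (F c \<noteq> 0 \<longleftrightarrow> (\<forall>j<0. c $$ j = e j))"
    "\<forall>c. (\<forall>i\<in>{0..<int N}. c $$ i = b $$ i) \<longrightarrow> F c \<noteq> 0 \<longrightarrow>
       A ^ (H - N + 2) \<le> (cmod (F c))\<^sup>2 \<and> (cmod (F c))\<^sup>2 \<le> B ^ (H - N + 2)"
    by (rule F_structure[of "fls_nth b"])
  show ?thesis using nz e(1) e(3)[THEN spec[of _ b]] by (simp add: kball_def)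
qed

lemma F_upper: "(cmod (F b))\<^sup>2 \<le> B ^ (H - N + 2)"
proof (cases "F b = 0")
  case False
  show ?thesis by (rule F_structure[of "fls_nth b"]) (use False in blast)
qed (use one_le_B in simp)

lemma F_L2: "F \<in> L2 \<mu>"
proof (rule L2_bound[of "indicator (kball 0 (- int (H + 1)))" _ _ "sqrt (B ^ (H - N + 2))"])
  show "indicator (kball 0 (- int (H + 1))) \<in> L2 \<mu>"
    using indicator_L2[of "kball 0 (- int (H + 1))"] by simp
  show "F \<in> borel_measurable \<mu>" using F_borel by simp
  show "AE b in \<mu>. cmod (F b) \<le> sqrt (B ^ (H - N + 2)) * cmod (indicator (kball 0 (- int (H + 1))) b)"
  proof (rule AE_I2)
    fix b
    show "cmod (F b) \<le> sqrt (B ^ (H - N + 2)) * cmod (indicator (kball 0 (- int (H + 1))) b)"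
    proof (cases "F b = 0")
      case False
      then show ?thesis using F_support[OF False] F_upper[of b] by (simp add: real_le_rsqrt)
    qed (use one_le_B in simp)
  qed
qed

lemma F_periodization:
  assumes b: "b \<in> kball 0 0"
  shows "A ^ (H - N + 2) \<le> (\<Sum>l\<in>kbox (- int (H + 1)) 0. (cmod (F (b + l)))\<^sup>2)"
    and "(\<Sum>l\<in>kbox (- int (H + 1)) 0. (cmod (F (b + l)))\<^sup>2) \<le> B ^ (H - N + 2)"
proof -
  obtain e :: "int \<Rightarrow> 'a" where e: "\<forall>j < - int (H + 1). e j = 0"
    "(\<forall>i\<in>{0..<int N}. b $$ i = 0) \<longrightarrow> (\<forall>j<int N. e j = 0)"
    "\<forall>c. (\<forall>i\<in>{0..<int N}. c $$ i = b $$ i) \<longrightarrow> (F c \<noteq> 0 \<longleftrightarrow> (\<forall>j<0. c $$ j = e j))"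
    "\<forall>c. (\<forall>i\<in>{0..<int N}. c $$ i = b $$ i) \<longrightarrow> F c \<noteq> 0 \<longrightarrow>
       A ^ (H - N + 2) \<le> (cmod (F c))\<^sup>2 \<and> (cmod (F c))\<^sup>2 \<le> B ^ (H - N + 2)"
    by (rule F_structure[of "fls_nth b"])
  \<comment> \<open>The one representative that supplies the negative digits required for
    \<open>F\<close> to be nonzero; all other terms of the sum vanish.\<close>
  define l0 where "l0 = Abs_fls (\<lambda>j. if j < 0 then e j else 0)"
  have l0: "l0 $$ j = (if j < 0 then e j else 0)" for j
    unfolding l0_def by (rule nth_Abs_fls_lower_bound[of "- int (H + 1)"]) (use e(1) in auto)
  have l0_box: "l0 \<in> kbox (- int (H + 1)) 0" using e(1) by (auto simp: kbox_def l0)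
  have digits: "\<forall>i\<in>{0..<int N}. (b + l) $$ i = b $$ i" if "l \<in> kbox (- int (H + 1)) 0" for l
    using that by (simp add: kbox_def)
  have nz: "F (b + l) \<noteq> 0 \<longleftrightarrow> l = l0" if l: "l \<in> kbox (- int (H + 1)) 0" for l
  proof -
    have "F (b + l) \<noteq> 0 \<longleftrightarrow> (\<forall>j<0. (b + l) $$ j = e j)" using e(3) digits[OF l] by blast
    also have "\<dots> \<longleftrightarrow> (\<forall>j<0. l $$ j = e j)" using b by (simp add: kball_def)
    also have "\<dots> \<longleftrightarrow> l = l0"
    proof
      assume *: "\<forall>j<0. l $$ j = e j"
      show "l = l0"
      proof (rule fls_eqI)
        show "l $$ j = l0 $$ j" for j
          using * l by (cases "j < 0") (auto simp: l0 kbox_def)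
      qed
    qed (simp add: l0)
    finally show ?thesis .
  qed
  have "(\<Sum>l\<in>kbox (- int (H + 1)) 0. (cmod (F (b + l)))\<^sup>2) = (\<Sum>l\<in>{l0}. (cmod (F (b + l)))\<^sup>2)"
    using l0_box nz finite_kbox by (intro sum.mono_neutral_right) auto
  moreover have "A ^ (H - N + 2) \<le> (cmod (F (b + l0)))\<^sup>2 \<and> (cmod (F (b + l0)))\<^sup>2 \<le> B ^ (H - N + 2)"
    using e(4) digits[OF l0_box] nz[OF l0_box] by blast
  ultimately show "A ^ (H - N + 2) \<le> (\<Sum>l\<in>kbox (- int (H + 1)) 0. (cmod (F (b + l)))\<^sup>2)"
    "(\<Sum>l\<in>kbox (- int (H + 1)) 0. (cmod (F (b + l)))\<^sup>2) \<le> B ^ (H - N + 2)" by simp_all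
qed

lemma F_eq_1:
  assumes "b \<in> kball 0 (int N)"
  shows "F b = 1"
  using F_prod[of 0 b] assms by (simp add: kball_def)

text \<open>The path spelling N zeros starts at the root, so all prescribed negative digits are 0,
  which forces h = 0.\<close>

lemma F_eq_0:
  assumes b: "b \<in> kball 0 (int N)" and h: "h \<in> H0" "h \<noteq> 0"
  shows "F (b + h) = 0"
proof (rule ccontr)
  assume nz: "F (b + h) \<noteq> 0"
  obtain e :: "int \<Rightarrow> 'a" where e: "\<forall>j < - int (H + 1). e j = 0"
    "(\<forall>i\<in>{0..<int N}. (0 :: 'a) = 0) \<longrightarrow> (\<forall>j<int N. e j = 0)"
    "\<forall>c. (\<forall>i\<in>{0..<int N}. c $$ i = 0) \<longrightarrow> (F c \<noteq> 0 \<longleftrightarrow> (\<forall>j<0. c $$ j = e j))"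
    "\<forall>c. (\<forall>i\<in>{0..<int N}. c $$ i = 0) \<longrightarrow> F c \<noteq> 0 \<longrightarrow>
       A ^ (H - N + 2) \<le> (cmod (F c))\<^sup>2 \<and> (cmod (F c))\<^sup>2 \<le> B ^ (H - N + 2)"
    by (rule F_structure[of "\<lambda>_. 0"])
  have "\<forall>i\<in>{0..<int N}. (b + h) $$ i = 0" using b h(1) by (simp add: kball_def H0_eq)
  then have "\<forall>j<0. (b + h) $$ j = e j" using nz e(3) by blast
  then have "h $$ j = 0" for j
    using b h(1) e(2) N_pos by (cases "j < 0") (auto simp: kball_def H0_eq)
  then have "h = 0" by (intro fls_eqI) simp
  with h(2) show False ..
qed

text \<open>In the refinement equation the mask appears after one dilation, which moves H0 to the
  places <= -2, where the periods of \<open>m\<close> are supported.\<close>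

lemma generates:
  assumes "has_ft \<phi> F"
  shows "generates_riesz_MRA \<mu> (A ^ (H - N + 2)) (B ^ (H - N + 2)) \<phi>"
proof -
  interpret refinable \<mu> p s coord \<phi> F "\<lambda>b. m (fls_shift 1 b)" "H + 1" N
    "A ^ (H - N + 2)" "B ^ (H - N + 2)" "sqrt B"
  proof (unfold_locales)
    show "has_ft \<phi> F" by fact
    show "F (fls_shift 1 b) = m (fls_shift 1 b) * F b" for b by (rule F_refinement)
    show "(\<lambda>b. m (fls_shift 1 b)) \<in> borel_measurable borel" by measurable
    show "m (fls_shift 1 (b + h)) = m (fls_shift 1 b)" if "h \<in> H0" for h b
      using m_periodic[of "fls_shift 1 h" "fls_shift 1 b"] that by (simp add: H0_eq)
    show "cmod (m (fls_shift 1 b)) \<le> sqrt B" for b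
      using m_bounds[of "fls_shift 1 b"] one_le_B
      by (cases "m (fls_shift 1 b) = 0") (auto simp: real_le_rsqrt)
    show "0 < A ^ (H - N + 2)" "0 < B ^ (H - N + 2)" using A_pos A_le_B by simp_all
  qed (fact F_support F_eq_1 F_eq_0 F_periodization)+
  show ?thesis by (rule generates_MRA)
qed

end

text \<open>The transform determines \<phi> only up to null sets, so the conclusion is asserted for
  every function with this transform, and the existence part keeps it from being vacuous.\<close>

theorem theorem5p1:
  fixes p s N H :: nat
    and coord :: "'a::{field,finite} \<Rightarrow> nat \<Rightarrow> nat"
    and \<mu> :: "'a fls measure"
    and \<nu> :: "'a fls character measure"
    and V :: "'v set" and E :: "('v \<times> 'v) set" and r :: 'v and lab :: "'v \<Rightarrow> 'a"
    and A B :: real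
    and m0 :: "'a fls character \<Rightarrow> complex"
  assumes coords: "gf_coordinates p s coord"
    and haar_K: "is_haar_K \<mu>"
    and haar_X: "is_haar_X \<nu>"
    and N: "N \<ge> 1"
    and tree: "N_valid_tree N V E r lab"
    and H: "H = tree_height V E r"
    and AB: "0 < A" "A \<le> B"
    and m0_measurable: "m0 \<in> borel_measurable borel"
    and m0_one: "\<forall>\<xi> \<in> annihilator (Ksub (- int N)). m0 \<xi> = 1"
    and m0_nonzero: "\<forall>\<xi> \<in> annihilator (Ksub 1). m0 \<xi> \<noteq> 0 \<longleftrightarrow> \<xi> \<in> tree_set p s coord N V E lab"
    and m0_bounds: "\<forall>\<xi> \<in> tree_set p s coord N V E lab. A \<le> (cmod (m0 \<xi>))\<^sup>2 \<and> (cmod (m0 \<xi>))\<^sup>2 \<le> B"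
    and m0_periodic: "\<forall>(n::nat) (\<alpha> :: nat \<Rightarrow> 'a) \<xi>.
          m0 (\<xi> * (\<Prod>j=1..n. rademacher p s coord (int j) (\<alpha> j))) = m0 \<xi>"
  shows "(\<exists>\<phi>. has_L2_fourier \<mu> \<nu> \<phi> (\<lambda>\<xi>. \<Prod>n. m0 (char_dilation (- int n) \<xi>))) \<and>
         (\<forall>\<phi>. has_L2_fourier \<mu> \<nu> \<phi> (\<lambda>\<xi>. \<Prod>n. m0 (char_dilation (- int n) \<xi>)) \<longrightarrow>
            generates_riesz_MRA \<mu> (A ^ (H - N + 2)) (B ^ (H - N + 2)) \<phi>)"
proof -
  interpret tree_mask \<mu> p s coord N V E r lab H A B m0
    using assms by unfold_locales
  have iff: "has_L2_fourier \<mu> \<nu> \<phi> (\<lambda>\<xi>. \<Prod>n. m0 (char_dilation (- int n) \<xi>)) \<longleftrightarrow> has_ft \<phi> F" for \<phi>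
    unfolding has_L2_fourier_iff[OF haar_X] F_eq_product ..
  show ?thesis
    unfolding iff using has_ft_exists[OF F_L2] generates by blast
qed

end
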